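(* Let $\mathcal{V}$ denote either $\mathcal{M}_k$ (modules over a commutative ring $k$), or $\mathsf{Ab}$, or $\mathsf{Set}$. Let $\mathcal{C}$ be a $\mathcal{V}$-monoidal $\mathcal{V}$-category and $G\colon\mathcal{C}\to\mathcal{V}$ be a representable essentially strong monoidal $\mathcal{V}$-functor. Then there exist a monoid $R$ in $\mathcal{V}$, a right bialgebroid $A$ in $\mathcal{V}$ over $R$, a strong monoidal functor $K\colon\mathcal{C}\to\mathcal{V}_A$ and a monoidal natural isomorphism $$G\ \cong\ \Gamma^R\,\Phi^A\,K ,$$ where $\Phi^A\colon\mathcal{V}_A\to{}_R\mathcal{V}_R$ denotes the strict monoidal forgetful functor of the bialgebroid $A$ and $\Gamma^R\colon{}_R\mathcal{V}_R\to\mathcal{V}$ the monoidal forgetful functor of $R$-$R$-bimodules.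
   Context: $\mathcal{V}$ has its usual closed symmetric monoidal structure $\langle\mathcal{V},\otimes,i\rangle$ (tensor product of $k$-modules, of abelian groups, or cartesian product of sets). Functors between $\mathcal{V}$-categories are understood to be $\mathcal{V}$-functors ($k$-linear, additive, or ordinary). $\mathcal{V}$-monoidal $\mathcal{V}$-category means a $\mathcal{V}$-category with a monoidal structure $\langle\mathcal{C},\Box,e\rangle$ whose product is a $\mathcal{V}$-functor in two variables. Representable means $G\cong\mathcal{C}(g,-)$ for some object $g$, where $\mathcal{C}(a,b)\in\mathcal{V}$ denotes the hom-object. Monoidal functor means lax monoidal, with $G_{a,b}\colon Ga\otimes Gb\to G(a\Box b)$, $G_0\colon i\to Ge$; strong (strict) monoidal means these are isomorphisms (identities). Coherence isomorphisms are $\mathbf{a}_{a,b,c}\colon a\Box(b\Box c)\to(a\Box b)\Box c$, $\mathbf{l}_c\colon e\Box c\to c$, $\mathbf{r}_c\colon c\Box e\to c$ (and similarly in $\mathcal V$). Bimodules. For a monoid $R$ in $\mathcal{V}$, ${}_R\mathcal{V}_R$ is the monoidal category of $R$-$R$-bimodules in $\mathcal V$ with product $\otimes_R$ (coequalizer of the two actions $X\otimes R\otimes Y\rightrightarrows X\otimes Y$) and unit $R$. $\Gamma^R\colon{}_R\mathcal{V}_R\to\mathcal{V}$ is the forgetful functor, monoidal via the canonical epimorphisms $X\otimes Y\to X\otimes_R Y$ and the unit $i\to R$. Essentially strong. For a monoidal functor $G\colon\mathcal{C}\to\mathcal{V}$, $Ge$ is a monoid with multiplication $G\mathbf{l}_e\circ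 G_{e,e}$ and unit $G_0$, each $Gc$ is a $Ge$-$Ge$-bimodule $Uc$ with actions $G\mathbf{l}_c\circ G_{e,c}$ and $G\mathbf{r}_c\circ G_{c,e}$, and $G$ factorizes as a monoidal functor as $G=\Gamma^{Ge}U$ with $U\colon\mathcal{C}\to{}_{Ge}\mathcal{V}_{Ge}$ having $U_0$ the identity and $U_{a,b}\colon Ga\otimes_{Ge}Gb\to G(a\Box b)$ induced by $G_{a,b}$. $G$ is essentially strong monoidal if this $U$ is strong monoidal; equivalently, if every $G_{a,b}$ is a coequalizer of $Ga\otimes(G\mathbf{l}_b\circ G_{e,b})$ and $((G\mathbf{r}_a\circ G_{a,e})\otimes Gb)\circ\mathbf{a}_{Ga,Ge,Gb}$. Right bialgebroid $A$ in $\mathcal{V}$ over a monoid $R$: a monoid $A$ in $\mathcal{V}$ with monoid morphisms $s\colon R\to A$ and $t\colon R^{\mathrm{op}}\to A$ satisfying $s(r)t(r')=t(r')s(r)$, together with $R$-$R$-bimodule maps $\delta\colon A\to A\otimes_R A$ and $\varepsilon\colon A\to R$, where $A$ is an $R$-$R$-bimodule by $r\cdot a\cdot r'=a\,t(r)s(r')$, such that: (i) $\langle A,\delta,\varepsilon\rangle$ is a comonoid in ${}_R\mathcal{V}_R$; (ii) writing $\delta(a)=a_{(1)}\otimes_R a_{(2)}$, one has $s(r)a_{(1)}\otimes_R a_{(2)}=a_{(1)}\otimes_R t(r)a_{(2)}$ for all $r\in R$, i.e. $\delta$ takes values in the Takeuchi product $A\times_R A\subset A\otimes_R A$ of elements with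 this property, which is a monoid under factorwise multiplication; (iii) $\delta\colon A\to A\times_R A$ is a morphism of monoids; (iv) $\varepsilon(1_A)=1_R$ and $\varepsilon(s(\varepsilon(a))b)=\varepsilon(ab)=\varepsilon(t(\varepsilon(a))b)$ for all $a,b\in A$. $\mathcal{V}_A$ is the category of right $A$-modules in $\mathcal{V}$. Every $X\in\mathcal{V}_A$ is an $R$-$R$-bimodule via $r\cdot x\cdot r'=x\triangleleft(t(r)s(r'))$; this defines $\Phi^A$. $\mathcal{V}_A$ is monoidal, with product $X\otimes_R Y$ with action $(x\otimes_R y)\triangleleft a=(x\triangleleft a_{(1)})\otimes_R(y\triangleleft a_{(2)})$ and unit $R$ with action $r\triangleleft a=\varepsilon(s(r)a)$, so that $\Phi^A$ is strict monoidal. *)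

theory Defs
  imports "HOL-Algebra.Module" "HOL-Library.FuncSet"
begin

section \<open>The base categories: k-modules, abelian groups, sets\<close>

text \<open>
  An object of any of the three base categories is a \<open>module\<close> record.  Only the fields that
  belong to the structure at hand are meaningful: all of \<open>carrier\<close>, \<open>add\<close>, \<open>zero\<close>, \<open>smult\<close> for
  modules, the first three for abelian groups, and only \<open>carrier\<close> for sets.  (The ring fields
  \<open>mult\<close> and \<open>one\<close>, which every \<open>module\<close> record carries, are never used.)
\<close>

datatype 'k base = ModK "'k ring" | AbGrp | SetCat

fun base_ok :: "'k base \<Rightarrow> bool" where
  "base_ok (ModK k) = cring k"
| "base_ok AbGrp = True"
| "base_ok SetCat = True"

fun vobj :: "'k base \<Rightarrow> ('k, 'x) module \<Rightarrow> bool" where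
  "vobj (ModK k) X = module k X"
| "vobj AbGrp X = abelian_group X"
| "vobj SetCat X = True"

text \<open>Nothing is said about the values of the function outside the carrier here; see \<open>vhom\<close>.\<close>

fun vlin :: "'k base \<Rightarrow> ('k, 'x) module \<Rightarrow> ('k, 'y) module \<Rightarrow> ('x \<Rightarrow> 'y) \<Rightarrow> bool" where
  "vlin (ModK k) X Y f =
     (f \<in> hom (add_monoid X) (add_monoid Y) \<and>
      (\<forall>r\<in>carrier k. \<forall>x\<in>carrier X. f (r \<odot>\<^bsub>X\<^esub> x) = r \<odot>\<^bsub>Y\<^esub> f x))"
| "vlin AbGrp X Y f = (f \<in> hom (add_monoid X) (add_monoid Y))"
| "vlin SetCat X Y f = (f \<in> carrier X \<rightarrow> carrier Y)"

definition vhom :: "'k base \<Rightarrow> ('k, 'x) module \<Rightarrow> ('k, 'y) module \<Rightarrow> ('x \<Rightarrow> 'y) set" where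
  "vhom \<V> X Y = {f \<in> extensional (carrier X). vlin \<V> X Y f}"

definition vhomobj ::
    "'k base \<Rightarrow> ('k, 'x) module \<Rightarrow> ('k, 'y) module \<Rightarrow> ('k, 'x \<Rightarrow> 'y) module" where
  "vhomobj \<V> X Y =
     \<lparr>carrier = vhom \<V> X Y, mult = undefined, one = undefined,
      zero = (\<lambda>x\<in>carrier X. \<zero>\<^bsub>Y\<^esub>),
      add = (\<lambda>f g. \<lambda>x\<in>carrier X. f x \<oplus>\<^bsub>Y\<^esub> g x),
      smult = (\<lambda>r f. \<lambda>x\<in>carrier X. r \<odot>\<^bsub>Y\<^esub> f x)\<rparr>"

text \<open>Bilinear maps, biadditive maps, arbitrary functions of two variables, respectively.\<close>

definition vbilin ::
    "'k base \<Rightarrow> ('k, 'x) module \<Rightarrow> ('k, 'y) module \<Rightarrow> ('k, 'z) module \<Rightarrow> ('x \<Rightarrow> 'y \<Rightarrow> 'z) \<Rightarrow> bool"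
  where
  "vbilin \<V> X Y Z \<beta> \<longleftrightarrow>
     (\<forall>x\<in>carrier X. vlin \<V> Y Z (\<beta> x)) \<and> (\<forall>y\<in>carrier Y. vlin \<V> X Z (\<lambda>x. \<beta> x y))"


section \<open>Categories and monoidal categories enriched in the base\<close>

text \<open>
  Arrows do not carry their domain and codomain, so composition \<open>Cmp C a b c g f\<close> (for
  \<open>f : a \<rightarrow> b\<close> and \<open>g : b \<rightarrow> c\<close>), and likewise the action of functors on arrows, are indexed by
  objects.  The hom-object \<open>Hom C a b\<close> is an object of the base.
\<close>

record ('k, 'o, 'h) vcat =
  Obj :: "'o set"
  Hom :: "'o \<Rightarrow> 'o \<Rightarrow> ('k, 'h) module"
  Cmp :: "'o \<Rightarrow> 'o \<Rightarrow> 'o \<Rightarrow> 'h \<Rightarrow> 'h \<Rightarrow> 'h"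
  Ide :: "'o \<Rightarrow> 'h"

abbreviation arr :: "('k, 'o, 'h, 'm) vcat_scheme \<Rightarrow> 'o \<Rightarrow> 'o \<Rightarrow> 'h set" where
  "arr C a b \<equiv> carrier (Hom C a b)"

text \<open>
  That composition is bilinear says that it is a morphism from the tensor product
  \<open>C(b,c) \<otimes> C(a,b)\<close> to \<open>C(a,c)\<close>.
\<close>

definition vcategory :: "'k base \<Rightarrow> ('k, 'o, 'h, 'm) vcat_scheme \<Rightarrow> bool" where
  "vcategory \<V> C \<longleftrightarrow>
     (\<forall>a\<in>Obj C. \<forall>b\<in>Obj C. vobj \<V> (Hom C a b)) \<and>
     (\<forall>a\<in>Obj C. \<forall>b\<in>Obj C. \<forall>c\<in>Obj C.
        vbilin \<V> (Hom C b c) (Hom C a b) (Hom C a c) (Cmp C a b c)) \<and>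
     (\<forall>a\<in>Obj C. Ide C a \<in> arr C a a) \<and>
     (\<forall>a\<in>Obj C. \<forall>b\<in>Obj C. \<forall>f\<in>arr C a b.
        Cmp C a a b f (Ide C a) = f \<and> Cmp C a b b (Ide C b) f = f) \<and>
     (\<forall>a\<in>Obj C. \<forall>b\<in>Obj C. \<forall>c\<in>Obj C. \<forall>d\<in>Obj C.
        \<forall>f\<in>arr C a b. \<forall>g\<in>arr C b c. \<forall>h\<in>arr C c d.
          Cmp C a b d (Cmp C b c d h g) f = Cmp C a c d h (Cmp C a b c g f))"

definition is_iso :: "('k, 'o, 'h, 'm) vcat_scheme \<Rightarrow> 'o \<Rightarrow> 'o \<Rightarrow> 'h \<Rightarrow> bool" where
  "is_iso C a b f \<longleftrightarrow> f \<in> arr C a b \<and>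
     (\<exists>g\<in>arr C b a. Cmp C a b a g f = Ide C a \<and> Cmp C b a b f g = Ide C b)"

text \<open>
  For \<open>f : a \<rightarrow> a'\<close> and \<open>g : b \<rightarrow> b'\<close>, the product of arrows is \<open>TenH C a a' b b' f g\<close>.  The
  associator \<open>Asc C a b c\<close> goes from \<open>a \<box> (b \<box> c)\<close> to \<open>(a \<box> b) \<box> c\<close>.
\<close>

record ('k, 'o, 'h) moncat = "('k, 'o, 'h) vcat" +
  Ten :: "'o \<Rightarrow> 'o \<Rightarrow> 'o"
  TenH :: "'o \<Rightarrow> 'o \<Rightarrow> 'o \<Rightarrow> 'o \<Rightarrow> 'h \<Rightarrow> 'h \<Rightarrow> 'h"
  Unt :: "'o"
  Asc :: "'o \<Rightarrow> 'o \<Rightarrow> 'o \<Rightarrow> 'h"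
  Lun :: "'o \<Rightarrow> 'h"
  Run :: "'o \<Rightarrow> 'h"

abbreviation whiskl :: "('k, 'o, 'h) moncat \<Rightarrow> 'o \<Rightarrow> 'o \<Rightarrow> 'o \<Rightarrow> 'h \<Rightarrow> 'h" where
  "whiskl C a b b' g \<equiv> TenH C a a b b' (Ide C a) g"

abbreviation whiskr :: "('k, 'o, 'h) moncat \<Rightarrow> 'o \<Rightarrow> 'o \<Rightarrow> 'o \<Rightarrow> 'h \<Rightarrow> 'h" where
  "whiskr C a a' b f \<equiv> TenH C a a' b b f (Ide C b)"

definition vbifunctor :: "'k base \<Rightarrow> ('k, 'o, 'h) moncat \<Rightarrow> bool" where
  "vbifunctor \<V> C \<longleftrightarrow>
     (\<forall>a\<in>Obj C. \<forall>b\<in>Obj C. Ten C a b \<in> Obj C) \<and>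
     (\<forall>a\<in>Obj C. \<forall>a'\<in>Obj C. \<forall>b\<in>Obj C. \<forall>b'\<in>Obj C.
        vbilin \<V> (Hom C a a') (Hom C b b') (Hom C (Ten C a b) (Ten C a' b')) (TenH C a a' b b')) \<and>
     (\<forall>a\<in>Obj C. \<forall>b\<in>Obj C. TenH C a a b b (Ide C a) (Ide C b) = Ide C (Ten C a b)) \<and>
     (\<forall>a\<in>Obj C. \<forall>a'\<in>Obj C. \<forall>a''\<in>Obj C. \<forall>b\<in>Obj C. \<forall>b'\<in>Obj C. \<forall>b''\<in>Obj C.
        \<forall>f\<in>arr C a a'. \<forall>f'\<in>arr C a' a''. \<forall>g\<in>arr C b b'. \<forall>g'\<in>arr C b' b''.
          TenH C a a'' b b'' (Cmp C a a' a'' f' f) (Cmp C b b' b'' g' g) =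
          Cmp C (Ten C a b) (Ten C a' b') (Ten C a'' b'')
            (TenH C a' a'' b' b'' f' g') (TenH C a a' b b' f g))"

definition vmonoidal_category :: "'k base \<Rightarrow> ('k, 'o, 'h) moncat \<Rightarrow> bool" where
  "vmonoidal_category \<V> C \<longleftrightarrow>
     vcategory \<V> C \<and> vbifunctor \<V> C \<and> Unt C \<in> Obj C \<and>
     (\<comment> \<open>coherence isomorphisms\<close>
      \<forall>a\<in>Obj C. \<forall>b\<in>Obj C. \<forall>c\<in>Obj C.
        is_iso C (Ten C a (Ten C b c)) (Ten C (Ten C a b) c) (Asc C a b c)) \<and>
     (\<forall>c\<in>Obj C. is_iso C (Ten C (Unt C) c) c (Lun C c) \<and> is_iso C (Ten C c (Unt C)) c (Run C c)) \<and>
     (\<comment> \<open>naturality\<close>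
      \<forall>a\<in>Obj C. \<forall>a'\<in>Obj C. \<forall>b\<in>Obj C. \<forall>b'\<in>Obj C. \<forall>c\<in>Obj C. \<forall>c'\<in>Obj C.
        \<forall>f\<in>arr C a a'. \<forall>g\<in>arr C b b'. \<forall>h\<in>arr C c c'.
          Cmp C (Ten C a (Ten C b c)) (Ten C a' (Ten C b' c')) (Ten C (Ten C a' b') c')
            (Asc C a' b' c')
            (TenH C a a' (Ten C b c) (Ten C b' c') f (TenH C b b' c c' g h)) =
          Cmp C (Ten C a (Ten C b c)) (Ten C (Ten C a b) c) (Ten C (Ten C a' b') c')
            (TenH C (Ten C a b) (Ten C a' b') c c' (TenH C a a' b b' f g) h)
            (Asc C a b c)) \<and>
     (\<forall>c\<in>Obj C. \<forall>c'\<in>Obj C. \<forall>h\<in>arr C c c'.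
        Cmp C (Ten C (Unt C) c) (Ten C (Unt C) c') c' (Lun C c') (whiskl C (Unt C) c c' h) =
        Cmp C (Ten C (Unt C) c) c c' h (Lun C c) \<and>
        Cmp C (Ten C c (Unt C)) (Ten C c' (Unt C)) c' (Run C c') (whiskr C c c' (Unt C) h) =
        Cmp C (Ten C c (Unt C)) c c' h (Run C c)) \<and>
     (\<comment> \<open>pentagon\<close>
      \<forall>a\<in>Obj C. \<forall>b\<in>Obj C. \<forall>c\<in>Obj C. \<forall>d\<in>Obj C.
        Cmp C (Ten C a (Ten C b (Ten C c d))) (Ten C (Ten C a b) (Ten C c d))
            (Ten C (Ten C (Ten C a b) c) d)
          (Asc C (Ten C a b) c d) (Asc C a b (Ten C c d)) =
        Cmp C (Ten C a (Ten C b (Ten C c d))) (Ten C (Ten C a (Ten C b c)) d)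
            (Ten C (Ten C (Ten C a b) c) d)
          (whiskr C (Ten C a (Ten C b c)) (Ten C (Ten C a b) c) d (Asc C a b c))
          (Cmp C (Ten C a (Ten C b (Ten C c d))) (Ten C a (Ten C (Ten C b c) d))
              (Ten C (Ten C a (Ten C b c)) d)
            (Asc C a (Ten C b c) d)
            (whiskl C a (Ten C b (Ten C c d)) (Ten C (Ten C b c) d) (Asc C b c d)))) \<and>
     (\<comment> \<open>triangle\<close>
      \<forall>a\<in>Obj C. \<forall>b\<in>Obj C.
        Cmp C (Ten C a (Ten C (Unt C) b)) (Ten C (Ten C a (Unt C)) b) (Ten C a b)
          (whiskr C (Ten C a (Unt C)) a b (Run C a)) (Asc C a (Unt C) b) =
        whiskl C a (Ten C (Unt C) b) b (Lun C b))"


section \<open>Functors, monoidal functors and their natural isomorphisms\<close>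

record ('o, 'h, 'p, 'l) vfun =
  FO :: "'o \<Rightarrow> 'p"
  FA :: "'o \<Rightarrow> 'o \<Rightarrow> 'h \<Rightarrow> 'l"

record ('o, 'h, 'p, 'l) monfun = "('o, 'h, 'p, 'l) vfun" +
  F2 :: "'o \<Rightarrow> 'o \<Rightarrow> 'l"
  F0 :: "'l"

definition vfunctor ::
    "'k base \<Rightarrow> ('k, 'o, 'h, 'm) vcat_scheme \<Rightarrow> ('k, 'p, 'l, 'n) vcat_scheme
      \<Rightarrow> ('o, 'h, 'p, 'l, 'r) vfun_scheme \<Rightarrow> bool" where
  "vfunctor \<V> C D F \<longleftrightarrow>
     (\<forall>a\<in>Obj C. FO F a \<in> Obj D) \<and>
     (\<forall>a\<in>Obj C. \<forall>b\<in>Obj C. vlin \<V> (Hom C a b) (Hom D (FO F a) (FO F b)) (FA F a b)) \<and>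
     (\<forall>a\<in>Obj C. FA F a a (Ide C a) = Ide D (FO F a)) \<and>
     (\<forall>a\<in>Obj C. \<forall>b\<in>Obj C. \<forall>c\<in>Obj C. \<forall>f\<in>arr C a b. \<forall>g\<in>arr C b c.
        FA F a c (Cmp C a b c g f) =
        Cmp D (FO F a) (FO F b) (FO F c) (FA F b c g) (FA F a b f))"

definition nat_iso ::
    "('k, 'o, 'h, 'm) vcat_scheme \<Rightarrow> ('k, 'p, 'l, 'n) vcat_scheme
      \<Rightarrow> ('o, 'h, 'p, 'l, 'r) vfun_scheme \<Rightarrow> ('o, 'h, 'p, 'l, 's) vfun_scheme
      \<Rightarrow> ('o \<Rightarrow> 'l) \<Rightarrow> bool" where
  "nat_iso C D F G \<theta> \<longleftrightarrow>
     (\<forall>a\<in>Obj C. is_iso D (FO F a) (FO G a) (\<theta> a)) \<and>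
     (\<forall>a\<in>Obj C. \<forall>b\<in>Obj C. \<forall>f\<in>arr C a b.
        Cmp D (FO F a) (FO F b) (FO G b) (\<theta> b) (FA F a b f) =
        Cmp D (FO F a) (FO G a) (FO G b) (FA G a b f) (\<theta> a))"

definition monoidal_functor ::
    "'k base \<Rightarrow> ('k, 'o, 'h) moncat \<Rightarrow> ('k, 'p, 'l) moncat \<Rightarrow> ('o, 'h, 'p, 'l) monfun \<Rightarrow> bool" where
  "monoidal_functor \<V> C D F \<longleftrightarrow>
     vfunctor \<V> C D F \<and>
     (\<forall>a\<in>Obj C. \<forall>b\<in>Obj C. F2 F a b \<in> arr D (Ten D (FO F a) (FO F b)) (FO F (Ten C a b))) \<and>
     F0 F \<in> arr D (Unt D) (FO F (Unt C)) \<and>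
     (\<comment> \<open>naturality\<close>
      \<forall>a\<in>Obj C. \<forall>a'\<in>Obj C. \<forall>b\<in>Obj C. \<forall>b'\<in>Obj C. \<forall>f\<in>arr C a a'. \<forall>g\<in>arr C b b'.
        Cmp D (Ten D (FO F a) (FO F b)) (Ten D (FO F a') (FO F b')) (FO F (Ten C a' b'))
          (F2 F a' b') (TenH D (FO F a) (FO F a') (FO F b) (FO F b') (FA F a a' f) (FA F b b' g)) =
        Cmp D (Ten D (FO F a) (FO F b)) (FO F (Ten C a b)) (FO F (Ten C a' b'))
          (FA F (Ten C a b) (Ten C a' b') (TenH C a a' b b' f g)) (F2 F a b)) \<and>
     (\<comment> \<open>associativity\<close>
      \<forall>a\<in>Obj C. \<forall>b\<in>Obj C. \<forall>c\<in>Obj C.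
        let x = FO F a; y = FO F b; z = FO F c; src = Ten D x (Ten D y z);
            tgt = FO F (Ten C (Ten C a b) c)
        in Cmp D src (FO F (Ten C a (Ten C b c))) tgt
             (FA F (Ten C a (Ten C b c)) (Ten C (Ten C a b) c) (Asc C a b c))
             (Cmp D src (Ten D x (FO F (Ten C b c))) (FO F (Ten C a (Ten C b c)))
               (F2 F a (Ten C b c))
               (whiskl D x (Ten D y z) (FO F (Ten C b c)) (F2 F b c))) =
           Cmp D src (Ten D (FO F (Ten C a b)) z) tgt
             (F2 F (Ten C a b) c)
             (Cmp D src (Ten D (Ten D x y) z) (Ten D (FO F (Ten C a b)) z)
               (whiskr D (Ten D x y) (FO F (Ten C a b)) z (F2 F a b))
               (Asc D x y z))) \<and>
     (\<comment> \<open>unit\<close>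
      \<forall>c\<in>Obj C.
        let z = FO F c; e = Unt C; Fe = FO F (Unt C); i = Unt D
        in Cmp D (Ten D i z) (FO F (Ten C e c)) z (FA F (Ten C e c) c (Lun C c))
             (Cmp D (Ten D i z) (Ten D Fe z) (FO F (Ten C e c)) (F2 F e c) (whiskr D i Fe z (F0 F))) =
           Lun D z \<and>
           Cmp D (Ten D z i) (FO F (Ten C c e)) z (FA F (Ten C c e) c (Run C c))
             (Cmp D (Ten D z i) (Ten D z Fe) (FO F (Ten C c e)) (F2 F c e) (whiskl D z i Fe (F0 F))) =
           Run D z)"

definition strong_monoidal_functor ::
    "'k base \<Rightarrow> ('k, 'o, 'h) moncat \<Rightarrow> ('k, 'p, 'l) moncat \<Rightarrow> ('o, 'h, 'p, 'l) monfun \<Rightarrow> bool" where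
  "strong_monoidal_functor \<V> C D F \<longleftrightarrow>
     monoidal_functor \<V> C D F \<and>
     (\<forall>a\<in>Obj C. \<forall>b\<in>Obj C. is_iso D (Ten D (FO F a) (FO F b)) (FO F (Ten C a b)) (F2 F a b)) \<and>
     is_iso D (Unt D) (FO F (Unt C)) (F0 F)"

text \<open>The composite \<open>G F\<close> of monoidal functors \<open>F : C \<rightarrow> D\<close> and \<open>G : D \<rightarrow> E\<close>.\<close>

definition monfun_comp ::
    "('k, 'o, 'h) moncat \<Rightarrow> ('k, 'p, 'l) moncat \<Rightarrow> ('k, 'q, 'j) moncat
      \<Rightarrow> ('p, 'l, 'q, 'j) monfun \<Rightarrow> ('o, 'h, 'p, 'l) monfun \<Rightarrow> ('o, 'h, 'q, 'j) monfun" where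
  "monfun_comp C D E G F =
     \<lparr>FO = (\<lambda>a. FO G (FO F a)),
      FA = (\<lambda>a b f. FA G (FO F a) (FO F b) (FA F a b f)),
      F2 = (\<lambda>a b. Cmp E (Ten E (FO G (FO F a)) (FO G (FO F b))) (FO G (Ten D (FO F a) (FO F b)))
                     (FO G (FO F (Ten C a b)))
                   (FA G (Ten D (FO F a) (FO F b)) (FO F (Ten C a b)) (F2 F a b))
                   (F2 G (FO F a) (FO F b))),
      F0 = Cmp E (Unt E) (FO G (Unt D)) (FO G (FO F (Unt C)))
             (FA G (Unt D) (FO F (Unt C)) (F0 F)) (F0 G)\<rparr>"

definition monoidal_nat_iso ::
    "('k, 'o, 'h) moncat \<Rightarrow> ('k, 'p, 'l) moncat
      \<Rightarrow> ('o, 'h, 'p, 'l) monfun \<Rightarrow> ('o, 'h, 'p, 'l) monfun \<Rightarrow> ('o \<Rightarrow> 'l) \<Rightarrow> bool" where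
  "monoidal_nat_iso C D F G \<theta> \<longleftrightarrow>
     nat_iso C D F G \<theta> \<and>
     (\<forall>a\<in>Obj C. \<forall>b\<in>Obj C.
        Cmp D (Ten D (FO F a) (FO F b)) (FO F (Ten C a b)) (FO G (Ten C a b))
          (\<theta> (Ten C a b)) (F2 F a b) =
        Cmp D (Ten D (FO F a) (FO F b)) (Ten D (FO G a) (FO G b)) (FO G (Ten C a b))
          (F2 G a b) (TenH D (FO F a) (FO G a) (FO F b) (FO G b) (\<theta> a) (\<theta> b))) \<and>
     Cmp D (Unt D) (FO F (Unt C)) (FO G (Unt C)) (\<theta> (Unt C)) (F0 F) = F0 G"


section \<open>The base as a monoidal category\<close>

text \<open>
  HOL has no category of all modules; the base category consists of the objects whose carrier is
  a subset of a fixed type \<open>'v\<close>.  Its tensor product is only determined up to isomorphism, and we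
  work with an arbitrary choice of it: \<open>tobj T X Y\<close> is the tensor product of \<open>X\<close> and \<open>Y\<close>,
  \<open>tel T X Y x y\<close> its element \<open>x \<otimes> y\<close>, and \<open>uobj T\<close> is a copy of the unit object (the regular
  module \<open>k\<close>, the group of integers, the one-element set), whose generator \<open>1\<close> is \<open>uel T\<close>.
  Such a choice exists whenever \<open>'v\<close> is infinite and, in the case of modules, at least as large
  as the carrier of \<open>k\<close>, since tensor products then have at most as many elements as \<open>'v\<close>.
\<close>

record ('k, 'v) tensor_data =
  tobj :: "('k, 'v) module \<Rightarrow> ('k, 'v) module \<Rightarrow> ('k, 'v) module"
  tel :: "('k, 'v) module \<Rightarrow> ('k, 'v) module \<Rightarrow> 'v \<Rightarrow> 'v \<Rightarrow> 'v"
  uobj :: "('k, 'v) module"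
  uel :: "'v"

definition universal_bilin ::
    "'k base \<Rightarrow> ('k, 'v) module \<Rightarrow> ('k, 'v) module \<Rightarrow> ('k, 'v) module \<Rightarrow> ('v \<Rightarrow> 'v \<Rightarrow> 'v) \<Rightarrow> bool"
  where
  "universal_bilin \<V> X Y P \<tau> \<longleftrightarrow>
     vobj \<V> P \<and> vbilin \<V> X Y P \<tau> \<and>
     (\<forall>(Z :: ('k, 'v) module) \<beta>. vobj \<V> Z \<and> vbilin \<V> X Y Z \<beta> \<longrightarrow>
        (\<exists>!f. f \<in> vhom \<V> P Z \<and> (\<forall>x\<in>carrier X. \<forall>y\<in>carrier Y. f (\<tau> x y) = \<beta> x y)))"

fun is_tensor ::
    "'k base \<Rightarrow> ('k, 'v) module \<Rightarrow> ('k, 'v) module \<Rightarrow> ('k, 'v) module \<Rightarrow> ('v \<Rightarrow> 'v \<Rightarrow> 'v) \<Rightarrow> bool"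
  where
  "is_tensor (ModK k) X Y P \<tau> = universal_bilin (ModK k) X Y P \<tau>"
| "is_tensor AbGrp X Y P \<tau> = universal_bilin AbGrp X Y P \<tau>"
| "is_tensor SetCat X Y P \<tau> =
     bij_betw (\<lambda>(x, y). \<tau> x y) (carrier X \<times> carrier Y) (carrier P)"

fun is_unit_object :: "'k base \<Rightarrow> ('k, 'v) module \<Rightarrow> 'v \<Rightarrow> bool" where
  "is_unit_object (ModK k) I u =
     (module k I \<and> u \<in> carrier I \<and> bij_betw (\<lambda>r. r \<odot>\<^bsub>I\<^esub> u) (carrier k) (carrier I))"
| "is_unit_object AbGrp I u =
     (abelian_group I \<and> u \<in> carrier I \<and>
      bij_betw (\<lambda>n::int. add_pow I n u) UNIV (carrier I))"
| "is_unit_object SetCat I u = (carrier I = {u})"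

definition usual_tensor :: "'k base \<Rightarrow> ('k, 'v) tensor_data \<Rightarrow> bool" where
  "usual_tensor \<V> T \<longleftrightarrow>
     (\<forall>X Y. vobj \<V> X \<and> vobj \<V> Y \<longrightarrow> is_tensor \<V> X Y (tobj T X Y) (tel T X Y)) \<and>
     is_unit_object \<V> (uobj T) (uel T)"

definition tlift ::
    "'k base \<Rightarrow> ('k, 'v) tensor_data \<Rightarrow> ('k, 'v) module \<Rightarrow> ('k, 'v) module \<Rightarrow> ('k, 'v) module
      \<Rightarrow> ('v \<Rightarrow> 'v \<Rightarrow> 'v) \<Rightarrow> 'v \<Rightarrow> 'v" where
  "tlift \<V> T X Y Z \<beta> =
     (THE f. f \<in> vhom \<V> (tobj T X Y) Z \<and>
        (\<forall>x\<in>carrier X. \<forall>y\<in>carrier Y. f (tel T X Y x y) = \<beta> x y))"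

text \<open>
  The unit constraints are determined by \<open>1 \<otimes> x \<mapsto> x\<close> and \<open>x \<otimes> 1 \<mapsto> x\<close>, because \<open>1\<close> generates the
  unit object.
\<close>

definition base_cat ::
    "'k base \<Rightarrow> ('k, 'v) tensor_data \<Rightarrow> ('k, ('k, 'v) module, 'v \<Rightarrow> 'v) moncat" where
  "base_cat \<V> T =
     \<lparr>Obj = {X. vobj \<V> X},
      Hom = vhomobj \<V>,
      Cmp = (\<lambda>X Y Z g f. compose (carrier X) g f),
      Ide = (\<lambda>X. \<lambda>x\<in>carrier X. x),
      Ten = tobj T,
      TenH = (\<lambda>X X' Y Y' f g.
        tlift \<V> T X Y (tobj T X' Y') (\<lambda>x y. tel T X' Y' (f x) (g y))),
      Unt = uobj T,
      Asc = (\<lambda>X Y Z. THE f.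
        f \<in> vhom \<V> (tobj T X (tobj T Y Z)) (tobj T (tobj T X Y) Z) \<and>
        (\<forall>x\<in>carrier X. \<forall>y\<in>carrier Y. \<forall>z\<in>carrier Z.
           f (tel T X (tobj T Y Z) x (tel T Y Z y z)) =
           tel T (tobj T X Y) Z (tel T X Y x y) z)),
      Lun = (\<lambda>X. THE f. f \<in> vhom \<V> (tobj T (uobj T) X) X \<and>
        (\<forall>x\<in>carrier X. f (tel T (uobj T) X (uel T) x) = x)),
      Run = (\<lambda>X. THE f. f \<in> vhom \<V> (tobj T X (uobj T)) X \<and>
        (\<forall>x\<in>carrier X. f (tel T X (uobj T) x (uel T)) = x))\<rparr>"

definition hom_functor ::
    "('k, 'o, 'v, 'm) vcat_scheme \<Rightarrow> 'o \<Rightarrow> ('o, 'v, ('k, 'v) module, 'v \<Rightarrow> 'v) vfun" where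
  "hom_functor C g =
     \<lparr>FO = (\<lambda>c. Hom C g c),
      FA = (\<lambda>a b f. \<lambda>h\<in>arr C g a. Cmp C g a b f h)\<rparr>"

definition representable ::
    "'k base \<Rightarrow> ('k, 'v) tensor_data \<Rightarrow> ('k, 'o, 'v, 'm) vcat_scheme
      \<Rightarrow> ('o, 'v, ('k, 'v) module, 'v \<Rightarrow> 'v, 'r) vfun_scheme \<Rightarrow> bool" where
  "representable \<V> T C G \<longleftrightarrow>
     (\<exists>g\<in>Obj C. \<exists>\<theta>. nat_iso C (base_cat \<V> T) G (hom_functor C g) \<theta>)"


section \<open>Monoids, comonoids, bimodules and modules in a monoidal category\<close>

record ('o, 'h) mon =
  mob :: "'o"
  mmu :: "'h"
  mun :: "'h"

definition is_monoid :: "('k, 'o, 'h) moncat \<Rightarrow> ('o, 'h) mon \<Rightarrow> bool" where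
  "is_monoid M R \<longleftrightarrow>
     (let X = mob R; XX = Ten M X X; m = mmu R; n = mun R; e = Unt M
      in X \<in> Obj M \<and> m \<in> arr M XX X \<and> n \<in> arr M e X \<and>
         Cmp M (Ten M X XX) XX X m (whiskl M X XX X m) =
         Cmp M (Ten M X XX) XX X m
           (Cmp M (Ten M X XX) (Ten M XX X) XX (whiskr M XX X X m) (Asc M X X X)) \<and>
         Cmp M (Ten M e X) XX X m (whiskr M e X X n) = Lun M X \<and>
         Cmp M (Ten M X e) XX X m (whiskl M X e X n) = Run M X)"

definition monoid_morphism ::
    "('k, 'o, 'h) moncat \<Rightarrow> ('o, 'h) mon \<Rightarrow> ('o, 'h) mon \<Rightarrow> 'h \<Rightarrow> bool" where
  "monoid_morphism M R S f \<longleftrightarrow>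
     (let X = mob R; Y = mob S
      in f \<in> arr M X Y \<and>
         Cmp M (Ten M X X) X Y f (mmu R) =
         Cmp M (Ten M X X) (Ten M Y Y) Y (mmu S) (TenH M X Y X Y f f) \<and>
         Cmp M (Unt M) X Y f (mun R) = mun S)"

definition is_comonoid :: "('k, 'o, 'h) moncat \<Rightarrow> 'o \<Rightarrow> 'h \<Rightarrow> 'h \<Rightarrow> bool" where
  "is_comonoid M X d n \<longleftrightarrow>
     (let XX = Ten M X X; e = Unt M
      in X \<in> Obj M \<and> d \<in> arr M X XX \<and> n \<in> arr M X e \<and>
         Cmp M X (Ten M X XX) (Ten M XX X) (Asc M X X X)
           (Cmp M X XX (Ten M X XX) (whiskl M X X XX d) d) =
         Cmp M X XX (Ten M XX X) (whiskr M X XX X d) d \<and>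
         Cmp M X (Ten M e X) X (Lun M X) (Cmp M X XX (Ten M e X) (whiskr M X e X n) d) = Ide M X \<and>
         Cmp M X (Ten M X e) X (Run M X) (Cmp M X XX (Ten M X e) (whiskl M X X e n) d) = Ide M X)"

record ('o, 'h) bimod =
  bob :: "'o"
  blact :: "'h"
  bract :: "'h"

definition is_bimodule :: "('k, 'o, 'h) moncat \<Rightarrow> ('o, 'h) mon \<Rightarrow> ('o, 'h) bimod \<Rightarrow> bool" where
  "is_bimodule M R B \<longleftrightarrow>
     (let r = mob R; m = mmu R; n = mun R; e = Unt M; x = bob B; l = blact B; p = bract B;
          rx = Ten M r x; xr = Ten M x r; rr = Ten M r r
      in x \<in> Obj M \<and> l \<in> arr M rx x \<and> p \<in> arr M xr x \<and>
         Cmp M (Ten M r rx) rx x l (whiskl M r rx x l) =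
         Cmp M (Ten M r rx) rx x l
           (Cmp M (Ten M r rx) (Ten M rr x) rx (whiskr M rr r x m) (Asc M r r x)) \<and>
         Cmp M (Ten M e x) rx x l (whiskr M e r x n) = Lun M x \<and>
         Cmp M (Ten M x rr) xr x p (whiskl M x rr r m) =
         Cmp M (Ten M x rr) xr x p
           (Cmp M (Ten M x rr) (Ten M xr r) xr (whiskr M xr x r p) (Asc M x r r)) \<and>
         Cmp M (Ten M x e) xr x p (whiskl M x e r n) = Run M x \<and>
         Cmp M (Ten M r xr) rx x l (whiskl M r xr x p) =
         Cmp M (Ten M r xr) xr x p
           (Cmp M (Ten M r xr) (Ten M rx r) xr (whiskr M rx x r l) (Asc M r x r)))"

definition bimodule_maps ::
    "('k, 'o, 'h) moncat \<Rightarrow> ('o, 'h) mon \<Rightarrow> ('o, 'h) bimod \<Rightarrow> ('o, 'h) bimod \<Rightarrow> 'h set" where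
  "bimodule_maps M R B B' =
     {f \<in> arr M (bob B) (bob B').
        Cmp M (Ten M (mob R) (bob B)) (bob B) (bob B') f (blact B) =
        Cmp M (Ten M (mob R) (bob B)) (Ten M (mob R) (bob B')) (bob B')
          (blact B') (whiskl M (mob R) (bob B) (bob B') f) \<and>
        Cmp M (Ten M (bob B) (mob R)) (bob B) (bob B') f (bract B) =
        Cmp M (Ten M (bob B) (mob R)) (Ten M (bob B') (mob R)) (bob B')
          (bract B') (whiskr M (bob B) (bob B') (mob R) f)}"

definition is_coequalizer ::
    "('k, 'o, 'h, 'm) vcat_scheme \<Rightarrow> 'o \<Rightarrow> 'o \<Rightarrow> 'h \<Rightarrow> 'h \<Rightarrow> 'o \<Rightarrow> 'h \<Rightarrow> bool" where
  "is_coequalizer M x y f g z q \<longleftrightarrow>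
     z \<in> Obj M \<and> q \<in> arr M y z \<and> Cmp M x y z q f = Cmp M x y z q g \<and>
     (\<forall>w\<in>Obj M. \<forall>h\<in>arr M y w. Cmp M x y w h f = Cmp M x y w h g \<longrightarrow>
        (\<exists>!k. k \<in> arr M z w \<and> Cmp M y z w k q = h))"

text \<open>
  The tensor product over \<open>R\<close> and the canonical epimorphism onto it: a chosen coequalizer of the
  two actions \<open>X \<otimes> (R \<otimes> Y) \<rightarrow> X \<otimes> Y\<close>.
\<close>

definition balanced ::
    "('k, 'o, 'h) moncat \<Rightarrow> ('o, 'h) mon \<Rightarrow> ('o, 'h) bimod \<Rightarrow> ('o, 'h) bimod \<Rightarrow> 'o \<times> 'h" where
  "balanced M R B B' =
     (let r = mob R; x = bob B; y = bob B'; xry = Ten M x (Ten M r y); xy = Ten M x y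
      in SOME zq. is_coequalizer M xry xy
           (whiskl M x (Ten M r y) y (blact B'))
           (Cmp M xry (Ten M (Ten M x r) y) xy (whiskr M (Ten M x r) x y (bract B)) (Asc M x r y))
           (fst zq) (snd zq))"

abbreviation "bten M R B B' \<equiv> fst (balanced M R B B')"
abbreviation "bepi M R B B' \<equiv> snd (balanced M R B B')"

text \<open>
  \<open>R\<close> acts on the tensor product over \<open>R\<close> from the left through the first factor and from the
  right through the second one; the right action is stated without inverting the associator.
\<close>

definition bim_ten ::
    "('k, 'o, 'h) moncat \<Rightarrow> ('o, 'h) mon \<Rightarrow> ('o, 'h) bimod \<Rightarrow> ('o, 'h) bimod \<Rightarrow> ('o, 'h) bimod" where
  "bim_ten M R B B' =
     (let r = mob R; x = bob B; y = bob B'; xy = Ten M x y; z = bten M R B B'; q = bepi M R B B'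
      in \<lparr>bob = z,
          blact = (THE l. l \<in> arr M (Ten M r z) z \<and>
            Cmp M (Ten M r xy) (Ten M r z) z l (whiskl M r xy z q) =
            Cmp M (Ten M r xy) xy z q
              (Cmp M (Ten M r xy) (Ten M (Ten M r x) y) xy
                (whiskr M (Ten M r x) x y (blact B)) (Asc M r x y))),
          bract = (THE p. p \<in> arr M (Ten M z r) z \<and>
            Cmp M (Ten M x (Ten M y r)) (Ten M z r) z p
              (Cmp M (Ten M x (Ten M y r)) (Ten M xy r) (Ten M z r)
                (whiskr M xy z r q) (Asc M x y r)) =
            Cmp M (Ten M x (Ten M y r)) xy z q (whiskl M x (Ten M y r) y (bract B')))\<rparr>)"

definition bimod_cat ::
    "('k, 'o, 'h) moncat \<Rightarrow> ('o, 'h) mon \<Rightarrow> ('k, ('o, 'h) bimod, 'h) moncat" where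
  "bimod_cat M R =
     \<lparr>Obj = {B. is_bimodule M R B},
      Hom = (\<lambda>B B'. (Hom M (bob B) (bob B'))\<lparr>carrier := bimodule_maps M R B B'\<rparr>),
      Cmp = (\<lambda>B B' B''. Cmp M (bob B) (bob B') (bob B'')),
      Ide = (\<lambda>B. Ide M (bob B)),
      Ten = bim_ten M R,
      TenH = (\<lambda>B1 B1' B2 B2' f g. THE h.
        h \<in> arr M (bten M R B1 B2) (bten M R B1' B2') \<and>
        Cmp M (Ten M (bob B1) (bob B2)) (bten M R B1 B2) (bten M R B1' B2') h (bepi M R B1 B2) =
        Cmp M (Ten M (bob B1) (bob B2)) (Ten M (bob B1') (bob B2')) (bten M R B1' B2')
          (bepi M R B1' B2') (TenH M (bob B1) (bob B1') (bob B2) (bob B2') f g)),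
      Unt = \<lparr>bob = mob R, blact = mmu R, bract = mmu R\<rparr>,
      Asc = (\<lambda>B1 B2 B3.
        let x = bob B1; y = bob B2; z = bob B3;
            yz = bten M R B2 B3; xy = bten M R B1 B2;
            src = bten M R B1 (bim_ten M R B2 B3); tgt = bten M R (bim_ten M R B1 B2) B3
        in THE h. h \<in> arr M src tgt \<and>
          Cmp M (Ten M x (Ten M y z)) src tgt h
            (Cmp M (Ten M x (Ten M y z)) (Ten M x yz) src
              (bepi M R B1 (bim_ten M R B2 B3)) (whiskl M x (Ten M y z) yz (bepi M R B2 B3))) =
          Cmp M (Ten M x (Ten M y z)) (Ten M xy z) tgt
            (bepi M R (bim_ten M R B1 B2) B3)
            (Cmp M (Ten M x (Ten M y z)) (Ten M (Ten M x y) z) (Ten M xy z)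
              (whiskr M (Ten M x y) xy z (bepi M R B1 B2)) (Asc M x y z))),
      Lun = (\<lambda>B.
        let U = \<lparr>bob = mob R, blact = mmu R, bract = mmu R\<rparr>
        in THE h. h \<in> arr M (bten M R U B) (bob B) \<and>
          Cmp M (Ten M (mob R) (bob B)) (bten M R U B) (bob B) h (bepi M R U B) = blact B),
      Run = (\<lambda>B.
        let U = \<lparr>bob = mob R, blact = mmu R, bract = mmu R\<rparr>
        in THE h. h \<in> arr M (bten M R B U) (bob B) \<and>
          Cmp M (Ten M (bob B) (mob R)) (bten M R B U) (bob B) h (bepi M R B U) = bract B)\<rparr>"

text \<open>The forgetful functor from bimodules, called \<open>\<Gamma>\<close> with superscript \<open>R\<close> in the literature.\<close>

definition bimod_forget ::
    "('k, 'o, 'h) moncat \<Rightarrow> ('o, 'h) mon \<Rightarrow> (('o, 'h) bimod, 'h, 'o, 'h) monfun" where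
  "bimod_forget M R =
     \<lparr>FO = bob, FA = (\<lambda>B B' f. f), F2 = bepi M R, F0 = mun R\<rparr>"

record ('o, 'h) rmod =
  rob :: "'o"
  ract :: "'h"

definition is_rmodule :: "('k, 'o, 'h) moncat \<Rightarrow> ('o, 'h) mon \<Rightarrow> ('o, 'h) rmod \<Rightarrow> bool" where
  "is_rmodule M A X \<longleftrightarrow>
     (let a = mob A; m = mmu A; n = mun A; e = Unt M; x = rob X; p = ract X;
          xa = Ten M x a; aa = Ten M a a
      in x \<in> Obj M \<and> p \<in> arr M xa x \<and>
         Cmp M (Ten M x aa) xa x p (whiskl M x aa a m) =
         Cmp M (Ten M x aa) xa x p
           (Cmp M (Ten M x aa) (Ten M xa a) xa (whiskr M xa x a p) (Asc M x a a)) \<and>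
         Cmp M (Ten M x e) xa x p (whiskl M x e a n) = Run M x)"

definition rmodule_maps ::
    "('k, 'o, 'h) moncat \<Rightarrow> ('o, 'h) mon \<Rightarrow> ('o, 'h) rmod \<Rightarrow> ('o, 'h) rmod \<Rightarrow> 'h set" where
  "rmodule_maps M A X Y =
     {f \<in> arr M (rob X) (rob Y).
        Cmp M (Ten M (rob X) (mob A)) (rob X) (rob Y) f (ract X) =
        Cmp M (Ten M (rob X) (mob A)) (Ten M (rob Y) (mob A)) (rob Y)
          (ract Y) (whiskr M (rob X) (rob Y) (mob A) f)}"


section \<open>Essentially strong monoidal functors\<close>

definition image_monoid ::
    "('k, 'o, 'h) moncat \<Rightarrow> ('k, 'p, 'l) moncat \<Rightarrow> ('o, 'h, 'p, 'l) monfun \<Rightarrow> ('p, 'l) mon" where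
  "image_monoid C M G =
     (let e = Unt C; Ge = FO G e
      in \<lparr>mob = Ge,
          mmu = Cmp M (Ten M Ge Ge) (FO G (Ten C e e)) Ge (FA G (Ten C e e) e (Lun C e)) (F2 G e e),
          mun = F0 G\<rparr>)"

definition image_bimod ::
    "('k, 'o, 'h) moncat \<Rightarrow> ('k, 'p, 'l) moncat \<Rightarrow> ('o, 'h, 'p, 'l) monfun
      \<Rightarrow> 'o \<Rightarrow> ('p, 'l) bimod" where
  "image_bimod C M G c =
     (let e = Unt C; Ge = FO G e; Gc = FO G c
      in \<lparr>bob = Gc,
          blact = Cmp M (Ten M Ge Gc) (FO G (Ten C e c)) Gc (FA G (Ten C e c) c (Lun C c)) (F2 G e c),
          bract = Cmp M (Ten M Gc Ge) (FO G (Ten C c e)) Gc (FA G (Ten C c e) c (Run C c)) (F2 G c e)\<rparr>)"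

text \<open>The factor \<open>U\<close> in \<open>G = \<Gamma> U\<close>.\<close>

definition bimod_factor ::
    "('k, 'o, 'h) moncat \<Rightarrow> ('k, 'p, 'l) moncat \<Rightarrow> ('o, 'h, 'p, 'l) monfun
      \<Rightarrow> ('o, 'h, ('p, 'l) bimod, 'l) monfun" where
  "bimod_factor C M G =
     (let R = image_monoid C M G; U = image_bimod C M G
      in \<lparr>FO = U,
          FA = FA G,
          F2 = (\<lambda>a b. THE h. h \<in> arr M (bten M R (U a) (U b)) (FO G (Ten C a b)) \<and>
                  Cmp M (Ten M (FO G a) (FO G b)) (bten M R (U a) (U b)) (FO G (Ten C a b))
                    h (bepi M R (U a) (U b)) = F2 G a b),
          F0 = Ide M (FO G (Unt C))\<rparr>)"

definition essentially_strong ::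
    "'k base \<Rightarrow> ('k, 'o, 'h) moncat \<Rightarrow> ('k, 'p, 'l) moncat \<Rightarrow> ('o, 'h, 'p, 'l) monfun \<Rightarrow> bool" where
  "essentially_strong \<V> C M G \<longleftrightarrow>
     monoidal_functor \<V> C M G \<and>
     strong_monoidal_functor \<V> C (bimod_cat M (image_monoid C M G)) (bimod_factor C M G)"


section \<open>Right bialgebroids and their modules\<close>

type_synonym ('k, 'v) vmon = "(('k, 'v) module, 'v \<Rightarrow> 'v) mon"
type_synonym ('k, 'v) vrmod = "(('k, 'v) module, 'v \<Rightarrow> 'v) rmod"
type_synonym ('k, 'v) vbimod = "(('k, 'v) module, 'v \<Rightarrow> 'v) bimod"

definition mmul :: "('k, 'v) tensor_data \<Rightarrow> ('k, 'v) vmon \<Rightarrow> 'v \<Rightarrow> 'v \<Rightarrow> 'v" where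
  "mmul T A a b = mmu A (tel T (mob A) (mob A) a b)"

definition mone :: "('k, 'v) tensor_data \<Rightarrow> ('k, 'v) vmon \<Rightarrow> 'v" where
  "mone T A = mun A (uel T)"

definition opposite_monoid ::
    "'k base \<Rightarrow> ('k, 'v) tensor_data \<Rightarrow> ('k, 'v) vmon \<Rightarrow> ('k, 'v) vmon" where
  "opposite_monoid \<V> T R = R\<lparr>mmu := tlift \<V> T (mob R) (mob R) (mob R) (\<lambda>x y. mmul T R y x)\<rparr>"

definition ract_el ::
    "('k, 'v) tensor_data \<Rightarrow> ('k, 'v) vmon \<Rightarrow> ('k, 'v) vrmod \<Rightarrow> 'v \<Rightarrow> 'v \<Rightarrow> 'v" where
  "ract_el T A X x a = ract X (tel T (rob X) (mob A) x a)"

text \<open>The map \<open>a \<mapsto> x \<triangleleft> a\<close> from \<open>A\<close> to \<open>X\<close>.\<close>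

definition orbit ::
    "('k, 'v) tensor_data \<Rightarrow> ('k, 'v) vmon \<Rightarrow> ('k, 'v) vrmod \<Rightarrow> 'v \<Rightarrow> 'v \<Rightarrow> 'v" where
  "orbit T A X x = (\<lambda>a\<in>carrier (mob A). ract_el T A X x a)"

record ('k, 'v) bialgebroid_data =
  tot :: "('k, 'v) vmon"
  src :: "'v \<Rightarrow> 'v"
  tgt :: "'v \<Rightarrow> 'v"
  cop :: "'v \<Rightarrow> 'v"
  cou :: "'v \<Rightarrow> 'v"

text \<open>The bimodule \<open>r \<cdot> x \<cdot> r' = x \<triangleleft> (t(r) s(r'))\<close> underlying a right \<open>A\<close>-module.\<close>

definition rmod_bimod ::
    "'k base \<Rightarrow> ('k, 'v) tensor_data \<Rightarrow> ('k, 'v) vmon \<Rightarrow> ('k, 'v) bialgebroid_data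
      \<Rightarrow> ('k, 'v) vrmod \<Rightarrow> ('k, 'v) vbimod" where
  "rmod_bimod \<V> T R A X =
     \<lparr>bob = rob X,
      blact = tlift \<V> T (mob R) (rob X) (rob X) (\<lambda>r x. ract_el T (tot A) X x (tgt A r)),
      bract = tlift \<V> T (rob X) (mob R) (rob X) (\<lambda>x r. ract_el T (tot A) X x (src A r))\<rparr>"

abbreviation regular :: "('k, 'v) bialgebroid_data \<Rightarrow> ('k, 'v) vrmod" where
  "regular A \<equiv> \<lparr>rob = mob (tot A), ract = mmu (tot A)\<rparr>"

abbreviation A_bimod ::
    "'k base \<Rightarrow> ('k, 'v) tensor_data \<Rightarrow> ('k, 'v) vmon \<Rightarrow> ('k, 'v) bialgebroid_data \<Rightarrow> ('k, 'v) vbimod"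
  where
  "A_bimod \<V> T R A \<equiv> rmod_bimod \<V> T R A (regular A)"

text \<open>For \<open>f : A \<rightarrow> X\<close> and \<open>g : A \<rightarrow> Y\<close>, the map \<open>f \<otimes>\<^sub>R g\<close> from \<open>A \<otimes>\<^sub>R A\<close> to \<open>X \<otimes>\<^sub>R Y\<close>.\<close>

abbreviation A_ten_map ::
    "'k base \<Rightarrow> ('k, 'v) tensor_data \<Rightarrow> ('k, 'v) vmon \<Rightarrow> ('k, 'v) bialgebroid_data
      \<Rightarrow> ('k, 'v) vrmod \<Rightarrow> ('k, 'v) vrmod \<Rightarrow> ('v \<Rightarrow> 'v) \<Rightarrow> ('v \<Rightarrow> 'v) \<Rightarrow> 'v \<Rightarrow> 'v" where
  "A_ten_map \<V> T R A X Y f g \<equiv>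
     TenH (bimod_cat (base_cat \<V> T) R) (A_bimod \<V> T R A) (rmod_bimod \<V> T R A X)
       (A_bimod \<V> T R A) (rmod_bimod \<V> T R A Y) f g"

text \<open>The element \<open>x \<otimes>\<^sub>R y\<close>.\<close>

definition bel ::
    "'k base \<Rightarrow> ('k, 'v) tensor_data \<Rightarrow> ('k, 'v) vmon \<Rightarrow> ('k, 'v) vbimod \<Rightarrow> ('k, 'v) vbimod
      \<Rightarrow> 'v \<Rightarrow> 'v \<Rightarrow> 'v" where
  "bel \<V> T R B B' x y = bepi (base_cat \<V> T) R B B' (tel T (bob B) (bob B') x y)"

text \<open>
  The elements \<open>z\<close> of \<open>A \<otimes>\<^sub>R A\<close> with \<open>(s(r) \<otimes>\<^sub>R 1) z = (1 \<otimes>\<^sub>R t(r)) z\<close>.  Left multiplications are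
  bimodule maps from \<open>A\<close> to \<open>A\<close>, because the bimodule structure of \<open>A\<close> is given by right
  multiplications; so they can be tensored over \<open>R\<close>.
\<close>

definition takeuchi_obj ::
    "'k base \<Rightarrow> ('k, 'v) tensor_data \<Rightarrow> ('k, 'v) vmon \<Rightarrow> ('k, 'v) bialgebroid_data
      \<Rightarrow> ('k, 'v) module" where
  "takeuchi_obj \<V> T R A =
     (let AA = bten (base_cat \<V> T) R (A_bimod \<V> T R A) (A_bimod \<V> T R A);
          L = orbit T (tot A) (regular A);
          tens = A_ten_map \<V> T R A (regular A) (regular A);
          one = mone T (tot A)
      in AA\<lparr>carrier := {z \<in> carrier AA. \<forall>r\<in>carrier (mob R).
            tens (L (src A r)) (L one) z = tens (L one) (L (tgt A r)) z}\<rparr>)"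

text \<open>
  Factorwise multiplication \<open>(x \<otimes>\<^sub>R y) z = (L\<^sub>x \<otimes>\<^sub>R L\<^sub>y) z\<close>, with \<open>L\<^sub>x\<close> left multiplication by \<open>x\<close>.
  For \<open>z\<close> in the Takeuchi product the right-hand side is balanced in \<open>x\<close> and \<open>y\<close>, hence extends to
  a unique endomorphism \<open>w \<mapsto> w z\<close> of \<open>A \<otimes>\<^sub>R A\<close>.
\<close>

definition takeuchi_mult ::
    "'k base \<Rightarrow> ('k, 'v) tensor_data \<Rightarrow> ('k, 'v) vmon \<Rightarrow> ('k, 'v) bialgebroid_data
      \<Rightarrow> 'v \<Rightarrow> 'v \<Rightarrow> 'v" where
  "takeuchi_mult \<V> T R A w z =
     (let B = A_bimod \<V> T R A; AA = bten (base_cat \<V> T) R B B;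
          L = orbit T (tot A) (regular A)
      in (THE h. h \<in> vhom \<V> AA AA \<and>
            (\<forall>x\<in>carrier (mob (tot A)). \<forall>y\<in>carrier (mob (tot A)).
               h (bel \<V> T R B B x y) =
               A_ten_map \<V> T R A (regular A) (regular A) (L x) (L y) z)) w)"

definition takeuchi_monoid ::
    "'k base \<Rightarrow> ('k, 'v) tensor_data \<Rightarrow> ('k, 'v) vmon \<Rightarrow> ('k, 'v) bialgebroid_data
      \<Rightarrow> ('k, 'v) vmon" where
  "takeuchi_monoid \<V> T R A =
     (let P = takeuchi_obj \<V> T R A; B = A_bimod \<V> T R A
      in \<lparr>mob = P,
          mmu = tlift \<V> T P P P (takeuchi_mult \<V> T R A),
          mun = (THE h. h \<in> vhom \<V> (uobj T) P \<and>
                   h (uel T) = bel \<V> T R B B (mone T (tot A)) (mone T (tot A)))\<rparr>)"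

definition right_bialgebroid ::
    "'k base \<Rightarrow> ('k, 'v) tensor_data \<Rightarrow> ('k, 'v) vmon \<Rightarrow> ('k, 'v) bialgebroid_data \<Rightarrow> bool" where
  "right_bialgebroid \<V> T R A \<longleftrightarrow>
     (let M = base_cat \<V> T; B = tot A; s = src A; t = tgt A; \<delta> = cop A; \<epsilon> = cou A;
          cA = carrier (mob B); cR = carrier (mob R); mulA = mmul T B
      in is_monoid M R \<and> is_monoid M B \<and>
         monoid_morphism M R B s \<and>
         monoid_morphism M (opposite_monoid \<V> T R) B t \<and>
         (\<forall>r\<in>cR. \<forall>r'\<in>cR. mulA (s r) (t r') = mulA (t r') (s r)) \<and>
         is_comonoid (bimod_cat M R) (A_bimod \<V> T R A) \<delta> \<epsilon> \<and>
         monoid_morphism M B (takeuchi_monoid \<V> T R A) \<delta> \<and>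
         \<epsilon> (mone T B) = mone T R \<and>
         (\<forall>a\<in>cA. \<forall>b\<in>cA.
            \<epsilon> (mulA (s (\<epsilon> a)) b) = \<epsilon> (mulA a b) \<and>
            \<epsilon> (mulA a b) = \<epsilon> (mulA (t (\<epsilon> a)) b)))"

text \<open>The product of right \<open>A\<close>-modules, with \<open>(x \<otimes>\<^sub>R y) \<triangleleft> a = (x \<triangleleft> a\<^sub>(\<^sub>1\<^sub>)) \<otimes>\<^sub>R (y \<triangleleft> a\<^sub>(\<^sub>2\<^sub>))\<close>.\<close>

definition rmod_ten ::
    "'k base \<Rightarrow> ('k, 'v) tensor_data \<Rightarrow> ('k, 'v) vmon \<Rightarrow> ('k, 'v) bialgebroid_data
      \<Rightarrow> ('k, 'v) vrmod \<Rightarrow> ('k, 'v) vrmod \<Rightarrow> ('k, 'v) vrmod" where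
  "rmod_ten \<V> T R A X Y =
     (let M = base_cat \<V> T; a = mob (tot A);
          BX = rmod_bimod \<V> T R A X; BY = rmod_bimod \<V> T R A Y; Z = bten M R BX BY
      in \<lparr>rob = Z,
          ract = (THE p. p \<in> arr M (Ten M Z a) Z \<and>
            (\<forall>x\<in>carrier (rob X). \<forall>y\<in>carrier (rob Y). \<forall>c\<in>carrier a.
               p (tel T Z a (bel \<V> T R BX BY x y) c) =
               A_ten_map \<V> T R A X Y (orbit T (tot A) X x) (orbit T (tot A) Y y) (cop A c)))\<rparr>)"

definition rmod_unit ::
    "'k base \<Rightarrow> ('k, 'v) tensor_data \<Rightarrow> ('k, 'v) vmon \<Rightarrow> ('k, 'v) bialgebroid_data
      \<Rightarrow> ('k, 'v) vrmod" where
  "rmod_unit \<V> T R A =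
     \<lparr>rob = mob R,
      ract = tlift \<V> T (mob R) (mob (tot A)) (mob R)
               (\<lambda>r a. cou A (mmul T (tot A) (src A r) a))\<rparr>"

text \<open>
  The product of arrows and the coherence isomorphisms of right \<open>A\<close>-modules are those of the
  underlying bimodules.
\<close>

definition rmod_cat ::
    "'k base \<Rightarrow> ('k, 'v) tensor_data \<Rightarrow> ('k, 'v) vmon \<Rightarrow> ('k, 'v) bialgebroid_data
      \<Rightarrow> ('k, ('k, 'v) vrmod, 'v \<Rightarrow> 'v) moncat" where
  "rmod_cat \<V> T R A =
     (let M = base_cat \<V> T; N = bimod_cat M R; \<phi> = rmod_bimod \<V> T R A
      in \<lparr>Obj = {X. is_rmodule M (tot A) X},
          Hom = (\<lambda>X Y. (Hom M (rob X) (rob Y))\<lparr>carrier := rmodule_maps M (tot A) X Y\<rparr>),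
          Cmp = (\<lambda>X Y Z. Cmp M (rob X) (rob Y) (rob Z)),
          Ide = (\<lambda>X. Ide M (rob X)),
          Ten = rmod_ten \<V> T R A,
          TenH = (\<lambda>X X' Y Y'. TenH N (\<phi> X) (\<phi> X') (\<phi> Y) (\<phi> Y')),
          Unt = rmod_unit \<V> T R A,
          Asc = (\<lambda>X Y Z. Asc N (\<phi> X) (\<phi> Y) (\<phi> Z)),
          Lun = (\<lambda>X. Lun N (\<phi> X)),
          Run = (\<lambda>X. Run N (\<phi> X))\<rparr>)"

text \<open>
  The forgetful functor from right \<open>A\<close>-modules to bimodules, called \<open>\<Phi>\<close> with superscript \<open>A\<close> in
  the literature; its monoidal structure consists of identities.
\<close>

definition rmod_forget ::
    "'k base \<Rightarrow> ('k, 'v) tensor_data \<Rightarrow> ('k, 'v) vmon \<Rightarrow> ('k, 'v) bialgebroid_data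
      \<Rightarrow> (('k, 'v) vrmod, 'v \<Rightarrow> 'v, ('k, 'v) vbimod, 'v \<Rightarrow> 'v) monfun" where
  "rmod_forget \<V> T R A =
     (let N = bimod_cat (base_cat \<V> T) R; \<phi> = rmod_bimod \<V> T R A
      in \<lparr>FO = \<phi>,
          FA = (\<lambda>X Y f. f),
          F2 = (\<lambda>X Y. Ide N (Ten N (\<phi> X) (\<phi> Y))),
          F0 = Ide N (Unt N)\<rparr>)"

end

theory Submission
  imports Defs
begin

text \<open>
  Let \<open>G\<close> be represented by \<open>g\<close>, with universal element \<open>w\<close> in \<open>G g\<close>: every \<open>x\<close> in \<open>G c\<close> is
  \<open>G(h) w\<close> for a unique \<open>h = \<theta>(x) : g \<rightarrow> c\<close>.  Transporting composition with endomorphisms of \<open>g\<close>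
  along this bijection makes \<open>A = G g\<close> a monoid, with \<open>x \<triangleleft> a = G(\<theta>(x)) a\<close> and unit \<open>w\<close>, and every
  \<open>G c\<close> a right \<open>A\<close>-module.  The monoid \<open>R = G e\<close> acts on all \<open>G c\<close> from both sides, and maps of
  the form \<open>G(f)\<close> commute with these actions; therefore \<open>r \<cdot> x = x \<triangleleft> t(r)\<close> and \<open>x \<cdot> r = x \<triangleleft> s(r)\<close>
  for \<open>t(r) = r \<cdot> w\<close> and \<open>s(r) = w \<cdot> r\<close>.  By the Yoneda lemma there are \<open>d : g \<rightarrow> g \<box> g\<close> with
  \<open>G(d) w = G_{g,g}(w \<otimes> w)\<close> and \<open>e\<^sub>0 : g \<rightarrow> e\<close> with \<open>G(e\<^sub>0) w = 1\<close>.  As the maps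
  \<open>U_{a,b} : G a \<otimes>\<^sub>R G b \<rightarrow> G(a \<box> b)\<close> are invertible, \<open>\<delta> = U_{g,g}\<^sup>-\<^sup>1 \<circ> G(d)\<close> and \<open>\<epsilon> = G(e\<^sub>0)\<close> are
  defined, and each bialgebroid axiom is an equality of maps out of \<open>G g\<close> that holds at \<open>w\<close>.
  The bimodule \<open>\<Phi>(K c)\<close> is equal to \<open>U c\<close>, so \<open>K\<close> inherits its monoidal structure from \<open>U\<close> and the
  required natural isomorphism is the identity.
\<close>

section \<open>Linear maps, quotients and subobjects in the base\<close>

text \<open>Two obstacles shape the proof. Everything is therefore computed on pure tensors, with
  uniqueness obtained from generating sets. Case distinctions between the three bases are confined
  to facts about the base itself; beyond them the guarded form of linearity below serves all three.
  Second, \<delta>, the products in the Takeuchi monoid and the actions on products of modules take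
  values in tensor products over R, not in values of G, so evaluation at \<open>w\<close> does not
  apply to them directly. They are first pushed along the injective map \<open>U_{a,b}\<close>. The
  central identity \<open>u_tenN_cop\<close> says that \<open>U_{a,b}\<close> sends
  \<open>(L\<^sub>x \<otimes> L\<^sub>y) \<delta>(c)\<close> to
  \<open>G_{a,b}(x \<otimes> y) \<triangleleft> c\<close>. Thus right multiplication by \<delta>(c)
  and the diagonal action of c both become the plain action of c on \<open>G(a \<box> b)\<close>.
  The Takeuchi condition, multiplicativity of \<delta> and the module structure on products all
  reduce to this.\<close>

lemma vlin_iff:
  "vlin V X Y f \<longleftrightarrow> f \<in> carrier X \<rightarrow> carrier Y \<and>
     (V \<noteq> SetCat \<longrightarrow> (\<forall>x\<in>carrier X. \<forall>y\<in>carrier X. f (x \<oplus>\<^bsub>X\<^esub> y) = f x \<oplus>\<^bsub>Y\<^esub> f y)) \<and>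
     (\<forall>k. V = ModK k \<longrightarrow> (\<forall>r\<in>carrier k. \<forall>x\<in>carrier X. f (r \<odot>\<^bsub>X\<^esub> x) = r \<odot>\<^bsub>Y\<^esub> f x))"
  by (cases V) (auto simp: hom_def)

lemma vobj_abelian_group: "V \<noteq> SetCat \<Longrightarrow> vobj V X \<Longrightarrow> abelian_group X"
  by (cases V) (auto simp: module_def)

lemma vobj_add_closed:
  "V \<noteq> SetCat \<Longrightarrow> vobj V X \<Longrightarrow> x \<in> carrier X \<Longrightarrow> y \<in> carrier X \<Longrightarrow> x \<oplus>\<^bsub>X\<^esub> y \<in> carrier X"
  using abelian_monoid.a_closed abelian_group.axioms(1) vobj_abelian_group by metis

lemma vobj_smult_closed:
  "vobj (ModK k) X \<Longrightarrow> r \<in> carrier k \<Longrightarrow> x \<in> carrier X \<Longrightarrow> r \<odot>\<^bsub>X\<^esub> x \<in> carrier X"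
  using module.smult_closed by fastforce

lemma vlin_closed: "vlin V X Y f \<Longrightarrow> x \<in> carrier X \<Longrightarrow> f x \<in> carrier Y"
  by (auto simp: vlin_iff)

lemma vlin_add:
  "vlin V X Y f \<Longrightarrow> V \<noteq> SetCat \<Longrightarrow> x \<in> carrier X \<Longrightarrow> y \<in> carrier X \<Longrightarrow>
     f (x \<oplus>\<^bsub>X\<^esub> y) = f x \<oplus>\<^bsub>Y\<^esub> f y"
  by (auto simp: vlin_iff)

lemma vlin_smult:
  "vlin (ModK k) X Y f \<Longrightarrow> r \<in> carrier k \<Longrightarrow> x \<in> carrier X \<Longrightarrow> f (r \<odot>\<^bsub>X\<^esub> x) = r \<odot>\<^bsub>Y\<^esub> f x"
  by (auto simp: vlin_iff)

text \<open>Since \<open>X\<close> is an object, sums and scalar multiples stay in its carrier,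
  where the two functions agree.\<close>

lemma vlin_cong:
  assumes "vobj V X" and "vlin V X Y f" and "\<And>x. x \<in> carrier X \<Longrightarrow> g x = f x"
  shows "vlin V X Y g"
  unfolding vlin_iff
proof (intro conjI allI impI ballI)
  show "g \<in> carrier X \<rightarrow> carrier Y"
    using assms(2,3) vlin_closed by fastforce
next
  fix x y assume V: "V \<noteq> SetCat" and "x \<in> carrier X" "y \<in> carrier X"
  then show "g (x \<oplus>\<^bsub>X\<^esub> y) = g x \<oplus>\<^bsub>Y\<^esub> g y"
    by (simp add: assms(3) vobj_add_closed[OF V assms(1)] vlin_add[OF assms(2) V])
next
  fix k r x assume V: "V = ModK k" and r: "r \<in> carrier k" and x: "x \<in> carrier X"
  then show "g (r \<odot>\<^bsub>X\<^esub> x) = r \<odot>\<^bsub>Y\<^esub> g x"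
    by (simp add: assms(3) vobj_smult_closed[OF assms(1)[unfolded V]]
        vlin_smult[OF assms(2)[unfolded V]])
qed

lemma vlin_id: "vlin V X X (\<lambda>x. x)"
  by (auto simp: vlin_iff)

lemma vlin_comp:
  assumes "vlin V X Y f" and "vlin V Y Z g"
  shows "vlin V X Z (\<lambda>x. g (f x))"
  using assms by (auto simp: vlin_iff Pi_iff)

lemma vlin_restrict: "vobj V X \<Longrightarrow> vlin V X Y f \<Longrightarrow> vlin V X Y (restrict f (carrier X))"
  by (rule vlin_cong) auto

lemma vhomI: "vobj V X \<Longrightarrow> vlin V X Y f \<Longrightarrow> restrict f (carrier X) \<in> vhom V X Y"
  by (simp add: vhom_def vlin_restrict)

lemma vhom_vlin: "f \<in> vhom V X Y \<Longrightarrow> vlin V X Y f"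
  by (simp add: vhom_def)

lemma vhom_closed: "f \<in> vhom V X Y \<Longrightarrow> x \<in> carrier X \<Longrightarrow> f x \<in> carrier Y"
  using vlin_closed[OF vhom_vlin] .

lemma vhom_ext:
  "f \<in> vhom V X Y \<Longrightarrow> g \<in> vhom V X Z \<Longrightarrow> (\<And>x. x \<in> carrier X \<Longrightarrow> f x = g x) \<Longrightarrow> f = g"
  by (auto simp: vhom_def intro: extensionalityI)

lemma vhom_comp:
  "f \<in> vhom V X Y \<Longrightarrow> g \<in> vhom V Y Z \<Longrightarrow> vobj V X \<Longrightarrow> compose (carrier X) g f \<in> vhom V X Z"
  unfolding compose_def by (rule vhomI[OF _ vlin_comp[OF vhom_vlin vhom_vlin]])

lemma vhom_id: "vobj V X \<Longrightarrow> (\<lambda>x\<in>carrier X. x) \<in> vhom V X X"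
  by (intro vhomI vlin_id)

lemma vhom_compose_id: "f \<in> vhom V X Y \<Longrightarrow> compose (carrier X) f (\<lambda>x\<in>carrier X. x) = f"
  by (rule extensionalityI[of _ "carrier X"]) (auto simp: vhom_def compose_def)

lemma vhom_id_compose: "f \<in> vhom V X Y \<Longrightarrow> compose (carrier X) (\<lambda>y\<in>carrier Y. y) f = f"
  by (rule extensionalityI[of _ "carrier X"]) (auto simp: vhom_closed compose_def, simp add: vhom_def)

lemma vlin_pointwise_add:
  assumes V: "V \<noteq> SetCat" and Y: "vobj V Y" and f: "vlin V X Y f" and g: "vlin V X Y g"
  shows "vlin V X Y (\<lambda>x. f x \<oplus>\<^bsub>Y\<^esub> g x)"
proof -
  interpret abelian_group Y
    using vobj_abelian_group[OF V Y] .
  have "r \<odot>\<^bsub>Y\<^esub> (a \<oplus>\<^bsub>Y\<^esub> b) = r \<odot>\<^bsub>Y\<^esub> a \<oplus>\<^bsub>Y\<^esub> r \<odot>\<^bsub>Y\<^esub> b"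
    if "V = ModK k" "r \<in> carrier k" "a \<in> carrier Y" "b \<in> carrier Y" for k r a b
    using Y that module.smult_r_distr[of k Y] by simp
  then show ?thesis
    using f g unfolding vlin_iff by (auto simp: a_ac Pi_iff)
qed

text \<open>Scaling by \<open>r\<close> preserves homogeneity because the base ring is
  commutative.\<close>

lemma vlin_pointwise_smult:
  assumes Y: "vobj (ModK k) Y" and f: "vlin (ModK k) X Y f" and r: "r \<in> carrier k"
  shows "vlin (ModK k) X Y (\<lambda>x. r \<odot>\<^bsub>Y\<^esub> f x)"
proof -
  interpret module k Y
    using Y by simp
  have "s \<odot>\<^bsub>Y\<^esub> (r \<odot>\<^bsub>Y\<^esub> y) = r \<odot>\<^bsub>Y\<^esub> (s \<odot>\<^bsub>Y\<^esub> y)" if "s \<in> carrier k" "y \<in> carrier Y" for s y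
    using that r by (metis smult_assoc1 m_comm)
  then show ?thesis
    using f r unfolding vlin_iff by (auto simp: smult_r_distr Pi_iff)
qed

section \<open>Detecting maps on generators\<close>

text \<open>Generation in the sense of joint epimorphy instead of spans, so that one notion covers
  sets, groups and modules. Targets range over objects in the type \<open>'v\<close> because the
  universal property of the tensor product is available only for these.\<close>

definition generates :: "'k base \<Rightarrow> ('k, 'v) module \<Rightarrow> 'v set \<Rightarrow> bool" where
  "generates V P S \<longleftrightarrow> S \<subseteq> carrier P \<and>
     (\<forall>(Z :: ('k, 'v) module) f g. vobj V Z \<longrightarrow> vlin V P Z f \<longrightarrow> vlin V P Z g \<longrightarrow>
        (\<forall>s\<in>S. f s = g s) \<longrightarrow> (\<forall>x\<in>carrier P. f x = g x))"

lemma generatesD: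
  fixes P Z :: "('k, 'v) module"
  shows "generates V P S \<Longrightarrow> vobj V Z \<Longrightarrow> vlin V P Z f \<Longrightarrow> vlin V P Z g \<Longrightarrow>
    (\<And>s. s \<in> S \<Longrightarrow> f s = g s) \<Longrightarrow> x \<in> carrier P \<Longrightarrow> f x = g x"
  unfolding generates_def by blast

lemma generates_carrier: "generates V X (carrier X)"
  by (simp add: generates_def)

text \<open>
  Maps of several variables are constructed by lifting in one variable and checking linearity in
  the others on generators; this lemma stands in for the internal hom.
\<close>

lemma vlin_in_parameter:
  fixes P Z :: "('k, 'v) module" and X :: "('k, 'x) module"
  assumes gen: "generates V P S" and X: "vobj V X" and Z: "vobj V Z"
    and F: "\<And>x. x \<in> carrier X \<Longrightarrow> vlin V P Z (F x)"
    and lin: "\<And>s. s \<in> S \<Longrightarrow> vlin V X Z (\<lambda>x. F x s)"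
    and p: "p \<in> carrier P"
  shows "vlin V X Z (\<lambda>x. F x p)"
  unfolding vlin_iff
proof (intro conjI allI impI ballI)
  show "(\<lambda>x. F x p) \<in> carrier X \<rightarrow> carrier Z"
    using F p by (auto intro: vlin_closed)
next
  fix x y assume V: "V \<noteq> SetCat" and xy: "x \<in> carrier X" "y \<in> carrier X"
  show "F (x \<oplus>\<^bsub>X\<^esub> y) p = F x p \<oplus>\<^bsub>Z\<^esub> F y p"
  proof (rule generatesD[OF gen Z _ _ _ p])
    show "vlin V P Z (F (x \<oplus>\<^bsub>X\<^esub> y))"
      using F vobj_add_closed[OF V X] xy by blast
    show "vlin V P Z (\<lambda>p. F x p \<oplus>\<^bsub>Z\<^esub> F y p)"
      using vlin_pointwise_add[OF V Z] F xy by blast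
    show "F (x \<oplus>\<^bsub>X\<^esub> y) s = F x s \<oplus>\<^bsub>Z\<^esub> F y s" if "s \<in> S" for s
      using vlin_add[OF lin V] that xy by blast
  qed
next
  fix k r x assume V: "V = ModK k" and r: "r \<in> carrier k" and x: "x \<in> carrier X"
  have rx: "r \<odot>\<^bsub>X\<^esub> x \<in> carrier X"
    by (rule vobj_smult_closed[OF X[unfolded V] r x])
  show "F (r \<odot>\<^bsub>X\<^esub> x) p = r \<odot>\<^bsub>Z\<^esub> F x p"
  proof (rule generatesD[OF gen Z _ _ _ p])
    show "vlin V P Z (F (r \<odot>\<^bsub>X\<^esub> x))"
      by (rule F[OF rx])
    show "vlin V P Z (\<lambda>p. r \<odot>\<^bsub>Z\<^esub> F x p)"
      unfolding V by (rule vlin_pointwise_smult[OF Z[unfolded V] F[OF x, unfolded V] r])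
    show "F (r \<odot>\<^bsub>X\<^esub> x) s = r \<odot>\<^bsub>Z\<^esub> F x s" if "s \<in> S" for s
      by (rule vlin_smult[OF lin[OF that, unfolded V] r x])
  qed
qed

text \<open>Together with linearity of a functor on hom-objects, this makes \<open>G(f) x\<close>
  linear in \<open>f\<close>.\<close>

lemma vlin_evaluation: "x \<in> carrier X \<Longrightarrow> vlin V (vhomobj V X Y) Y (\<lambda>f. f x)"
  by (auto simp: vlin_iff vhomobj_def vhom_closed)

text \<open>
  The quotient of \<open>P\<close> by the joint kernel of a family of maps lives on a set of representatives, so
  that its carrier stays in the type of \<open>P\<close>.  Applied to all maps that coequalize a given pair, this
  gives coequalizers in the three bases at once.
\<close>

definition kernel_rel :: "('k, 'v) module \<Rightarrow> (('k, 'v) module \<times> ('v \<Rightarrow> 'v)) set \<Rightarrow> 'v \<Rightarrow> 'v \<Rightarrow> bool" where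
  "kernel_rel P H p p' \<longleftrightarrow> p \<in> carrier P \<and> p' \<in> carrier P \<and> (\<forall>(W, h)\<in>H. h p = h p')"

definition quot_rep :: "('k, 'v) module \<Rightarrow> (('k, 'v) module \<times> ('v \<Rightarrow> 'v)) set \<Rightarrow> 'v \<Rightarrow> 'v" where
  "quot_rep P H p = (SOME p'. kernel_rel P H p p')"

definition quot_obj :: "('k, 'v) module \<Rightarrow> (('k, 'v) module \<times> ('v \<Rightarrow> 'v)) set \<Rightarrow> ('k, 'v) module" where
  "quot_obj P H = P\<lparr>carrier := quot_rep P H ` carrier P, zero := quot_rep P H \<zero>\<^bsub>P\<^esub>,
     add := (\<lambda>x y. quot_rep P H (x \<oplus>\<^bsub>P\<^esub> y)), smult := (\<lambda>r x. quot_rep P H (r \<odot>\<^bsub>P\<^esub> x))\<rparr>"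

lemma kernel_rel_quot_rep: "p \<in> carrier P \<Longrightarrow> kernel_rel P H p (quot_rep P H p)"
  unfolding quot_rep_def by (rule someI[of _ p]) (auto simp: kernel_rel_def)

lemma quot_rep_closed: "p \<in> carrier P \<Longrightarrow> quot_rep P H p \<in> carrier P"
  using kernel_rel_quot_rep by (fastforce simp: kernel_rel_def)

text \<open>Related elements are related to exactly the same elements, so both choices are made from
  one and the same predicate.\<close>

lemma quot_rep_eq: "kernel_rel P H p p' \<Longrightarrow> quot_rep P H p = quot_rep P H p'"
  unfolding quot_rep_def by (rule arg_cong[of _ _ Eps]) (force simp: kernel_rel_def)

lemma quot_rep_value: "p \<in> carrier P \<Longrightarrow> (W, h) \<in> H \<Longrightarrow> h (quot_rep P H p) = h p"
  using kernel_rel_quot_rep[of p P H] by (auto simp: kernel_rel_def)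

text \<open>Linearity of the maps in \<open>H\<close> makes the joint kernel a congruence. Hence
  taking representatives commutes with the operations, and the laws of the quotient are images of
  the laws of \<open>P\<close> under a surjection.\<close>

lemma
  fixes P :: "('k, 'v) module"
  assumes ok: "base_ok V" and P: "vobj V P" and H: "\<And>W h. (W, h) \<in> H \<Longrightarrow> vobj V W \<and> vlin V P W h"
  shows vobj_quot_obj: "vobj V (quot_obj P H)"
    and vlin_quot_rep: "vlin V P (quot_obj P H) (quot_rep P H)"
proof -
  let ?q = "quot_rep P H" and ?Q = "quot_obj P H"
  have car: "carrier ?Q = ?q ` carrier P"
    by (simp add: quot_obj_def)
  have add: "?q p \<oplus>\<^bsub>?Q\<^esub> ?q p' = ?q (p \<oplus>\<^bsub>P\<^esub> p')"
    if V: "V \<noteq> SetCat" and pp: "p \<in> carrier P" "p' \<in> carrier P" for p p'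
  proof -
    have "h (?q p \<oplus>\<^bsub>P\<^esub> ?q p') = h (p \<oplus>\<^bsub>P\<^esub> p')" if Wh: "(W, h) \<in> H" for W h
      using vlin_add[OF conjunct2[OF H[OF Wh]] V] pp Wh by (simp add: quot_rep_closed quot_rep_value)
    then have "kernel_rel P H (?q p \<oplus>\<^bsub>P\<^esub> ?q p') (p \<oplus>\<^bsub>P\<^esub> p')"
      using pp V P by (auto simp: kernel_rel_def quot_rep_closed vobj_add_closed)
    then show ?thesis
      by (simp add: quot_obj_def quot_rep_eq)
  qed
  have smult: "r \<odot>\<^bsub>?Q\<^esub> ?q p = ?q (r \<odot>\<^bsub>P\<^esub> p)"
    if V: "V = ModK k" and r: "r \<in> carrier k" and p: "p \<in> carrier P" for k r p
  proof -
    have P': "vobj (ModK k) P"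
      using P V by simp
    have "h (r \<odot>\<^bsub>P\<^esub> ?q p) = h (r \<odot>\<^bsub>P\<^esub> p)" if Wh: "(W, h) \<in> H" for W h
      using vlin_smult[OF conjunct2[OF H[OF Wh, unfolded V]] r] p Wh
      by (simp add: quot_rep_closed quot_rep_value)
    then have "kernel_rel P H (r \<odot>\<^bsub>P\<^esub> ?q p) (r \<odot>\<^bsub>P\<^esub> p)"
      using p r by (auto simp: kernel_rel_def quot_rep_closed vobj_smult_closed[OF P'])
    then show ?thesis
      by (simp add: quot_obj_def quot_rep_eq)
  qed
  show "vlin V P ?Q ?q"
    unfolding vlin_iff by (auto simp: car add smult)
  have group: "abelian_group ?Q" if V: "V \<noteq> SetCat"
  proof -
    interpret abelian_group P
      using vobj_abelian_group[OF V P] .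
    have z: "\<zero>\<^bsub>?Q\<^esub> = ?q \<zero>\<^bsub>P\<^esub>"
      by (simp add: quot_obj_def)
    show ?thesis
    proof (rule abelian_groupI)
      show "\<exists>y\<in>carrier ?Q. y \<oplus>\<^bsub>?Q\<^esub> x = \<zero>\<^bsub>?Q\<^esub>" if x: "x \<in> carrier ?Q" for x
      proof -
        obtain p where p: "p \<in> carrier P" "x = ?q p"
          using x by (auto simp: car)
        then have "?q (\<ominus>\<^bsub>P\<^esub> p) \<oplus>\<^bsub>?Q\<^esub> x = \<zero>\<^bsub>?Q\<^esub>"
          using V by (simp add: add z l_neg)
        then show ?thesis
          using p by (auto simp: car)
      qed
    qed (use V in \<open>auto simp: car add z a_ac\<close>)
  qed
  show "vobj V ?Q"
  proof (cases V)
    case (ModK k)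
    interpret module k P
      using P ModK by simp
    have "module k ?Q"
    proof (rule moduleI)
      show "cring k"
        using ok ModK by simp
      show "abelian_group ?Q"
        using group ModK by simp
    qed (use ModK in \<open>auto simp: car add smult smult_l_distr smult_r_distr smult_assoc1\<close>)
    then show ?thesis
      using ModK by simp
  next
    case AbGrp
    then show ?thesis
      using group by simp
  qed simp
qed

text \<open>The joint equalizer of a family of pairs of maps; the Takeuchi product is of this form.
  Closure under zero and negatives holds because additive maps between groups preserve them.\<close>

lemma vobj_restrict_carrier:
  fixes P :: "('k, 'v) module" and Z :: "('k, 'z) module"
  assumes ok: "base_ok V" and P: "vobj V P" and Z: "vobj V Z"
    and f: "\<And>i. i \<in> I \<Longrightarrow> vlin V P Z (f i)" and g: "\<And>i. i \<in> I \<Longrightarrow> vlin V P Z (g i)"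
  shows "vobj V (P\<lparr>carrier := {z \<in> carrier P. \<forall>i\<in>I. f i z = g i z}\<rparr>)" (is "vobj V ?Q")
proof -
  have group: "abelian_group ?Q" if V: "V \<noteq> SetCat"
  proof -
    interpret P: abelian_group P
      using vobj_abelian_group[OF V P] .
    interpret Z: abelian_group Z
      using vobj_abelian_group[OF V Z] .
    have zero: "h \<zero>\<^bsub>P\<^esub> = \<zero>\<^bsub>Z\<^esub>" if h: "vlin V P Z h" for h
    proof -
      have "h \<zero>\<^bsub>P\<^esub> \<oplus>\<^bsub>Z\<^esub> h \<zero>\<^bsub>P\<^esub> = h \<zero>\<^bsub>P\<^esub>"
        using vlin_add[OF h V, of "\<zero>\<^bsub>P\<^esub>" "\<zero>\<^bsub>P\<^esub>"] by simp
      then show ?thesis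
        using vlin_closed[OF h P.zero_closed] by (simp add: Z.add.r_cancel_one')
    qed
    have neg: "h (\<ominus>\<^bsub>P\<^esub> x) = \<ominus>\<^bsub>Z\<^esub> h x" if h: "vlin V P Z h" and x: "x \<in> carrier P" for h x
    proof -
      have "h (\<ominus>\<^bsub>P\<^esub> x) \<oplus>\<^bsub>Z\<^esub> h x = \<zero>\<^bsub>Z\<^esub>"
        using vlin_add[OF h V, of "\<ominus>\<^bsub>P\<^esub> x" x] x zero[OF h] by (simp add: P.l_neg)
      then show ?thesis
        using vlin_closed[OF h] x by (simp add: Z.minus_equality)
    qed
    show ?thesis
    proof (rule abelian_groupI)
      show "\<exists>y\<in>carrier ?Q. y \<oplus>\<^bsub>?Q\<^esub> x = \<zero>\<^bsub>?Q\<^esub>" if "x \<in> carrier ?Q" for x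
        using that f g by (auto simp: neg P.l_neg intro!: bexI[of _ "\<ominus>\<^bsub>P\<^esub> x"])
    qed (use f g V in \<open>auto simp: zero P.a_ac vlin_add[of V P Z]\<close>)
  qed
  show ?thesis
  proof (cases V)
    case (ModK k)
    interpret module k P
      using P ModK by simp
    have "module k ?Q"
    proof (rule moduleI)
      show "cring k"
        using ok ModK by simp
      show "abelian_group ?Q"
        using group ModK by simp
    qed (use f g ModK in \<open>auto simp: smult_l_distr smult_r_distr smult_assoc1 vlin_smult[of k P Z]\<close>)
    then show ?thesis
      using ModK by simp
  next
    case AbGrp
    then show ?thesis
      using group by simp
  qed simp
qed

lemma vlin_restrict_carrier:
  "S \<subseteq> carrier P \<Longrightarrow>
     vlin V X (P\<lparr>carrier := S\<rparr>) f \<longleftrightarrow> vlin V X P f \<and> f \<in> carrier X \<rightarrow> S"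
  by (auto simp: vlin_iff)

lemma vlin_from_restrict_carrier:
  "S \<subseteq> carrier P \<Longrightarrow> vlin V P X f \<Longrightarrow> vlin V (P\<lparr>carrier := S\<rparr>) X f"
  by (simp add: vlin_iff Pi_iff subset_iff)

section \<open>The base as a monoidal category\<close>

lemma vbilin_cong:
  assumes X: "vobj V X" and Y: "vobj V Y" and b: "vbilin V X Y Z \<beta>"
    and eq: "\<And>x y. x \<in> carrier X \<Longrightarrow> y \<in> carrier Y \<Longrightarrow> \<gamma> x y = \<beta> x y"
  shows "vbilin V X Y Z \<gamma>"
  unfolding vbilin_def
proof (intro conjI ballI)
  show "vlin V Y Z (\<gamma> x)" if "x \<in> carrier X" for x
    by (rule vlin_cong[OF Y, of Z "\<beta> x"]) (use b that in \<open>simp_all add: vbilin_def eq\<close>)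
  show "vlin V X Z (\<lambda>x. \<gamma> x y)" if "y \<in> carrier Y" for y
    by (rule vlin_cong[OF X, of Z "\<lambda>x. \<beta> x y"]) (use b that in \<open>simp_all add: vbilin_def eq\<close>)
qed

locale base_tensor =
  fixes V :: "'k base" and T :: "('k, 'v) tensor_data"
  assumes base_ok: "base_ok V" and usual_tensor: "usual_tensor V T"
begin

abbreviation "M \<equiv> base_cat V T"
abbreviation "I \<equiv> uobj T"

lemma base_cat_simps [simp]:
  "Obj M = {X. vobj V X}" "Hom M = vhomobj V" "Cmp M X Y Z g f = compose (carrier X) g f"
  "Ide M X = (\<lambda>x\<in>carrier X. x)" "Ten M = tobj T" "Unt M = I"
  by (simp_all add: base_cat_def)

lemma arr_base_cat [simp]: "carrier (vhomobj V X Y) = vhom V X Y"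
  by (simp add: vhomobj_def)

text \<open>For sets the tensor product is specified by a bijection with the cartesian product, and
  the lift of a function of two variables is obtained by inverting it. In the linear bases the
  property is the specification itself.\<close>

lemma universal_tensor:
  assumes X: "vobj V X" and Y: "vobj V Y"
  shows "universal_bilin V X Y (tobj T X Y) (tel T X Y)"
proof (cases V)
  case SetCat
  let ?\<tau> = "\<lambda>(x, y). tel T X Y x y"
  have bij: "bij_betw ?\<tau> (carrier X \<times> carrier Y) (carrier (tobj T X Y))"
    using usual_tensor X Y SetCat by (auto simp: usual_tensor_def)
  have surj: "\<exists>x\<in>carrier X. \<exists>y\<in>carrier Y. p = tel T X Y x y" if "p \<in> carrier (tobj T X Y)" for p
    using that bij_betw_imp_surj_on[OF bij, symmetric] by auto
  have "\<exists>!f. f \<in> vhom V (tobj T X Y) Z \<and> (\<forall>x\<in>carrier X. \<forall>y\<in>carrier Y. f (tel T X Y x y) = \<beta> x y)"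
    if \<beta>: "vbilin V X Y Z \<beta>" for Z :: "('k, 'v) module" and \<beta>
  proof (rule ex_ex1I)
    define f where "f = (\<lambda>p\<in>carrier (tobj T X Y). (\<lambda>(x, y). \<beta> x y)
      (inv_into (carrier X \<times> carrier Y) ?\<tau> p))"
    have val: "f (tel T X Y x y) = \<beta> x y" if "x \<in> carrier X" "y \<in> carrier Y" for x y
    proof -
      have "inv_into (carrier X \<times> carrier Y) ?\<tau> (?\<tau> (x, y)) = (x, y)"
        using bij that by (intro inv_into_f_f) (auto simp: bij_betw_def)
      moreover have "?\<tau> (x, y) \<in> carrier (tobj T X Y)"
        using bij that by (auto simp: bij_betw_def)
      ultimately show ?thesis
        by (simp add: f_def)
    qed
    have "f \<in> carrier (tobj T X Y) \<rightarrow> carrier Z"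
    proof
      fix p assume "p \<in> carrier (tobj T X Y)"
      then obtain x y where "x \<in> carrier X" "y \<in> carrier Y" "p = tel T X Y x y"
        using surj by blast
      then show "f p \<in> carrier Z"
        using \<beta> SetCat val by (auto simp: vbilin_def)
    qed
    then have "f \<in> vhom V (tobj T X Y) Z"
      using SetCat by (simp add: vhom_def f_def)
    then show "\<exists>f. f \<in> vhom V (tobj T X Y) Z \<and>
        (\<forall>x\<in>carrier X. \<forall>y\<in>carrier Y. f (tel T X Y x y) = \<beta> x y)"
      using val by blast
  next
    fix f g
    assume f: "f \<in> vhom V (tobj T X Y) Z \<and> (\<forall>x\<in>carrier X. \<forall>y\<in>carrier Y. f (tel T X Y x y) = \<beta> x y)"
      and g: "g \<in> vhom V (tobj T X Y) Z \<and> (\<forall>x\<in>carrier X. \<forall>y\<in>carrier Y. g (tel T X Y x y) = \<beta> x y)"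
    have "f p = g p" if p: "p \<in> carrier (tobj T X Y)" for p
    proof -
      obtain x y where "x \<in> carrier X" "y \<in> carrier Y" "p = tel T X Y x y"
        using surj[OF p] by blast
      then show ?thesis
        using f g by auto
    qed
    then show "f = g"
      using f g by (auto intro: vhom_ext)
  qed
  moreover have "vbilin V X Y (tobj T X Y) (tel T X Y)"
    using bij SetCat by (auto simp: vbilin_def bij_betw_def)
  ultimately show ?thesis
    using SetCat by (simp add: universal_bilin_def)
qed (use usual_tensor X Y in \<open>auto simp: usual_tensor_def\<close>)

lemma vobj_tobj [simp, intro]: "vobj V X \<Longrightarrow> vobj V Y \<Longrightarrow> vobj V (tobj T X Y)"
  using universal_tensor unfolding universal_bilin_def by blast

lemma vbilin_tel: "vobj V X \<Longrightarrow> vobj V Y \<Longrightarrow> vbilin V X Y (tobj T X Y) (tel T X Y)"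
  using universal_tensor unfolding universal_bilin_def by blast

lemma vlin_tel_left:
  "vobj V X \<Longrightarrow> vobj V Y \<Longrightarrow> y \<in> carrier Y \<Longrightarrow> vlin V X (tobj T X Y) (\<lambda>x. tel T X Y x y)"
  using vbilin_tel by (simp add: vbilin_def)

lemma vlin_tel_right:
  "vobj V X \<Longrightarrow> vobj V Y \<Longrightarrow> x \<in> carrier X \<Longrightarrow> vlin V Y (tobj T X Y) (tel T X Y x)"
  using vbilin_tel by (simp add: vbilin_def)

lemma tel_closed [simp, intro]:
  "vobj V X \<Longrightarrow> vobj V Y \<Longrightarrow> x \<in> carrier X \<Longrightarrow> y \<in> carrier Y \<Longrightarrow>
     tel T X Y x y \<in> carrier (tobj T X Y)"
  using vlin_closed[OF vlin_tel_right] .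

lemma tlift_unique_ex:
  fixes X Y Z :: "('k, 'v) module"
  assumes "vobj V X" and "vobj V Y" and "vobj V Z" and "vbilin V X Y Z \<beta>"
  shows "\<exists>!f. f \<in> vhom V (tobj T X Y) Z \<and> (\<forall>x\<in>carrier X. \<forall>y\<in>carrier Y. f (tel T X Y x y) = \<beta> x y)"
  using universal_tensor[OF assms(1,2), unfolded universal_bilin_def, THEN conjunct2, THEN conjunct2,
      rule_format, OF conjI[OF assms(3,4)]] .

lemma
  fixes X Y Z :: "('k, 'v) module"
  assumes "vobj V X" and "vobj V Y" and "vobj V Z" and "vbilin V X Y Z \<beta>"
  shows tlift_vhom: "tlift V T X Y Z \<beta> \<in> vhom V (tobj T X Y) Z"
    and tlift_tel: "\<And>x y. x \<in> carrier X \<Longrightarrow> y \<in> carrier Y \<Longrightarrow>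
      tlift V T X Y Z \<beta> (tel T X Y x y) = \<beta> x y"
  using theI'[OF tlift_unique_ex[OF assms], folded tlift_def] by simp_all

lemma vbilin_comp_tel:
  "vobj V X \<Longrightarrow> vobj V Y \<Longrightarrow> vlin V (tobj T X Y) Z f \<Longrightarrow>
     vbilin V X Y Z (\<lambda>x y. f (tel T X Y x y))"
  using vlin_comp[OF vlin_tel_left, of X Y _ Z f] vlin_comp[OF vlin_tel_right, of X Y _ Z f]
  by (simp add: vbilin_def)

text \<open>Bilinearity of \<beta> is inherited from \<open>f\<close>, since both agree on pure
  tensors. This resolves lifts for which a morphism with the right values is already known.\<close>

lemma tlift_eqI:
  fixes Z :: "('k, 'v) module"
  assumes "vobj V X" and "vobj V Y" and "vobj V Z" and f: "f \<in> vhom V (tobj T X Y) Z"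
    and val: "\<And>x y. x \<in> carrier X \<Longrightarrow> y \<in> carrier Y \<Longrightarrow> f (tel T X Y x y) = \<beta> x y"
  shows "tlift V T X Y Z \<beta> = f"
proof -
  have "vbilin V X Y Z (\<lambda>x y. f (tel T X Y x y))"
    using vbilin_comp_tel[OF assms(1,2) vhom_vlin[OF f]] .
  then have "vbilin V X Y Z \<beta>"
    by (rule vbilin_cong[OF assms(1,2)]) (simp add: val)
  then show ?thesis
    unfolding tlift_def using f val
    by (intro the1_equality[OF tlift_unique_ex[OF assms(1-3)]]) simp_all
qed

text \<open>Agreement is extended one variable at a time, first in \<open>x\<close> with
  \<open>q\<close> in \<open>Q\<close> fixed, then in \<open>y\<close>. Two maps that agree on all
  pure tensors are lifts of the same bilinear map.\<close>

lemma generates_tobj: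
  assumes X: "vobj V X" and Y: "vobj V Y" and S: "generates V X S" and Q: "generates V Y Q"
  shows "generates V (tobj T X Y) {tel T X Y s q |s q. s \<in> S \<and> q \<in> Q}"
  unfolding generates_def
proof (intro conjI allI impI ballI)
  have sub: "S \<subseteq> carrier X" "Q \<subseteq> carrier Y"
    using S Q by (auto simp: generates_def)
  then show "{tel T X Y s q |s q. s \<in> S \<and> q \<in> Q} \<subseteq> carrier (tobj T X Y)"
    using X Y by auto
  fix Z :: "('k, 'v) module" and f g p
  assume Z: "vobj V Z" and f: "vlin V (tobj T X Y) Z f" and g: "vlin V (tobj T X Y) Z g"
    and eq: "\<forall>t\<in>{tel T X Y s q |s q. s \<in> S \<and> q \<in> Q}. f t = g t"
    and p: "p \<in> carrier (tobj T X Y)"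
  note bf = vbilin_comp_tel[OF X Y f] and bg = vbilin_comp_tel[OF X Y g]
  have 1: "f (tel T X Y x q) = g (tel T X Y x q)" if "x \<in> carrier X" "q \<in> Q" for x q
    by (rule generatesD[OF S Z, of "\<lambda>x. f (tel T X Y x q)" "\<lambda>x. g (tel T X Y x q)"])
      (use bf bg eq that sub in \<open>auto simp: vbilin_def\<close>)
  have 2: "f (tel T X Y x y) = g (tel T X Y x y)" if "x \<in> carrier X" "y \<in> carrier Y" for x y
    by (rule generatesD[OF Q Z, of "\<lambda>y. f (tel T X Y x y)" "\<lambda>y. g (tel T X Y x y)"])
      (use bf bg that 1 in \<open>auto simp: vbilin_def\<close>)
  have "tlift V T X Y Z (\<lambda>x y. g (tel T X Y x y)) = restrict f (carrier (tobj T X Y))"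
    by (rule tlift_eqI) (use X Y Z f 2 in \<open>auto intro: vhomI\<close>)
  moreover have "tlift V T X Y Z (\<lambda>x y. g (tel T X Y x y)) = restrict g (carrier (tobj T X Y))"
    by (rule tlift_eqI) (use X Y Z g in \<open>auto intro: vhomI\<close>)
  ultimately show "f p = g p"
    using p by (metis restrict_apply')
qed

lemma tobj_eqI:
  fixes Z :: "('k, 'v) module"
  assumes "vobj V X" and "vobj V Y" and "vobj V Z"
    and "vlin V (tobj T X Y) Z f" and "vlin V (tobj T X Y) Z g"
    and "\<And>x y. x \<in> carrier X \<Longrightarrow> y \<in> carrier Y \<Longrightarrow> f (tel T X Y x y) = g (tel T X Y x y)"
    and "p \<in> carrier (tobj T X Y)"
  shows "f p = g p"
  by (rule generatesD[OF generates_tobj[OF assms(1,2) generates_carrier generates_carrier] assms(3-5) _ assms(7)])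
    (auto simp: assms(6))

lemma vhom_tobj_eqI:
  fixes Z :: "('k, 'v) module"
  assumes "vobj V X" and "vobj V Y" and "vobj V Z"
    and "f \<in> vhom V (tobj T X Y) Z" and "g \<in> vhom V (tobj T X Y) Z"
    and "\<And>x y. x \<in> carrier X \<Longrightarrow> y \<in> carrier Y \<Longrightarrow> f (tel T X Y x y) = g (tel T X Y x y)"
  shows "f = g"
  by (rule vhom_ext[OF assms(4,5)])
    (rule tobj_eqI[OF assms(1-3) vhom_vlin[OF assms(4)] vhom_vlin[OF assms(5)] assms(6)])

section \<open>The unit object, products of maps and the associator\<close>

text \<open>The unit object is free on \<open>uel T\<close>: in the linear bases, inverting the
  bijection of \<open>is_unit_object\<close> gives a coordinate \<rho> in \<open>k\<close> or in the
  integers, and the map with value \<open>x\<close> at the generator multiplies \<open>x\<close> by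
  this coordinate.\<close>

lemma
  shows vobj_unit [simp, intro]: "vobj V I" and uel_closed [simp, intro]: "uel T \<in> carrier I"
    and generates_uel: "generates V I {uel T}"
    and unit_map_ex: "\<And>X :: ('k, 'v) module. \<And>x. vobj V X \<Longrightarrow> x \<in> carrier X \<Longrightarrow> \<exists>f. f \<in> vhom V I X \<and> f (uel T) = x"
proof -
  \<comment> \<open>All four facts form one conjunction so that the three bases are separated only
    once.\<close>
  have "vobj V I \<and> uel T \<in> carrier I \<and> generates V I {uel T} \<and>
    (\<forall>(X :: ('k, 'v) module) x. vobj V X \<longrightarrow> x \<in> carrier X \<longrightarrow> (\<exists>f. f \<in> vhom V I X \<and> f (uel T) = x))"
  proof (cases V)
    case (ModK k)
    have I: "module k I" and u: "uel T \<in> carrier I"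
      and bij: "bij_betw (\<lambda>r. r \<odot>\<^bsub>I\<^esub> uel T) (carrier k) (carrier I)"
      using usual_tensor ModK by (auto simp: usual_tensor_def)
    interpret I: module k I
      by (rule I)
    have ex: "\<exists>r\<in>carrier k. i = r \<odot>\<^bsub>I\<^esub> uel T" if "i \<in> carrier I" for i
      using bij that by (auto simp: bij_betw_def)
    have gen: "generates V I {uel T}"
      unfolding generates_def
    proof (intro conjI allI impI ballI)
      fix Z :: "('k, 'v) module" and f g i
      assume "vlin V I Z f" "vlin V I Z g" "\<forall>s\<in>{uel T}. f s = g s" "i \<in> carrier I"
      then show "f i = g i"
        using ex[of i] u ModK by (auto simp: vlin_iff)
    qed (use u in auto)
    have "\<exists>f. f \<in> vhom V I X \<and> f (uel T) = x" if X: "vobj V X" and x: "x \<in> carrier X"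
      for X :: "('k, 'v) module" and x
    proof -
      interpret X: module k X
        using X ModK by simp
      define \<rho> where "\<rho> = inv_into (carrier k) (\<lambda>r. r \<odot>\<^bsub>I\<^esub> uel T)"
      have \<rho>: "\<rho> (r \<odot>\<^bsub>I\<^esub> uel T) = r" if "r \<in> carrier k" for r
        unfolding \<rho>_def by (rule bij_betw_inv_into_left[OF bij that])
      have "vlin V I X (\<lambda>i. \<rho> i \<odot>\<^bsub>X\<^esub> x)"
        unfolding vlin_iff
      proof (intro conjI allI impI ballI)
        show "(\<lambda>i. \<rho> i \<odot>\<^bsub>X\<^esub> x) \<in> carrier I \<rightarrow> carrier X"
          using \<rho> x by (auto dest!: ex)
        fix i j assume "i \<in> carrier I" "j \<in> carrier I"
        then obtain r s where rs: "r \<in> carrier k" "s \<in> carrier k"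
          and ij: "i = r \<odot>\<^bsub>I\<^esub> uel T" "j = s \<odot>\<^bsub>I\<^esub> uel T"
          using ex by metis
        have "i \<oplus>\<^bsub>I\<^esub> j = (r \<oplus>\<^bsub>k\<^esub> s) \<odot>\<^bsub>I\<^esub> uel T"
          using rs u unfolding ij by (simp add: I.smult_l_distr)
        then show "\<rho> (i \<oplus>\<^bsub>I\<^esub> j) \<odot>\<^bsub>X\<^esub> x = \<rho> i \<odot>\<^bsub>X\<^esub> x \<oplus>\<^bsub>X\<^esub> \<rho> j \<odot>\<^bsub>X\<^esub> x"
          using x rs by (simp add: \<rho> ij X.smult_l_distr)
      next
        fix k' r i assume "V = ModK k'" "r \<in> carrier k'" "i \<in> carrier I"
        then have r: "r \<in> carrier k" and i: "i \<in> carrier I"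
          using ModK by auto
        obtain s where s: "s \<in> carrier k" and si: "i = s \<odot>\<^bsub>I\<^esub> uel T"
          using ex[OF i] by metis
        have "r \<odot>\<^bsub>I\<^esub> i = (r \<otimes>\<^bsub>k\<^esub> s) \<odot>\<^bsub>I\<^esub> uel T"
          using r s u unfolding si by (simp add: I.smult_assoc1)
        then show "\<rho> (r \<odot>\<^bsub>I\<^esub> i) \<odot>\<^bsub>X\<^esub> x = r \<odot>\<^bsub>X\<^esub> (\<rho> i \<odot>\<^bsub>X\<^esub> x)"
          using x r s by (simp add: \<rho> si X.smult_assoc1)
      qed
      moreover have "\<rho> (uel T) \<odot>\<^bsub>X\<^esub> x = x"
        using \<rho>[of "\<one>\<^bsub>k\<^esub>"] u x by simp
      ultimately show ?thesis
        using I u ModK by (intro exI[of _ "\<lambda>i\<in>carrier I. \<rho> i \<odot>\<^bsub>X\<^esub> x"]) (auto intro: vhomI)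
    qed
    then show ?thesis
      using I u gen ModK by simp
  next
    case AbGrp
    have I: "abelian_group I" and u: "uel T \<in> carrier I"
      and bij: "bij_betw (\<lambda>n::int. add_pow I n (uel T)) UNIV (carrier I)"
      using usual_tensor AbGrp by (auto simp: usual_tensor_def)
    interpret I: abelian_group I
      by (rule I)
    have ex: "\<exists>n::int. i = add_pow I n (uel T)" if "i \<in> carrier I" for i
      using bij that by (auto simp: bij_betw_def)
    have gen: "generates V I {uel T}"
      unfolding generates_def
    proof (intro conjI allI impI ballI)
      fix Z :: "('k, 'v) module" and f g i
      assume Z: "vobj V Z" and f: "vlin V I Z f" and g: "vlin V I Z g"
        and eq: "\<forall>s\<in>{uel T}. f s = g s" and i: "i \<in> carrier I"
      interpret Z: abelian_group Z
        using Z AbGrp by simp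
      have hom: "f \<in> hom (add_monoid I) (add_monoid Z)" "g \<in> hom (add_monoid I) (add_monoid Z)"
        using f g AbGrp by auto
      obtain n :: int where n: "i = add_pow I n (uel T)"
        using ex[OF i] by metis
      show "f i = g i"
        using hom_int_pow[OF hom(1) _ I.a_group Z.a_group, of "uel T" n]
          hom_int_pow[OF hom(2) _ I.a_group Z.a_group, of "uel T" n] u eq n
        by (simp add: add_pow_def)
    qed (use u in auto)
    have "\<exists>f. f \<in> vhom V I X \<and> f (uel T) = x" if X: "vobj V X" and x: "x \<in> carrier X"
      for X :: "('k, 'v) module" and x
    proof -
      interpret X: abelian_group X
        using X AbGrp by simp
      define \<rho> where "\<rho> = inv_into UNIV (\<lambda>n::int. add_pow I n (uel T))"
      have \<rho>: "\<rho> (add_pow I n (uel T)) = n" for n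
        unfolding \<rho>_def by (rule bij_betw_inv_into_left[OF bij UNIV_I])
      have "vlin V I X (\<lambda>i. add_pow X (\<rho> i) x)"
        unfolding vlin_iff
      proof (intro conjI allI impI ballI)
        show "(\<lambda>i. add_pow X (\<rho> i) x) \<in> carrier I \<rightarrow> carrier X"
          using x by auto
        fix i j assume "i \<in> carrier I" "j \<in> carrier I"
        then obtain m n :: int where ij: "i = add_pow I m (uel T)" "j = add_pow I n (uel T)"
          using ex by metis
        have "i \<oplus>\<^bsub>I\<^esub> j = add_pow I (m + n) (uel T)"
          using u unfolding ij by (simp add: I.add.int_pow_mult)
        then show "add_pow X (\<rho> (i \<oplus>\<^bsub>I\<^esub> j)) x = add_pow X (\<rho> i) x \<oplus>\<^bsub>X\<^esub> add_pow X (\<rho> j) x"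
          using x by (simp add: \<rho> ij X.add.int_pow_mult)
      qed (use AbGrp in simp)
      moreover have "add_pow X (\<rho> (uel T)) x = x"
        using \<rho>[of 1] u x by simp
      ultimately show ?thesis
        using I u AbGrp by (intro exI[of _ "\<lambda>i\<in>carrier I. add_pow X (\<rho> i) x"]) (auto intro: vhomI)
    qed
    then show ?thesis
      using I u gen AbGrp by simp
  next
    case SetCat
    then have I: "carrier I = {uel T}"
      using usual_tensor by (auto simp: usual_tensor_def)
    have "(\<lambda>i\<in>carrier I. x) \<in> vhom V I X" if "x \<in> carrier X" for x and X :: "('k, 'v) module"
      using SetCat that by (auto simp: vhom_def)
    then have "\<exists>f. f \<in> vhom V I X \<and> f (uel T) = x" if "x \<in> carrier X" for x and X :: "('k, 'v) module"
      using that I by (intro exI[of _ "\<lambda>i\<in>carrier I. x"]) auto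
    then show ?thesis
      using SetCat I by (simp add: generates_def)
  qed
  then show "vobj V I" "uel T \<in> carrier I" "generates V I {uel T}"
    "\<And>X :: ('k, 'v) module. \<And>x. vobj V X \<Longrightarrow> x \<in> carrier X \<Longrightarrow> \<exists>f. f \<in> vhom V I X \<and> f (uel T) = x"
    by blast+
qed

text \<open>The usual passage from elements of \<open>X\<close> to morphisms from the unit object to
  \<open>X\<close>; it supplies the units of monoids that are given by an element.\<close>

definition unit_map :: "('k, 'v) module \<Rightarrow> 'v \<Rightarrow> 'v \<Rightarrow> 'v" where
  "unit_map X x = (SOME f. f \<in> vhom V I X \<and> f (uel T) = x)"

lemma
  assumes "vobj V X" and "x \<in> carrier X"
  shows unit_map_vhom: "unit_map X x \<in> vhom V I X" and unit_map_uel: "unit_map X x (uel T) = x"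
  using someI_ex[OF unit_map_ex[OF assms]] unfolding unit_map_def by auto

text \<open>Linearity in \<open>x\<close> need only be tested at the generator of the unit object,
  where the map is the identity. The lifts of these bilinear maps are the unit constraints.\<close>

lemma unit_map_vbilin:
  assumes X: "vobj V X"
  shows "vbilin V I X X (\<lambda>i x. unit_map X x i)" and "vbilin V X I X (unit_map X)"
proof -
  have *: "vlin V X X (\<lambda>x. unit_map X x i)" if "i \<in> carrier I" for i
  proof (rule vlin_in_parameter[OF generates_uel X X _ _ that])
    show "vlin V I X (unit_map X x)" if "x \<in> carrier X" for x
      using unit_map_vhom[OF X that] by (rule vhom_vlin)
    show "vlin V X X (\<lambda>x. unit_map X x s)" if "s \<in> {uel T}" for s
      using that unit_map_uel[OF X] by (auto intro!: vlin_cong[OF X vlin_id])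
  qed
  show "vbilin V I X X (\<lambda>i x. unit_map X x i)" "vbilin V X I X (unit_map X)"
    using * unit_map_vhom[OF X] by (auto simp: vbilin_def dest: vhom_vlin)
qed

lemma vhom_unit_eqI:
  fixes Z :: "('k, 'v) module"
  assumes "vobj V Z" and "f \<in> vhom V I Z" and "g \<in> vhom V I Z" and "f (uel T) = g (uel T)"
  shows "f = g"
  by (rule vhom_ext[OF assms(2,3)],
      rule generatesD[OF generates_uel assms(1) vhom_vlin[OF assms(2)] vhom_vlin[OF assms(3)]])
    (auto simp: assms(4))

lemma Lun_unique:
  fixes Z :: "('k, 'v) module"
  assumes "vobj V X" and "vobj V Z" and "f \<in> vhom V (tobj T I X) Z" and "g \<in> vhom V (tobj T I X) Z"
    and "\<And>x. x \<in> carrier X \<Longrightarrow> f (tel T I X (uel T) x) = g (tel T I X (uel T) x)"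
  shows "f = g"
  by (rule vhom_ext[OF assms(3,4)],
      rule generatesD[OF generates_tobj[OF _ _ generates_uel generates_carrier] assms(2)
        vhom_vlin[OF assms(3)] vhom_vlin[OF assms(4)]])
    (auto simp: assms)

lemma Run_unique:
  fixes Z :: "('k, 'v) module"
  assumes "vobj V X" and "vobj V Z" and "f \<in> vhom V (tobj T X I) Z" and "g \<in> vhom V (tobj T X I) Z"
    and "\<And>x. x \<in> carrier X \<Longrightarrow> f (tel T X I x (uel T)) = g (tel T X I x (uel T))"
  shows "f = g"
  by (rule vhom_ext[OF assms(3,4)],
      rule generatesD[OF generates_tobj[OF _ _ generates_carrier generates_uel] assms(2)
        vhom_vlin[OF assms(3)] vhom_vlin[OF assms(4)]])
    (auto simp: assms)

lemma Lun_eqI: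
  assumes "vobj V X" and "f \<in> vhom V (tobj T I X) X"
    and "\<And>x. x \<in> carrier X \<Longrightarrow> f (tel T I X (uel T) x) = x"
  shows "Lun M X = f"
  using assms by (auto simp: base_cat_def intro!: the_equality intro: Lun_unique)

lemma Run_eqI:
  assumes "vobj V X" and "f \<in> vhom V (tobj T X I) X"
    and "\<And>x. x \<in> carrier X \<Longrightarrow> f (tel T X I x (uel T)) = x"
  shows "Run M X = f"
  using assms by (auto simp: base_cat_def intro!: the_equality intro: Run_unique)

lemma
  assumes X: "vobj V X"
  shows Lun_tel: "x \<in> carrier X \<Longrightarrow> Lun M X (tel T I X (uel T) x) = x"
    and Run_tel: "x \<in> carrier X \<Longrightarrow> Run M X (tel T X I x (uel T)) = x"
proof -
  note l = tlift_vhom[OF vobj_unit X X unit_map_vbilin(1)[OF X]]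
    tlift_tel[OF vobj_unit X X unit_map_vbilin(1)[OF X]]
  note r = tlift_vhom[OF X vobj_unit X unit_map_vbilin(2)[OF X]]
    tlift_tel[OF X vobj_unit X unit_map_vbilin(2)[OF X]]
  have "Lun M X = tlift V T I X X (\<lambda>i x. unit_map X x i)"
    using X by (intro Lun_eqI l) (simp_all add: l unit_map_uel)
  moreover have "Run M X = tlift V T X I X (unit_map X)"
    using X by (intro Run_eqI r) (simp_all add: r unit_map_uel)
  ultimately show "x \<in> carrier X \<Longrightarrow> Lun M X (tel T I X (uel T) x) = x"
    "x \<in> carrier X \<Longrightarrow> Run M X (tel T X I x (uel T)) = x"
    using l r X by (simp_all add: unit_map_uel)
qed

lemma
  assumes X: "vobj V X" "vobj V X'" and Y: "vobj V Y" "vobj V Y'"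
    and f: "f \<in> vhom V X X'" and g: "g \<in> vhom V Y Y'"
  shows TenH_vhom: "TenH M X X' Y Y' f g \<in> vhom V (tobj T X Y) (tobj T X' Y')"
    and TenH_tel: "x \<in> carrier X \<Longrightarrow> y \<in> carrier Y \<Longrightarrow>
      TenH M X X' Y Y' f g (tel T X Y x y) = tel T X' Y' (f x) (g y)"
proof -
  have "vbilin V X Y (tobj T X' Y') (\<lambda>x y. tel T X' Y' (f x) (g y))"
    unfolding vbilin_def
    using vlin_comp[OF vhom_vlin[OF f] vlin_tel_left[OF X(2) Y(2)]]
      vlin_comp[OF vhom_vlin[OF g] vlin_tel_right[OF X(2) Y(2)]] vhom_closed[OF f] vhom_closed[OF g]
    by blast
  then show "TenH M X X' Y Y' f g \<in> vhom V (tobj T X Y) (tobj T X' Y')"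
    "x \<in> carrier X \<Longrightarrow> y \<in> carrier Y \<Longrightarrow>
      TenH M X X' Y Y' f g (tel T X Y x y) = tel T X' Y' (f x) (g y)"
    using X Y by (simp_all add: base_cat_def tlift_vhom tlift_tel)
qed

lemma generates_tobj3:
  assumes "vobj V X" and "vobj V Y" and "vobj V Z"
  shows "generates V (tobj T X (tobj T Y Z))
    {tel T X (tobj T Y Z) x (tel T Y Z y z) |x y z. x \<in> carrier X \<and> y \<in> carrier Y \<and> z \<in> carrier Z}"
proof -
  have "{tel T X (tobj T Y Z) s q |s q. s \<in> carrier X \<and> q \<in> {tel T Y Z s q |s q. s \<in> carrier Y \<and> q \<in> carrier Z}} =
    {tel T X (tobj T Y Z) x (tel T Y Z y z) |x y z. x \<in> carrier X \<and> y \<in> carrier Y \<and> z \<in> carrier Z}"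
    by blast
  then show ?thesis
    using generates_tobj[OF assms(1) vobj_tobj[OF assms(2,3)] generates_carrier
        generates_tobj[OF assms(2,3) generates_carrier generates_carrier]] by simp
qed

lemma vhom_tobj3_eqI:
  fixes W :: "('k, 'v) module"
  assumes "vobj V X" and "vobj V Y" and "vobj V Z" and "vobj V W"
    and "f \<in> vhom V (tobj T X (tobj T Y Z)) W" and "g \<in> vhom V (tobj T X (tobj T Y Z)) W"
    and "\<And>x y z. x \<in> carrier X \<Longrightarrow> y \<in> carrier Y \<Longrightarrow> z \<in> carrier Z \<Longrightarrow>
      f (tel T X (tobj T Y Z) x (tel T Y Z y z)) = g (tel T X (tobj T Y Z) x (tel T Y Z y z))"
  shows "f = g"
  by (rule vhom_ext[OF assms(5,6)],
      rule generatesD[OF generates_tobj3[OF assms(1-3)] assms(4) vhom_vlin[OF assms(5)] vhom_vlin[OF assms(6)]])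
    (auto simp: assms(7))

text \<open>For fixed \<open>x\<close> the assignment
  \<open>(y, z) \<mapsto> (x \<otimes> y) \<otimes> z\<close> lifts to a map \<open>F x\<close>. By
  \<open>vlin_in_parameter\<close> it is linear in \<open>x\<close>, so a second lift gives the
  associator.\<close>

lemma
  assumes X: "vobj V X" and Y: "vobj V Y" and Z: "vobj V Z"
  shows Asc_vhom: "Asc M X Y Z \<in> vhom V (tobj T X (tobj T Y Z)) (tobj T (tobj T X Y) Z)"
    and Asc_tel: "x \<in> carrier X \<Longrightarrow> y \<in> carrier Y \<Longrightarrow> z \<in> carrier Z \<Longrightarrow>
      Asc M X Y Z (tel T X (tobj T Y Z) x (tel T Y Z y z)) = tel T (tobj T X Y) Z (tel T X Y x y) z"
proof -
  let ?W = "tobj T (tobj T X Y) Z"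
  define F where "F x = tlift V T Y Z ?W (\<lambda>y z. tel T (tobj T X Y) Z (tel T X Y x y) z)" for x
  have W: "vobj V ?W"
    using X Y Z by simp
  have *: "vbilin V Y Z ?W (\<lambda>y z. tel T (tobj T X Y) Z (tel T X Y x y) z)" if "x \<in> carrier X" for x
    using that X Y Z
    by (auto simp: vbilin_def intro!: vlin_tel_right vlin_comp[OF vlin_tel_right, of X Y _ _ "\<lambda>y. tel T (tobj T X Y) Z y _", OF _ _ _ vlin_tel_left])
  have F: "F x \<in> vhom V (tobj T Y Z) ?W" if "x \<in> carrier X" for x
    unfolding F_def using Y Z W *[OF that] by (rule tlift_vhom)
  have F_tel: "F x (tel T Y Z y z) = tel T (tobj T X Y) Z (tel T X Y x y) z"
    if "x \<in> carrier X" "y \<in> carrier Y" "z \<in> carrier Z" for x y z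
    unfolding F_def using that by (intro tlift_tel Y Z W *)
  have bF: "vbilin V X (tobj T Y Z) ?W F"
    unfolding vbilin_def
  proof (intro conjI ballI)
    fix p assume p: "p \<in> carrier (tobj T Y Z)"
    show "vlin V X ?W (\<lambda>x. F x p)"
    proof (rule vlin_in_parameter[OF generates_tobj[OF Y Z generates_carrier generates_carrier] X W _ _ p])
      show "vlin V X ?W (\<lambda>x. F x s)"
        if s: "s \<in> {tel T Y Z s q |s q. s \<in> carrier Y \<and> q \<in> carrier Z}" for s
      proof -
        obtain y z where "y \<in> carrier Y" "z \<in> carrier Z" "s = tel T Y Z y z"
          using s by blast
        then show ?thesis
          using X Y Z F_tel
          by (auto intro!: vlin_cong[OF X vlin_comp[OF vlin_tel_left[of X Y y] vlin_tel_left[of "tobj T X Y" Z z]]])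
      qed
    qed (use F in \<open>auto dest: vhom_vlin\<close>)
  qed (use F in \<open>auto dest: vhom_vlin\<close>)
  let ?f = "tlift V T X (tobj T Y Z) ?W F"
  have f: "?f \<in> vhom V (tobj T X (tobj T Y Z)) ?W"
    using X Y Z bF by (intro tlift_vhom) auto
  have f_tel: "?f (tel T X (tobj T Y Z) x (tel T Y Z y z)) = tel T (tobj T X Y) Z (tel T X Y x y) z"
    if "x \<in> carrier X" "y \<in> carrier Y" "z \<in> carrier Z" for x y z
    using that X Y Z bF by (subst tlift_tel) (auto simp: F_tel)
  have "Asc M X Y Z = ?f"
    unfolding base_cat_def moncat.simps
  proof (rule the_equality)
    fix h assume h: "h \<in> vhom V (tobj T X (tobj T Y Z)) ?W \<and>
      (\<forall>x\<in>carrier X. \<forall>y\<in>carrier Y. \<forall>z\<in>carrier Z.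
        h (tel T X (tobj T Y Z) x (tel T Y Z y z)) = tel T (tobj T X Y) Z (tel T X Y x y) z)"
    then show "h = ?f"
      by (intro vhom_tobj3_eqI[OF X Y Z W _ f]) (simp_all add: f_tel)
  qed (use f f_tel in blast)
  then show "Asc M X Y Z \<in> vhom V (tobj T X (tobj T Y Z)) ?W"
    "x \<in> carrier X \<Longrightarrow> y \<in> carrier Y \<Longrightarrow> z \<in> carrier Z \<Longrightarrow>
      Asc M X Y Z (tel T X (tobj T Y Z) x (tel T Y Z y z)) = tel T (tobj T X Y) Z (tel T X Y x y) z"
    using f f_tel by simp_all
qed

text \<open>With \<open>H\<close> all maps that coequalize \<open>f\<close> and \<open>g\<close>,
  the elements \<open>f p\<close> and \<open>g p\<close> are related by construction. A map in
  \<open>H\<close> is constant on classes, so its restriction to representatives is the mediating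
  map; uniqueness holds since \<open>q\<close> is onto.\<close>

lemma coequalizer_exists:
  fixes P P' :: "('k, 'v) module"
  assumes P: "vobj V P" and f: "f \<in> vhom V P' P" and g: "g \<in> vhom V P' P" and P': "vobj V P'"
  shows "\<exists>z q. is_coequalizer M P' P f g z q"
proof -
  define H :: "(('k, 'v) module \<times> ('v \<Rightarrow> 'v)) set" where "H = {(W, h). vobj V W \<and> h \<in> vhom V P W \<and> compose (carrier P') h f = compose (carrier P') h g}"
  define q where "q = restrict (quot_rep P H) (carrier P)"
  let ?Q = "quot_obj P H"
  have H: "vobj V W \<and> vlin V P W h" if "(W, h) \<in> H" for W :: "('k, 'v) module" and h
    using that by (auto simp: H_def dest: vhom_vlin)
  have Q: "vobj V ?Q"
    using vobj_quot_obj[OF base_ok P H] .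
  have q: "q \<in> vhom V P ?Q"
    unfolding q_def using vhomI[OF P vlin_quot_rep[OF base_ok P H]] .
  have car: "carrier ?Q = q ` carrier P"
    by (auto simp: quot_obj_def q_def)
  have "kernel_rel P H (f p) (g p)" if "p \<in> carrier P'" for p
    using that f g by (auto simp: kernel_rel_def H_def vhom_closed dest!: fun_cong[of _ _ p] simp: compose_eq)
  then have fg: "compose (carrier P') q f = compose (carrier P') q g"
    using f g by (auto simp: compose_def q_def vhom_closed quot_rep_eq)
  have "\<exists>!k. k \<in> vhom V ?Q W \<and> compose (carrier P) k q = h"
    if W: "vobj V W" and h: "h \<in> vhom V P W" and eq: "compose (carrier P') h f = compose (carrier P') h g"
    for W :: "('k, 'v) module" and h
  proof -
    have Wh: "(W, h) \<in> H"
      using W h eq by (simp add: H_def)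
    have hq: "h (q p) = h p" if "p \<in> carrier P" for p
      using quot_rep_value[OF that Wh] that by (simp add: q_def)
    have sub: "carrier ?Q \<subseteq> carrier P"
      by (auto simp: car q_def quot_rep_closed)
    have add: "h (x \<oplus>\<^bsub>?Q\<^esub> y) = h (x \<oplus>\<^bsub>P\<^esub> y)" if "V \<noteq> SetCat" "x \<in> carrier P" "y \<in> carrier P" for x y
      using that quot_rep_value[OF _ Wh] vobj_add_closed[OF _ P] by (simp add: quot_obj_def)
    have smult: "h (r \<odot>\<^bsub>?Q\<^esub> x) = h (r \<odot>\<^bsub>P\<^esub> x)"
      if V: "V = ModK k" and "r \<in> carrier k" "x \<in> carrier P" for k r x
      using that quot_rep_value[OF _ Wh] vobj_smult_closed[OF P[unfolded V]] by (simp add: quot_obj_def)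
    have lin: "vlin V ?Q W h"
      using vhom_vlin[OF h] sub add smult unfolding vlin_iff by (auto simp: subset_iff)
    show ?thesis
    proof (rule ex1I[of _ "restrict h (carrier ?Q)"])
      have "compose (carrier P) (restrict h (carrier ?Q)) q = h"
        using h by (intro extensionalityI[of _ "carrier P"]) (auto simp: compose_def car hq vhom_def)
      then show "restrict h (carrier ?Q) \<in> vhom V ?Q W \<and> compose (carrier P) (restrict h (carrier ?Q)) q = h"
        using vhomI[OF Q lin] by blast
    next
      fix k assume k: "k \<in> vhom V ?Q W \<and> compose (carrier P) k q = h"
      have "k x = h x" if x: "x \<in> carrier ?Q" for x
      proof -
        obtain p where "p \<in> carrier P" "x = q p"
          using x car by blast
        then show ?thesis
          using k hq compose_eq[of p "carrier P" k q] by simp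
      qed
      then show "k = restrict h (carrier ?Q)"
        using k by (intro extensionalityI[of _ "carrier ?Q"]) (auto simp: vhom_def)
    qed
  qed
  then have "is_coequalizer M P' P f g ?Q q"
    using Q q fg by (simp add: is_coequalizer_def)
  then show ?thesis
    by blast
qed

section \<open>Elementwise criteria for monoids, modules and their maps\<close>

lemma whiskl_tel:
  "vobj V X \<Longrightarrow> vobj V Y \<Longrightarrow> vobj V Y' \<Longrightarrow> g \<in> vhom V Y Y' \<Longrightarrow> x \<in> carrier X \<Longrightarrow> y \<in> carrier Y \<Longrightarrow>
     TenH M X X Y Y' (\<lambda>x\<in>carrier X. x) g (tel T X Y x y) = tel T X Y' x (g y)"
  by (simp add: TenH_tel vhom_id)

lemma whiskr_tel:
  "vobj V X \<Longrightarrow> vobj V X' \<Longrightarrow> vobj V Y \<Longrightarrow> f \<in> vhom V X X' \<Longrightarrow> x \<in> carrier X \<Longrightarrow> y \<in> carrier Y \<Longrightarrow>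
     TenH M X X' Y Y f (\<lambda>x\<in>carrier Y. x) (tel T X Y x y) = tel T X' Y (f x) y"
  by (simp add: TenH_tel vhom_id)

lemma is_monoidI:
  assumes X: "vobj V X" and m: "m \<in> vhom V (tobj T X X) X" and n: "n \<in> vhom V I X"
    and assoc: "\<And>x y z. x \<in> carrier X \<Longrightarrow> y \<in> carrier X \<Longrightarrow> z \<in> carrier X \<Longrightarrow>
      m (tel T X X x (m (tel T X X y z))) = m (tel T X X (m (tel T X X x y)) z)"
    and left: "\<And>x. x \<in> carrier X \<Longrightarrow> m (tel T X X (n (uel T)) x) = x"
    and right: "\<And>x. x \<in> carrier X \<Longrightarrow> m (tel T X X x (n (uel T))) = x"
  shows "is_monoid M \<lparr>mob = X, mmu = m, mun = n\<rparr>"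
proof -
  let ?XXX = "tobj T X (tobj T X X)"
  note simps = compose_eq Asc_tel whiskl_tel whiskr_tel vhom_closed[OF m] vhom_closed[OF n]
  have "compose (carrier ?XXX) m (whiskl M X (tobj T X X) X m) =
      compose (carrier ?XXX) m (compose (carrier ?XXX) (whiskr M (tobj T X X) X X m) (Asc M X X X))"
  proof (rule vhom_tobj3_eqI[OF X X X X])
    show "compose (carrier ?XXX) m (whiskl M X (tobj T X X) X m) \<in> vhom V ?XXX X"
      using X m by (auto intro!: vhom_comp[OF TenH_vhom m] vhom_id)
    show "compose (carrier ?XXX) m (compose (carrier ?XXX) (whiskr M (tobj T X X) X X m) (Asc M X X X)) \<in> vhom V ?XXX X"
      using X m by (auto intro!: vhom_comp[OF vhom_comp[OF Asc_vhom TenH_vhom] m] vhom_id)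
  qed (use X m in \<open>simp add: simps assoc\<close>)
  moreover have "Lun M X = compose (carrier (tobj T I X)) m (whiskr M I X X n)"
  proof (rule Lun_eqI[OF X])
    show "compose (carrier (tobj T I X)) m (whiskr M I X X n) \<in> vhom V (tobj T I X) X"
      using X n by (auto intro!: vhom_comp[OF TenH_vhom m] vhom_id)
  qed (use X n in \<open>simp add: simps left\<close>)
  moreover have "Run M X = compose (carrier (tobj T X I)) m (whiskl M X I X n)"
  proof (rule Run_eqI[OF X])
    show "compose (carrier (tobj T X I)) m (whiskl M X I X n) \<in> vhom V (tobj T X I) X"
      using X n by (auto intro!: vhom_comp[OF TenH_vhom m] vhom_id)
  qed (use X n in \<open>simp add: simps right\<close>)
  ultimately show ?thesis
    using X m n by (simp add: is_monoid_def)
qed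

lemma is_rmoduleI:
  assumes X: "vobj V (rob X)" and A: "vobj V (mob A)"
    and m: "mmu A \<in> vhom V (tobj T (mob A) (mob A)) (mob A)" and n: "mun A \<in> vhom V I (mob A)"
    and p: "ract X \<in> vhom V (tobj T (rob X) (mob A)) (rob X)"
    and assoc: "\<And>x a b. x \<in> carrier (rob X) \<Longrightarrow> a \<in> carrier (mob A) \<Longrightarrow> b \<in> carrier (mob A) \<Longrightarrow>
      ract_el T A X x (mmul T A a b) = ract_el T A X (ract_el T A X x a) b"
    and unit: "\<And>x. x \<in> carrier (rob X) \<Longrightarrow> ract_el T A X x (mone T A) = x"
  shows "is_rmodule M A X"
proof -
  let ?X = "rob X" and ?A = "mob A"
  let ?XAA = "tobj T ?X (tobj T ?A ?A)"
  note simps = compose_eq Asc_tel whiskl_tel whiskr_tel vhom_closed[OF m] vhom_closed[OF n] vhom_closed[OF p]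
  have "compose (carrier ?XAA) (ract X) (whiskl M ?X (tobj T ?A ?A) ?A (mmu A)) =
      compose (carrier ?XAA) (ract X) (compose (carrier ?XAA) (whiskr M (tobj T ?X ?A) ?X ?A (ract X)) (Asc M ?X ?A ?A))"
  proof (rule vhom_tobj3_eqI[OF X A A X])
    show "compose (carrier ?XAA) (ract X) (whiskl M ?X (tobj T ?A ?A) ?A (mmu A)) \<in> vhom V ?XAA ?X"
      using X A m by (auto intro!: vhom_comp[OF TenH_vhom p] vhom_id)
    show "compose (carrier ?XAA) (ract X) (compose (carrier ?XAA) (whiskr M (tobj T ?X ?A) ?X ?A (ract X)) (Asc M ?X ?A ?A)) \<in> vhom V ?XAA ?X"
      using X A p by (auto intro!: vhom_comp[OF vhom_comp[OF Asc_vhom TenH_vhom] p] vhom_id)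
  qed (use X A m p assoc in \<open>simp add: simps ract_el_def mmul_def\<close>)
  moreover have "Run M ?X = compose (carrier (tobj T ?X I)) (ract X) (whiskl M ?X I ?A (mun A))"
  proof (rule Run_eqI[OF X])
    show "compose (carrier (tobj T ?X I)) (ract X) (whiskl M ?X I ?A (mun A)) \<in> vhom V (tobj T ?X I) ?X"
      using X A n by (auto intro!: vhom_comp[OF TenH_vhom p] vhom_id)
  qed (use X A n unit in \<open>simp add: simps ract_el_def mone_def\<close>)
  ultimately show ?thesis
    using X p by (simp add: is_rmodule_def)
qed

lemma rmodule_mapsI:
  assumes X: "vobj V (rob X)" and Y: "vobj V (rob Y)" and A: "vobj V (mob A)"
    and p: "ract X \<in> vhom V (tobj T (rob X) (mob A)) (rob X)"
    and q: "ract Y \<in> vhom V (tobj T (rob Y) (mob A)) (rob Y)"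
    and f: "f \<in> vhom V (rob X) (rob Y)"
    and eq: "\<And>x a. x \<in> carrier (rob X) \<Longrightarrow> a \<in> carrier (mob A) \<Longrightarrow>
      f (ract_el T A X x a) = ract_el T A Y (f x) a"
  shows "f \<in> rmodule_maps M A X Y"
proof -
  have "compose (carrier (tobj T (rob X) (mob A))) f (ract X) =
      compose (carrier (tobj T (rob X) (mob A))) (ract Y) (whiskr M (rob X) (rob Y) (mob A) f)"
  proof (rule vhom_tobj_eqI[OF X A Y])
    show "compose (carrier (tobj T (rob X) (mob A))) f (ract X) \<in> vhom V (tobj T (rob X) (mob A)) (rob Y)"
      using X A by (auto intro!: vhom_comp[OF p f])
    show "compose (carrier (tobj T (rob X) (mob A))) (ract Y) (whiskr M (rob X) (rob Y) (mob A) f) \<in> vhom V (tobj T (rob X) (mob A)) (rob Y)"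
      using X A Y f by (auto intro!: vhom_comp[OF TenH_vhom q] vhom_id)
  qed (use X A Y f eq in \<open>simp add: compose_eq whiskr_tel ract_el_def\<close>)
  then show ?thesis
    using f by (simp add: rmodule_maps_def)
qed

lemma monoid_morphismI:
  assumes A: "vobj V (mob A)" and B: "vobj V (mob B)"
    and m: "mmu A \<in> vhom V (tobj T (mob A) (mob A)) (mob A)" and m': "mmu B \<in> vhom V (tobj T (mob B) (mob B)) (mob B)"
    and n: "mun A \<in> vhom V I (mob A)" and n': "mun B \<in> vhom V I (mob B)"
    and f: "f \<in> vhom V (mob A) (mob B)"
    and mult: "\<And>x y. x \<in> carrier (mob A) \<Longrightarrow> y \<in> carrier (mob A) \<Longrightarrow> f (mmul T A x y) = mmul T B (f x) (f y)"
    and unit: "f (mone T A) = mone T B"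
  shows "monoid_morphism M A B f"
proof -
  let ?AA = "tobj T (mob A) (mob A)"
  have "compose (carrier ?AA) f (mmu A) =
      compose (carrier ?AA) (mmu B) (TenH M (mob A) (mob B) (mob A) (mob B) f f)"
  proof (rule vhom_tobj_eqI[OF A A B])
    show "compose (carrier ?AA) f (mmu A) \<in> vhom V ?AA (mob B)"
      using A by (auto intro!: vhom_comp[OF m f])
    show "compose (carrier ?AA) (mmu B) (TenH M (mob A) (mob B) (mob A) (mob B) f f) \<in> vhom V ?AA (mob B)"
      using A B f by (auto intro!: vhom_comp[OF TenH_vhom m'])
  qed (use A B f mult in \<open>simp add: compose_eq TenH_tel mmul_def\<close>)
  moreover have "compose (carrier I) f (mun A) = mun B"
    by (rule vhom_unit_eqI[OF B vhom_comp[OF n f] n']) (use unit in \<open>simp_all add: compose_eq mone_def\<close>)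
  ultimately show ?thesis
    using f by (simp add: monoid_morphism_def)
qed

end

section \<open>Tensor products over a monoid\<close>

text \<open>Only the types of the structure maps of \<open>R\<close> are assumed. For the image
  monoid of a functor, the monoid laws are derived after this locale has been interpreted, from the
  bimodule laws of the object belonging to the unit (\<open>monoid_R\<close>).\<close>

locale bimodules = base_tensor V T for V :: "'k base" and T :: "('k, 'v) tensor_data" +
  fixes R :: "('k, 'v) vmon"
  assumes vobj_R [simp, intro]: "vobj V (mob R)"
    and mmu_R: "mmu R \<in> vhom V (tobj T (mob R) (mob R)) (mob R)"
    and mun_R: "mun R \<in> vhom V (uobj T) (mob R)"
begin

abbreviation "N \<equiv> bimod_cat M R"
abbreviation "RO \<equiv> mob R"
abbreviation "lmul B r x \<equiv> blact B (tel T RO (bob B) r x)"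
abbreviation "rmul B x r \<equiv> bract B (tel T (bob B) RO x r)"
abbreviation "bt B B' \<equiv> bten M R B B'"
abbreviation "bq B B' \<equiv> bepi M R B B'"
abbreviation "be B B' x y \<equiv> bel V T R B B' x y"

text \<open>Two actions without laws: exactly the data to which the coequalizer defining the product
  over \<open>R\<close> refers.\<close>

definition two_sided :: "('k, 'v) vbimod \<Rightarrow> bool" where
  "two_sided B \<longleftrightarrow> vobj V (bob B) \<and> blact B \<in> vhom V (tobj T RO (bob B)) (bob B) \<and>
     bract B \<in> vhom V (tobj T (bob B) RO) (bob B)"

lemma
  assumes "two_sided B"
  shows vobj_bob [simp, intro]: "vobj V (bob B)"
    and blact_vhom: "blact B \<in> vhom V (tobj T RO (bob B)) (bob B)"
    and bract_vhom: "bract B \<in> vhom V (tobj T (bob B) RO) (bob B)"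
    and lmul_closed [simp, intro]: "r \<in> carrier RO \<Longrightarrow> x \<in> carrier (bob B) \<Longrightarrow> lmul B r x \<in> carrier (bob B)"
    and rmul_closed [simp, intro]: "r \<in> carrier RO \<Longrightarrow> x \<in> carrier (bob B) \<Longrightarrow> rmul B x r \<in> carrier (bob B)"
  using assms vhom_closed[of "blact B" V "tobj T RO (bob B)" "bob B"]
    vhom_closed[of "bract B" V "tobj T (bob B) RO" "bob B"]
  by (auto simp: two_sided_def)

lemma
  assumes "two_sided B"
  shows lmul_vbilin: "vbilin V RO (bob B) (bob B) (lmul B)"
    and rmul_vbilin: "vbilin V (bob B) RO (bob B) (rmul B)"
  using vbilin_comp_tel[OF vobj_R vobj_bob vhom_vlin[OF blact_vhom]]
    vbilin_comp_tel[OF vobj_bob vobj_R vhom_vlin[OF bract_vhom]] assms by blast+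

text \<open>The choice made in \<open>balanced\<close> succeeds because coequalizers exist in the
  base.\<close>

lemma balanced_coequalizer:
  assumes B: "two_sided B" and B': "two_sided B'"
  shows "is_coequalizer M (tobj T (bob B) (tobj T RO (bob B'))) (tobj T (bob B) (bob B'))
    (whiskl M (bob B) (tobj T RO (bob B')) (bob B') (blact B'))
    (compose (carrier (tobj T (bob B) (tobj T RO (bob B'))))
       (whiskr M (tobj T (bob B) RO) (bob B) (bob B') (bract B)) (Asc M (bob B) RO (bob B')))
    (bt B B') (bq B B')"
proof -
  have "\<exists>z q. is_coequalizer M (tobj T (bob B) (tobj T RO (bob B'))) (tobj T (bob B) (bob B'))
    (whiskl M (bob B) (tobj T RO (bob B')) (bob B') (blact B'))
    (compose (carrier (tobj T (bob B) (tobj T RO (bob B'))))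
       (whiskr M (tobj T (bob B) RO) (bob B) (bob B') (bract B)) (Asc M (bob B) RO (bob B'))) z q"
    using B B' by (intro coequalizer_exists)
      (auto intro!: TenH_vhom vhom_comp Asc_vhom vhom_id blact_vhom bract_vhom)
  then show ?thesis
    unfolding balanced_def by (simp add: Let_def) (rule someI_ex[of "\<lambda>zq. is_coequalizer _ _ _ _ _ (fst zq) (snd zq)"], simp)
qed

lemma
  assumes B: "two_sided B" and B': "two_sided B'"
  shows vobj_bt [simp, intro]: "vobj V (bt B B')"
    and bq_vhom: "bq B B' \<in> vhom V (tobj T (bob B) (bob B')) (bt B B')"
    and be_closed [simp, intro]: "x \<in> carrier (bob B) \<Longrightarrow> y \<in> carrier (bob B') \<Longrightarrow> be B B' x y \<in> carrier (bt B B')"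
    and be_vbilin: "vbilin V (bob B) (bob B') (bt B B') (be B B')"
    and be_balanced: "x \<in> carrier (bob B) \<Longrightarrow> r \<in> carrier RO \<Longrightarrow> y \<in> carrier (bob B') \<Longrightarrow>
      be B B' (rmul B x r) y = be B B' x (lmul B' r y)"
proof -
  note c = balanced_coequalizer[OF B B', unfolded is_coequalizer_def base_cat_simps arr_base_cat]
  show 1: "vobj V (bt B B')" and 2: "bq B B' \<in> vhom V (tobj T (bob B) (bob B')) (bt B B')"
    using c by simp_all
  show "be B B' x y \<in> carrier (bt B B')" if "x \<in> carrier (bob B)" "y \<in> carrier (bob B')"
    unfolding bel_def using that B B' vhom_closed[OF 2] by simp
  show "vbilin V (bob B) (bob B') (bt B B') (be B B')"
    using vbilin_comp_tel[OF vobj_bob[OF B] vobj_bob[OF B'] vhom_vlin[OF 2]] by (simp add: bel_def)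
  \<comment> \<open>The balancing relation is the coequalizer equation evaluated at
    \<open>x \<otimes> (r \<otimes> y)\<close>.\<close>
  show "be B B' (rmul B x r) y = be B B' x (lmul B' r y)"
    if "x \<in> carrier (bob B)" "r \<in> carrier RO" "y \<in> carrier (bob B')"
    using c[THEN conjunct2, THEN conjunct2, THEN conjunct1,
        THEN fun_cong[of _ _ "tel T (bob B) (tobj T RO (bob B')) x (tel T RO (bob B') r y)"]] that B B'
    by (simp add: bel_def compose_eq Asc_tel whiskl_tel whiskr_tel blact_vhom bract_vhom)
qed

lemma be_lin:
  assumes B: "two_sided B" and B': "two_sided B'"
  shows "x \<in> carrier (bob B) \<Longrightarrow> vlin V (bob B') (bt B B') (be B B' x)"
    and "y \<in> carrier (bob B') \<Longrightarrow> vlin V (bob B) (bt B B') (\<lambda>x. be B B' x y)"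
  using be_vbilin[OF assms] by (simp_all add: vbilin_def)

text \<open>The universal property on elements: that \<beta> is balanced says, on threefold pure
  tensors, that its lift to the ordinary tensor product coequalizes the two actions.\<close>

lemma bt_lift_ex:
  fixes W :: "('k, 'v) module"
  assumes B: "two_sided B" and B': "two_sided B'" and W: "vobj V W"
    and b: "vbilin V (bob B) (bob B') W \<beta>"
    and bal: "\<And>x r y. x \<in> carrier (bob B) \<Longrightarrow> r \<in> carrier RO \<Longrightarrow> y \<in> carrier (bob B') \<Longrightarrow>
      \<beta> (rmul B x r) y = \<beta> x (lmul B' r y)"
  shows "\<exists>k. k \<in> vhom V (bt B B') W \<and>
    (\<forall>x\<in>carrier (bob B). \<forall>y\<in>carrier (bob B'). k (be B B' x y) = \<beta> x y)"
proof -
  let ?X = "bob B" and ?Y = "bob B'"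
  let ?xry = "tobj T ?X (tobj T RO ?Y)"
  let ?f = "whiskl M (bob B) (tobj T RO (bob B')) (bob B') (blact B')"
  let ?g = "compose (carrier ?xry)
       (whiskr M (tobj T (bob B) RO) (bob B) (bob B') (bract B)) (Asc M (bob B) RO (bob B'))"
  let ?h = "tlift V T ?X ?Y W \<beta>"
  note c = balanced_coequalizer[OF B B', unfolded is_coequalizer_def]
  have f: "?f \<in> vhom V ?xry (tobj T ?X ?Y)" and g: "?g \<in> vhom V ?xry (tobj T ?X ?Y)"
    using B B' by (auto intro!: TenH_vhom vhom_comp Asc_vhom vhom_id blact_vhom bract_vhom)
  have h_tel: "?h (tel T ?X ?Y x y) = \<beta> x y" if "x \<in> carrier ?X" "y \<in> carrier ?Y" for x y
    using that B B' W b by (simp add: tlift_tel)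
  have h: "?h \<in> vhom V (tobj T ?X ?Y) W"
    using B B' W b by (simp add: tlift_vhom)
  have "compose (carrier ?xry) ?h ?f = compose (carrier ?xry) ?h ?g"
  proof (rule vhom_tobj3_eqI[OF vobj_bob[OF B] vobj_R vobj_bob[OF B'] W])
    show "compose (carrier ?xry) ?h ?f \<in> vhom V ?xry W" "compose (carrier ?xry) ?h ?g \<in> vhom V ?xry W"
      using B B' vhom_comp[OF f h] vhom_comp[OF g h] by simp_all
    show "compose (carrier ?xry) ?h ?f (tel T ?X (tobj T RO ?Y) x (tel T RO ?Y r y)) =
        compose (carrier ?xry) ?h ?g (tel T ?X (tobj T RO ?Y) x (tel T RO ?Y r y))"
      if "x \<in> carrier ?X" "r \<in> carrier RO" "y \<in> carrier ?Y" for x r y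
      using that B B'
      by (simp add: compose_eq Asc_tel whiskl_tel whiskr_tel blact_vhom bract_vhom h_tel bal)
  qed
  then obtain k where k: "k \<in> vhom V (bt B B') W" "compose (carrier (tobj T ?X ?Y)) k (bq B B') = ?h"
    using ex1_implies_ex[OF c[THEN conjunct2, THEN conjunct2, THEN conjunct2, rule_format, of W ?h]] W h
    by auto
  have "k (be B B' x y) = \<beta> x y" if "x \<in> carrier ?X" "y \<in> carrier ?Y" for x y
    using that fun_cong[OF k(2), of "tel T ?X ?Y x y"] B B' by (simp add: bel_def compose_eq h_tel)
  then show ?thesis
    using k(1) by blast
qed

text \<open>Both \<open>k\<close> and \<open>k'\<close> are factorizations of the one map
  \<open>?h\<close> through the coequalizer, and such a factorization is unique.\<close>

lemma bepi_unique:
  fixes W :: "('k, 'v) module"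
  assumes B: "two_sided B" and B': "two_sided B'" and W: "vobj V W"
    and k: "k \<in> vhom V (bt B B') W" and k': "k' \<in> vhom V (bt B B') W"
    and eq: "\<And>x y. x \<in> carrier (bob B) \<Longrightarrow> y \<in> carrier (bob B') \<Longrightarrow> k (be B B' x y) = k' (be B B' x y)"
  shows "k = k'"
proof -
  let ?X = "bob B" and ?Y = "bob B'"
  let ?xry = "tobj T ?X (tobj T RO ?Y)"
  let ?f = "whiskl M (bob B) (tobj T RO (bob B')) (bob B') (blact B')"
  let ?g = "compose (carrier ?xry)
       (whiskr M (tobj T (bob B) RO) (bob B) (bob B') (bract B)) (Asc M (bob B) RO (bob B'))"
  let ?h = "compose (carrier (tobj T ?X ?Y)) k (bq B B')"
  note c = balanced_coequalizer[OF B B', unfolded is_coequalizer_def]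
  have f: "?f \<in> vhom V ?xry (tobj T ?X ?Y)" and g: "?g \<in> vhom V ?xry (tobj T ?X ?Y)"
    using B B' by (auto intro!: TenH_vhom vhom_comp Asc_vhom vhom_id blact_vhom bract_vhom)
  have h: "?h \<in> vhom V (tobj T ?X ?Y) W"
    using B B' by (auto intro!: vhom_comp[OF bq_vhom k])
  have fg: "compose (carrier ?xry) (bq B B') ?f = compose (carrier ?xry) (bq B B') ?g"
    using c by simp
  have "compose (carrier ?xry) ?h ?f = compose (carrier ?xry) ?h ?g"
  proof
    fix p show "compose (carrier ?xry) ?h ?f p = compose (carrier ?xry) ?h ?g p"
      using fun_cong[OF fg, of p] vhom_closed[OF f, of p] vhom_closed[OF g, of p]
      by (auto simp: compose_def)
  qed
  then have "\<exists>!k. k \<in> vhom V (bt B B') W \<and> compose (carrier (tobj T ?X ?Y)) k (bq B B') = ?h"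
    using c[THEN conjunct2, THEN conjunct2, THEN conjunct2, rule_format, of W ?h] W h by simp
  moreover have "compose (carrier (tobj T ?X ?Y)) k' (bq B B') = ?h"
    by (rule vhom_tobj_eqI[OF vobj_bob[OF B] vobj_bob[OF B'] W _ h])
      (use B B' eq k' in \<open>auto intro!: vhom_comp bq_vhom simp: compose_eq bel_def\<close>)
  ultimately show ?thesis
    using k k' by blast
qed

lemma generates_be:
  assumes B: "two_sided B" and B': "two_sided B'"
  shows "generates V (bt B B') {be B B' x y |x y. x \<in> carrier (bob B) \<and> y \<in> carrier (bob B')}"
  unfolding generates_def
proof (intro conjI allI impI ballI)
  show "{be B B' x y |x y. x \<in> carrier (bob B) \<and> y \<in> carrier (bob B')} \<subseteq> carrier (bt B B')"
    using B B' by auto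
  fix Z :: "('k, 'v) module" and f g p
  assume Z: "vobj V Z" and f: "vlin V (bt B B') Z f" and g: "vlin V (bt B B') Z g"
    and eq: "\<forall>s\<in>{be B B' x y |x y. x \<in> carrier (bob B) \<and> y \<in> carrier (bob B')}. f s = g s"
    and p: "p \<in> carrier (bt B B')"
  have "restrict f (carrier (bt B B')) = restrict g (carrier (bt B B'))"
    by (rule bepi_unique[OF B B' Z vhomI[OF vobj_bt[OF B B'] f] vhomI[OF vobj_bt[OF B B'] g]])
      (use B B' eq in auto)
  then show "f p = g p"
    using p by (metis restrict_apply')
qed

lemma bt_eqI:
  fixes W :: "('k, 'v) module"
  assumes B: "two_sided B" and B': "two_sided B'" and W: "vobj V W"
    and f: "vlin V (bt B B') W f" and g: "vlin V (bt B B') W g"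
    and eq: "\<And>x y. x \<in> carrier (bob B) \<Longrightarrow> y \<in> carrier (bob B') \<Longrightarrow> f (be B B' x y) = g (be B B' x y)"
    and p: "p \<in> carrier (bt B B')"
  shows "f p = g p"
  by (rule generatesD[OF generates_be[OF B B'] W f g _ p]) (auto simp: eq)

abbreviation "rmult r s \<equiv> mmul T R r s"
abbreviation "rone \<equiv> mone T R"

lemma rmult_closed [simp, intro]: "r \<in> carrier RO \<Longrightarrow> s \<in> carrier RO \<Longrightarrow> rmult r s \<in> carrier RO"
  unfolding mmul_def using vhom_closed[OF mmu_R] by simp

section \<open>Bimodules, their maps and their products on elements\<close>

lemma bimod_cat_simps [simp]:
  "Obj N = {B. is_bimodule M R B}" "carrier (Hom N B B') = bimodule_maps M R B B'"
  "Cmp N B B' B'' g f = compose (carrier (bob B)) g f" "Ide N B = (\<lambda>x\<in>carrier (bob B). x)"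
  "Ten N = bim_ten M R" "Unt N = \<lparr>bob = RO, blact = mmu R, bract = mmu R\<rparr>"
  by (simp_all add: bimod_cat_def)

lemma two_sided_unit [simp]: "two_sided \<lparr>bob = RO, blact = mmu R, bract = mmu R\<rparr>"
  using mmu_R by (simp add: two_sided_def)

lemma
  assumes B: "is_bimodule M R B"
  shows is_bimodule_two_sided: "two_sided B"
    and lmul_lmul: "r \<in> carrier RO \<Longrightarrow> s \<in> carrier RO \<Longrightarrow> x \<in> carrier (bob B) \<Longrightarrow>
      lmul B r (lmul B s x) = lmul B (rmult r s) x"
    and lmul_one: "x \<in> carrier (bob B) \<Longrightarrow> lmul B rone x = x"
    and rmul_rmul: "r \<in> carrier RO \<Longrightarrow> s \<in> carrier RO \<Longrightarrow> x \<in> carrier (bob B) \<Longrightarrow>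
      rmul B (rmul B x r) s = rmul B x (rmult r s)"
    and rmul_one: "x \<in> carrier (bob B) \<Longrightarrow> rmul B x rone = x"
    and lmul_rmul: "r \<in> carrier RO \<Longrightarrow> s \<in> carrier RO \<Longrightarrow> x \<in> carrier (bob B) \<Longrightarrow>
      lmul B r (rmul B x s) = rmul B (lmul B r x) s"
proof -
  let ?X = "bob B"
  have X: "vobj V ?X" and l: "blact B \<in> vhom V (tobj T RO ?X) ?X" and p: "bract B \<in> vhom V (tobj T ?X RO) ?X"
    and 1: "compose (carrier (tobj T RO (tobj T RO ?X))) (blact B) (whiskl M RO (tobj T RO ?X) ?X (blact B)) =
      compose (carrier (tobj T RO (tobj T RO ?X))) (blact B) (compose (carrier (tobj T RO (tobj T RO ?X)))
        (whiskr M (tobj T RO RO) RO ?X (mmu R)) (Asc M RO RO ?X))"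
    and 2: "compose (carrier (tobj T I ?X)) (blact B) (whiskr M I RO ?X (mun R)) = Lun M ?X"
    and 3: "compose (carrier (tobj T ?X (tobj T RO RO))) (bract B) (whiskl M ?X (tobj T RO RO) RO (mmu R)) =
      compose (carrier (tobj T ?X (tobj T RO RO))) (bract B) (compose (carrier (tobj T ?X (tobj T RO RO)))
        (whiskr M (tobj T ?X RO) ?X RO (bract B)) (Asc M ?X RO RO))"
    and 4: "compose (carrier (tobj T ?X I)) (bract B) (whiskl M ?X I RO (mun R)) = Run M ?X"
    and 5: "compose (carrier (tobj T RO (tobj T ?X RO))) (blact B) (whiskl M RO (tobj T ?X RO) ?X (bract B)) =
      compose (carrier (tobj T RO (tobj T ?X RO))) (bract B) (compose (carrier (tobj T RO (tobj T ?X RO)))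
        (whiskr M (tobj T RO ?X) ?X RO (blact B)) (Asc M RO ?X RO))"
    using B by (simp_all add: is_bimodule_def Let_def)
  show "two_sided B"
    using X l p by (simp add: two_sided_def)
  note simps = compose_eq Asc_tel whiskl_tel whiskr_tel mmul_def mone_def vhom_closed[OF mmu_R] vhom_closed[OF l] vhom_closed[OF p]
  show "lmul B r (lmul B s x) = lmul B (rmult r s) x"
    if "r \<in> carrier RO" "s \<in> carrier RO" "x \<in> carrier ?X"
    using fun_cong[OF 1, of "tel T RO (tobj T RO ?X) r (tel T RO ?X s x)"] that X l p mmu_R
    by (simp add: simps)
  show "rmul B (rmul B x r) s = rmul B x (rmult r s)"
    if "r \<in> carrier RO" "s \<in> carrier RO" "x \<in> carrier ?X"
    using fun_cong[OF 3, of "tel T ?X (tobj T RO RO) x (tel T RO RO r s)"] that X l p mmu_R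
    by (simp add: simps)
  show "lmul B r (rmul B x s) = rmul B (lmul B r x) s"
    if "r \<in> carrier RO" "s \<in> carrier RO" "x \<in> carrier ?X"
    using fun_cong[OF 5, of "tel T RO (tobj T ?X RO) r (tel T ?X RO x s)"] that X l p mmu_R
    by (simp add: simps)
  show "lmul B rone x = x" if "x \<in> carrier ?X"
    using fun_cong[OF 2, of "tel T I ?X (uel T) x"] that X l mun_R by (simp add: simps Lun_tel)
  show "rmul B x rone = x" if "x \<in> carrier ?X"
    using fun_cong[OF 4, of "tel T ?X I x (uel T)"] that X p mun_R by (simp add: simps Run_tel)
qed

lemma bimodule_maps_iff:
  assumes B: "two_sided B" and B': "two_sided B'"
  shows "f \<in> bimodule_maps M R B B' \<longleftrightarrow> f \<in> vhom V (bob B) (bob B') \<and>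
    (\<forall>r\<in>carrier RO. \<forall>x\<in>carrier (bob B).
       f (lmul B r x) = lmul B' r (f x) \<and> f (rmul B x r) = rmul B' (f x) r)"
proof (cases "f \<in> vhom V (bob B) (bob B')")
  case f: True
  let ?X = "bob B" and ?Y = "bob B'"
  have 1: "compose (carrier (tobj T RO ?X)) f (blact B) =
      compose (carrier (tobj T RO ?X)) (blact B') (whiskl M RO ?X ?Y f) \<longleftrightarrow>
    (\<forall>r\<in>carrier RO. \<forall>x\<in>carrier ?X. f (lmul B r x) = lmul B' r (f x))" (is "?l = ?r \<longleftrightarrow> ?P")
  proof
    assume eq: "?l = ?r"
    show ?P
    proof (intro ballI)
      fix r x assume "r \<in> carrier RO" "x \<in> carrier ?X"
      then show "f (lmul B r x) = lmul B' r (f x)"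
        using fun_cong[OF eq, of "tel T RO ?X r x"] B B' f by (simp add: compose_eq whiskl_tel)
    qed
  next
    assume ?P
    then show "?l = ?r"
      using B B' f
      by (intro vhom_tobj_eqI[OF vobj_R vobj_bob[OF B] vobj_bob[OF B']])
        (auto intro!: vhom_comp[OF blact_vhom] vhom_comp[OF TenH_vhom blact_vhom] vhom_id simp: compose_eq whiskl_tel)
  qed
  have 2: "compose (carrier (tobj T ?X RO)) f (bract B) =
      compose (carrier (tobj T ?X RO)) (bract B') (whiskr M ?X ?Y RO f) \<longleftrightarrow>
    (\<forall>r\<in>carrier RO. \<forall>x\<in>carrier ?X. f (rmul B x r) = rmul B' (f x) r)" (is "?l = ?r \<longleftrightarrow> ?P")
  proof
    assume eq: "?l = ?r"
    show ?P
    proof (intro ballI)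
      fix r x assume "r \<in> carrier RO" "x \<in> carrier ?X"
      then show "f (rmul B x r) = rmul B' (f x) r"
        using fun_cong[OF eq, of "tel T ?X RO x r"] B B' f by (simp add: compose_eq whiskr_tel)
    qed
  next
    assume ?P
    then show "?l = ?r"
      using B B' f
      by (intro vhom_tobj_eqI[OF vobj_bob[OF B] vobj_R vobj_bob[OF B']])
        (auto intro!: vhom_comp[OF bract_vhom] vhom_comp[OF TenH_vhom bract_vhom] vhom_id simp: compose_eq whiskr_tel)
  qed
  show ?thesis
    using f 1 2 by (auto simp: bimodule_maps_def)
qed (simp add: bimodule_maps_def)

lemma bimodule_maps_comp:
  assumes "two_sided B" "two_sided B'" "two_sided B''"
    and "f \<in> bimodule_maps M R B B'" and "k \<in> bimodule_maps M R B' B''"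
  shows "compose (carrier (bob B)) k f \<in> bimodule_maps M R B B''"
  using assms by (auto simp: bimodule_maps_iff compose_eq vhom_closed intro!: vhom_comp)

text \<open>A linear family of balanced maps lifts to a linear family: the lifts are chosen
  separately for each parameter, and linearity in the parameter is then checked on elements
  \<open>x \<otimes>\<^sub>R y\<close>. With \<open>R\<close> as parameter this yields the actions
  on a product over \<open>R\<close>.\<close>

lemma bt_lift_parameter:
  fixes X W :: "('k, 'v) module"
  assumes B: "two_sided B" and B': "two_sided B'" and X: "vobj V X" and W: "vobj V W"
    and b: "\<And>a. a \<in> carrier X \<Longrightarrow> vbilin V (bob B) (bob B') W (\<beta> a)"
    and lin: "\<And>x y. x \<in> carrier (bob B) \<Longrightarrow> y \<in> carrier (bob B') \<Longrightarrow> vlin V X W (\<lambda>a. \<beta> a x y)"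
    and bal: "\<And>a x r y. a \<in> carrier X \<Longrightarrow> x \<in> carrier (bob B) \<Longrightarrow> r \<in> carrier RO \<Longrightarrow> y \<in> carrier (bob B') \<Longrightarrow>
      \<beta> a (rmul B x r) y = \<beta> a x (lmul B' r y)"
  shows "\<exists>F. vbilin V X (bt B B') W F \<and> (\<forall>a\<in>carrier X. F a \<in> vhom V (bt B B') W \<and>
    (\<forall>x\<in>carrier (bob B). \<forall>y\<in>carrier (bob B'). F a (be B B' x y) = \<beta> a x y))"
proof -
  have "\<forall>a\<in>carrier X. \<exists>k. k \<in> vhom V (bt B B') W \<and>
      (\<forall>x\<in>carrier (bob B). \<forall>y\<in>carrier (bob B'). k (be B B' x y) = \<beta> a x y)"
    using bt_lift_ex[OF B B' W b bal] by blast
  then obtain F where F: "\<forall>a\<in>carrier X. F a \<in> vhom V (bt B B') W \<and>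
      (\<forall>x\<in>carrier (bob B). \<forall>y\<in>carrier (bob B'). F a (be B B' x y) = \<beta> a x y)"
    by metis
  have "vlin V X W (\<lambda>a. F a p)" if p: "p \<in> carrier (bt B B')" for p
  proof (rule vlin_in_parameter[OF generates_be[OF B B'] X W _ _ p])
    show "vlin V (bt B B') W (F a)" if "a \<in> carrier X" for a
      using F that vhom_vlin by blast
    show "vlin V X W (\<lambda>a. F a s)"
      if s: "s \<in> {be B B' x y |x y. x \<in> carrier (bob B) \<and> y \<in> carrier (bob B')}" for s
    proof -
      obtain x y where xy: "x \<in> carrier (bob B)" "y \<in> carrier (bob B')" "s = be B B' x y"
        using s by blast
      then show ?thesis
        using F by (auto intro: vlin_cong[OF X lin[OF xy(1,2)]])
    qed
  qed
  then have "vbilin V X (bt B B') W F"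
    using F by (auto simp: vbilin_def dest: vhom_vlin)
  then show ?thesis
    using F by blast
qed

text \<open>Acting by \<open>r\<close> on the first factor respects the balancing relation because
  the left and right actions on \<open>B\<close> commute. The \<open>THE\<close> in
  \<open>bim_ten\<close> is then resolved, since elements
  \<open>r \<otimes> (x \<otimes>\<^sub>R y)\<close> generate.\<close>

lemma bim_ten_left_action:
  assumes B: "is_bimodule M R B" and B': "is_bimodule M R B'"
  shows "blact (bim_ten M R B B') \<in> vhom V (tobj T RO (bt B B')) (bt B B') \<and>
    (\<forall>r\<in>carrier RO. \<forall>x\<in>carrier (bob B). \<forall>y\<in>carrier (bob B').
       blact (bim_ten M R B B') (tel T RO (bt B B') r (be B B' x y)) = be B B' (lmul B r x) y)"
proof -
  let ?X = "bob B" and ?Y = "bob B'" and ?Z = "bt B B'"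
  let ?xy = "tobj T ?X ?Y"
  note t = is_bimodule_two_sided[OF B] is_bimodule_two_sided[OF B']
  note bil = be_vbilin[OF t]
  have Z: "vobj V ?Z"
    using t by simp
  have "\<exists>F. vbilin V RO ?Z ?Z F \<and> (\<forall>a\<in>carrier RO. F a \<in> vhom V ?Z ?Z \<and>
    (\<forall>x\<in>carrier ?X. \<forall>y\<in>carrier ?Y. F a (be B B' x y) = be B B' (lmul B a x) y))"
  proof (rule bt_lift_parameter[OF t vobj_R Z])
    fix r assume r: "r \<in> carrier RO"
    have "vlin V ?X ?X (lmul B r)"
      using lmul_vbilin[OF t(1)] r by (simp add: vbilin_def)
    then show "vbilin V ?X ?Y ?Z (\<lambda>x. be B B' (lmul B r x))"
      using bil t r by (auto simp: vbilin_def intro: vlin_comp)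
    show "be B B' (lmul B r (rmul B x s)) y = be B B' (lmul B r x) (lmul B' s y)"
      if "x \<in> carrier ?X" "s \<in> carrier RO" "y \<in> carrier ?Y" for x s y
      using that r t by (simp add: lmul_rmul[OF B] be_balanced)
  next
    fix x y assume xy: "x \<in> carrier ?X" "y \<in> carrier ?Y"
    have "vlin V RO ?X (\<lambda>r. lmul B r x)"
      using lmul_vbilin[OF t(1)] xy by (simp add: vbilin_def)
    then show "vlin V RO ?Z (\<lambda>r. be B B' (lmul B r x) y)"
      by (rule vlin_comp) (use bil xy in \<open>simp add: vbilin_def\<close>)
  qed
  then obtain F where F: "vbilin V RO ?Z ?Z F"
    and F_be: "\<And>r x y. r \<in> carrier RO \<Longrightarrow> x \<in> carrier ?X \<Longrightarrow> y \<in> carrier ?Y \<Longrightarrow> F r (be B B' x y) = be B B' (lmul B r x) y"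
    by blast
  let ?l = "tlift V T RO ?Z ?Z F"
  have l: "?l \<in> vhom V (tobj T RO ?Z) ?Z"
    using Z F by (intro tlift_vhom) auto
  have l_be: "?l (tel T RO ?Z r (be B B' x y)) = be B B' (lmul B r x) y"
    if "r \<in> carrier RO" "x \<in> carrier ?X" "y \<in> carrier ?Y" for r x y
    using that F t by (simp add: tlift_tel F_be)
  have "blact (bim_ten M R B B') = ?l"
    unfolding bim_ten_def Let_def bimod.simps base_cat_simps(1-3,5,6) arr_base_cat
  proof (rule the_equality)
    show "?l \<in> vhom V (tobj T RO ?Z) ?Z \<and>
      compose (carrier (tobj T RO ?xy)) ?l (whiskl M RO ?xy ?Z (bq B B')) =
      compose (carrier (tobj T RO ?xy)) (bq B B') (compose (carrier (tobj T RO ?xy))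
        (whiskr M (tobj T RO ?X) ?X ?Y (blact B)) (Asc M RO ?X ?Y))"
    proof (intro conjI l vhom_tobj3_eqI[OF vobj_R vobj_bob[OF t(1)] vobj_bob[OF t(2)] Z])
      show "compose (carrier (tobj T RO ?xy)) ?l (whiskl M RO ?xy ?Z (bq B B')) \<in> vhom V (tobj T RO ?xy) ?Z"
        using t l by (auto intro!: vhom_comp[OF TenH_vhom l] vhom_id bq_vhom)
      show "compose (carrier (tobj T RO ?xy)) (bq B B') (compose (carrier (tobj T RO ?xy))
        (whiskr M (tobj T RO ?X) ?X ?Y (blact B)) (Asc M RO ?X ?Y)) \<in> vhom V (tobj T RO ?xy) ?Z"
        using t by (auto intro!: vhom_comp[OF vhom_comp[OF Asc_vhom TenH_vhom] bq_vhom] vhom_id blact_vhom)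
    qed (use t in \<open>simp add: compose_eq Asc_tel whiskl_tel whiskr_tel blact_vhom bq_vhom l_be flip: bel_def\<close>)
  next
    fix h assume h: "h \<in> vhom V (tobj T RO ?Z) ?Z \<and>
      compose (carrier (tobj T RO ?xy)) h (whiskl M RO ?xy ?Z (bq B B')) =
      compose (carrier (tobj T RO ?xy)) (bq B B') (compose (carrier (tobj T RO ?xy))
        (whiskr M (tobj T RO ?X) ?X ?Y (blact B)) (Asc M RO ?X ?Y))"
    have "h (tel T RO ?Z r (be B B' x y)) = be B B' (lmul B r x) y"
      if "r \<in> carrier RO" "x \<in> carrier ?X" "y \<in> carrier ?Y" for r x y
      using fun_cong[OF conjunct2[OF h], of "tel T RO ?xy r (tel T ?X ?Y x y)"] that t
      by (simp add: compose_eq Asc_tel whiskl_tel whiskr_tel blact_vhom bq_vhom bel_def)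
    then show "h = ?l"
      by (intro vhom_ext[OF conjunct1[OF h] l])
        (rule generatesD[OF generates_tobj[OF vobj_R Z generates_carrier generates_be[OF t]] Z
            vhom_vlin[OF conjunct1[OF h]] vhom_vlin[OF l]], auto simp: l_be)
  qed
  then show ?thesis
    using l l_be by simp
qed

text \<open>The mirror image, resting on the commuting actions on \<open>B'\<close>. The lift is
  taken with \<open>R\<close> as parameter and its arguments are swapped afterwards.\<close>

lemma bim_ten_right_action:
  assumes B: "is_bimodule M R B" and B': "is_bimodule M R B'"
  shows "bract (bim_ten M R B B') \<in> vhom V (tobj T (bt B B') RO) (bt B B') \<and>
    (\<forall>r\<in>carrier RO. \<forall>x\<in>carrier (bob B). \<forall>y\<in>carrier (bob B').
       bract (bim_ten M R B B') (tel T (bt B B') RO (be B B' x y) r) = be B B' x (rmul B' y r))"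
proof -
  let ?X = "bob B" and ?Y = "bob B'" and ?Z = "bt B B'"
  let ?xy = "tobj T ?X ?Y" and ?xyr = "tobj T ?X (tobj T ?Y RO)"
  note t = is_bimodule_two_sided[OF B] is_bimodule_two_sided[OF B']
  note bil = be_vbilin[OF t]
  have Z: "vobj V ?Z"
    using t by simp
  have "\<exists>F. vbilin V RO ?Z ?Z F \<and> (\<forall>a\<in>carrier RO. F a \<in> vhom V ?Z ?Z \<and>
    (\<forall>x\<in>carrier ?X. \<forall>y\<in>carrier ?Y. F a (be B B' x y) = be B B' x (rmul B' y a)))"
  proof (rule bt_lift_parameter[OF t vobj_R Z])
    fix r assume r: "r \<in> carrier RO"
    have "vlin V ?Y ?Y (\<lambda>y. rmul B' y r)"
      using rmul_vbilin[OF t(2)] r by (simp add: vbilin_def)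
    then show "vbilin V ?X ?Y ?Z (\<lambda>x y. be B B' x (rmul B' y r))"
      using bil t r by (auto simp: vbilin_def intro: vlin_comp)
    show "be B B' (rmul B x s) (rmul B' y r) = be B B' x (rmul B' (lmul B' s y) r)"
      if "x \<in> carrier ?X" "s \<in> carrier RO" "y \<in> carrier ?Y" for x s y
      using that r t by (simp add: be_balanced flip: lmul_rmul[OF B'])
  next
    fix x y assume xy: "x \<in> carrier ?X" "y \<in> carrier ?Y"
    have "vlin V RO ?Y (rmul B' y)"
      using rmul_vbilin[OF t(2)] xy by (simp add: vbilin_def)
    then show "vlin V RO ?Z (\<lambda>r. be B B' x (rmul B' y r))"
      by (rule vlin_comp) (use bil xy in \<open>simp add: vbilin_def\<close>)
  qed
  then obtain F where F: "vbilin V RO ?Z ?Z F"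
    and F_be: "\<And>r x y. r \<in> carrier RO \<Longrightarrow> x \<in> carrier ?X \<Longrightarrow> y \<in> carrier ?Y \<Longrightarrow> F r (be B B' x y) = be B B' x (rmul B' y r)"
    by blast
  let ?p = "tlift V T ?Z RO ?Z (\<lambda>z r. F r z)"
  have F': "vbilin V ?Z RO ?Z (\<lambda>z r. F r z)"
    using F by (auto simp: vbilin_def)
  have p: "?p \<in> vhom V (tobj T ?Z RO) ?Z"
    using Z F' by (intro tlift_vhom) auto
  have p_be: "?p (tel T ?Z RO (be B B' x y) r) = be B B' x (rmul B' y r)"
    if "r \<in> carrier RO" "x \<in> carrier ?X" "y \<in> carrier ?Y" for r x y
    using that F' t by (simp add: tlift_tel F_be)
  have "bract (bim_ten M R B B') = ?p"
    unfolding bim_ten_def Let_def bimod.simps base_cat_simps(1-3,5,6) arr_base_cat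
  proof (rule the_equality)
    show "?p \<in> vhom V (tobj T ?Z RO) ?Z \<and>
      compose (carrier ?xyr) ?p (compose (carrier ?xyr) (whiskr M ?xy ?Z RO (bq B B')) (Asc M ?X ?Y RO)) =
      compose (carrier ?xyr) (bq B B') (whiskl M ?X (tobj T ?Y RO) ?Y (bract B'))"
    proof (intro conjI p vhom_tobj3_eqI[OF vobj_bob[OF t(1)] vobj_bob[OF t(2)] vobj_R Z])
      show "compose (carrier ?xyr) ?p (compose (carrier ?xyr) (whiskr M ?xy ?Z RO (bq B B')) (Asc M ?X ?Y RO)) \<in> vhom V ?xyr ?Z"
        using t p by (auto intro!: vhom_comp[OF vhom_comp[OF Asc_vhom TenH_vhom] p] vhom_id bq_vhom)
      show "compose (carrier ?xyr) (bq B B') (whiskl M ?X (tobj T ?Y RO) ?Y (bract B')) \<in> vhom V ?xyr ?Z"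
        using t by (auto intro!: vhom_comp[OF TenH_vhom bq_vhom] vhom_id bract_vhom)
    qed (use t in \<open>simp add: compose_eq Asc_tel whiskl_tel whiskr_tel bract_vhom bq_vhom p_be flip: bel_def\<close>)
  next
    fix h assume h: "h \<in> vhom V (tobj T ?Z RO) ?Z \<and>
      compose (carrier ?xyr) h (compose (carrier ?xyr) (whiskr M ?xy ?Z RO (bq B B')) (Asc M ?X ?Y RO)) =
      compose (carrier ?xyr) (bq B B') (whiskl M ?X (tobj T ?Y RO) ?Y (bract B'))"
    have "h (tel T ?Z RO (be B B' x y) r) = be B B' x (rmul B' y r)"
      if "r \<in> carrier RO" "x \<in> carrier ?X" "y \<in> carrier ?Y" for r x y
      using fun_cong[OF conjunct2[OF h], of "tel T ?X (tobj T ?Y RO) x (tel T ?Y RO y r)"] that t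
      by (simp add: compose_eq Asc_tel whiskl_tel whiskr_tel bract_vhom bq_vhom bel_def)
    then show "h = ?p"
      by (intro vhom_ext[OF conjunct1[OF h] p])
        (rule generatesD[OF generates_tobj[OF Z vobj_R generates_be[OF t] generates_carrier] Z
            vhom_vlin[OF conjunct1[OF h]] vhom_vlin[OF p]], auto simp: p_be)
  qed
  then show ?thesis
    using p p_be by simp
qed

lemma bob_bim_ten [simp]: "bob (bim_ten M R B B') = bt B B'"
  by (simp add: bim_ten_def Let_def)

lemma
  assumes B: "is_bimodule M R B" and B': "is_bimodule M R B'"
  shows two_sided_bim_ten: "two_sided (bim_ten M R B B')"
  using bim_ten_left_action[OF B B'] bim_ten_right_action[OF B B']
    vobj_bt[OF is_bimodule_two_sided[OF B] is_bimodule_two_sided[OF B']]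
  by (simp_all add: two_sided_def)

text \<open>Right linearity of \<open>f\<close> and left linearity of \<open>g\<close> are what
  makes \<open>f(x) \<otimes>\<^sub>R g(y)\<close> balanced.\<close>

lemma
  assumes B: "two_sided B1" "two_sided B2" and B': "two_sided B1'" "two_sided B2'"
    and f: "f \<in> vhom V (bob B1) (bob B1')" and g: "g \<in> vhom V (bob B2) (bob B2')"
    and fr: "\<And>x r. x \<in> carrier (bob B1) \<Longrightarrow> r \<in> carrier RO \<Longrightarrow> f (rmul B1 x r) = rmul B1' (f x) r"
    and gl: "\<And>y r. y \<in> carrier (bob B2) \<Longrightarrow> r \<in> carrier RO \<Longrightarrow> g (lmul B2 r y) = lmul B2' r (g y)"
  shows TenH_N_vhom: "TenH N B1 B1' B2 B2' f g \<in> vhom V (bt B1 B2) (bt B1' B2')"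
    and TenH_N_be: "x \<in> carrier (bob B1) \<Longrightarrow> y \<in> carrier (bob B2) \<Longrightarrow>
      TenH N B1 B1' B2 B2' f g (be B1 B2 x y) = be B1' B2' (f x) (g y)"
proof -
  let ?W = "bt B1' B2'"
  note bil = be_vbilin[OF B']
  have W: "vobj V ?W"
    using B' by simp
  have "\<exists>k. k \<in> vhom V (bt B1 B2) ?W \<and>
    (\<forall>x\<in>carrier (bob B1). \<forall>y\<in>carrier (bob B2). k (be B1 B2 x y) = be B1' B2' (f x) (g y))"
  proof (rule bt_lift_ex[OF B W])
    show "vbilin V (bob B1) (bob B2) ?W (\<lambda>x y. be B1' B2' (f x) (g y))"
      unfolding vbilin_def
      using vlin_comp[OF vhom_vlin[OF f] be_lin(2)[OF B']]
        vlin_comp[OF vhom_vlin[OF g] be_lin(1)[OF B']] vhom_closed[OF f] vhom_closed[OF g]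
      by blast
  qed (use B' f g in \<open>simp add: fr gl be_balanced vhom_closed\<close>)
  then obtain k where k: "k \<in> vhom V (bt B1 B2) ?W"
    and k_be: "\<And>x y. x \<in> carrier (bob B1) \<Longrightarrow> y \<in> carrier (bob B2) \<Longrightarrow> k (be B1 B2 x y) = be B1' B2' (f x) (g y)"
    by blast
  let ?xy = "tobj T (bob B1) (bob B2)"
  have "TenH N B1 B1' B2 B2' f g = k"
    unfolding bimod_cat_def moncat.simps base_cat_simps(1-3,5,6) arr_base_cat
  proof (rule the_equality)
    have "compose (carrier ?xy) k (bq B1 B2) =
      compose (carrier ?xy) (bq B1' B2') (TenH M (bob B1) (bob B1') (bob B2) (bob B2') f g)"
    proof (rule vhom_tobj_eqI[OF vobj_bob[OF B(1)] vobj_bob[OF B(2)] W])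
      show "compose (carrier ?xy) k (bq B1 B2) \<in> vhom V ?xy ?W"
        using B by (auto intro!: vhom_comp[OF bq_vhom k])
      show "compose (carrier ?xy) (bq B1' B2') (TenH M (bob B1) (bob B1') (bob B2) (bob B2') f g) \<in> vhom V ?xy ?W"
        using B B' f g by (auto intro!: vhom_comp[OF TenH_vhom bq_vhom])
    qed (use B B' f g in \<open>simp add: compose_eq TenH_tel k_be flip: bel_def\<close>)
    then show "k \<in> vhom V (bt B1 B2) ?W \<and> compose (carrier ?xy) k (bq B1 B2) =
      compose (carrier ?xy) (bq B1' B2') (TenH M (bob B1) (bob B1') (bob B2) (bob B2') f g)"
      using k by simp
  next
    fix h assume h: "h \<in> vhom V (bt B1 B2) ?W \<and> compose (carrier ?xy) h (bq B1 B2) =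
      compose (carrier ?xy) (bq B1' B2') (TenH M (bob B1) (bob B1') (bob B2) (bob B2') f g)"
    have "h (be B1 B2 x y) = be B1' B2' (f x) (g y)"
      if "x \<in> carrier (bob B1)" "y \<in> carrier (bob B2)" for x y
      using fun_cong[OF conjunct2[OF h], of "tel T (bob B1) (bob B2) x y"] that B B' f g
      by (simp add: compose_eq TenH_tel bel_def)
    then show "h = k"
      using h k_be by (intro bepi_unique[OF B W _ k]) simp_all
  qed
  then show "TenH N B1 B1' B2 B2' f g \<in> vhom V (bt B1 B2) (bt B1' B2')"
    "x \<in> carrier (bob B1) \<Longrightarrow> y \<in> carrier (bob B2) \<Longrightarrow>
      TenH N B1 B1' B2 B2' f g (be B1 B2 x y) = be B1' B2' (f x) (g y)"
    using k k_be by simp_all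
qed

text \<open>Uniqueness of the associator over \<open>R\<close>: elements
  \<open>x \<otimes>\<^sub>R (y \<otimes>\<^sub>R z)\<close> are reached by generating first in the
  outer and then in the inner product. The candidate \<open>k\<close> comes from the caller; for the
  bimodules \<open>Ub a\<close> it is built from the associator of \<open>C\<close> in
  \<open>Asc_N\<close>.\<close>

lemma Asc_N_eqI:
  assumes B: "is_bimodule M R B1" "is_bimodule M R B2" "is_bimodule M R B3"
    and k: "k \<in> vhom V (bt B1 (bim_ten M R B2 B3)) (bt (bim_ten M R B1 B2) B3)"
    and val: "\<And>x y z. x \<in> carrier (bob B1) \<Longrightarrow> y \<in> carrier (bob B2) \<Longrightarrow> z \<in> carrier (bob B3) \<Longrightarrow>
      k (be B1 (bim_ten M R B2 B3) x (be B2 B3 y z)) = be (bim_ten M R B1 B2) B3 (be B1 B2 x y) z"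
  shows "Asc N B1 B2 B3 = k"
proof -
  let ?x = "bob B1" and ?y = "bob B2" and ?z = "bob B3"
  let ?B23 = "bim_ten M R B2 B3" and ?B12 = "bim_ten M R B1 B2"
  let ?xyz = "tobj T ?x (tobj T ?y ?z)"
  note t = B[THEN is_bimodule_two_sided]
  note t2 = two_sided_bim_ten[OF B(2,3)] two_sided_bim_ten[OF B(1,2)]
  let ?l = "\<lambda>h. compose (carrier ?xyz) h (compose (carrier ?xyz) (bq B1 ?B23)
    (whiskl M ?x (tobj T ?y ?z) (bt B2 B3) (bq B2 B3)))"
  let ?r = "compose (carrier ?xyz) (bq ?B12 B3) (compose (carrier ?xyz)
    (whiskr M (tobj T ?x ?y) (bt B1 B2) ?z (bq B1 B2)) (Asc M ?x ?y ?z))"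
  have W: "vobj V (bt ?B12 B3)"
    using t t2 by simp
  have l_val: "?l h (tel T ?x (tobj T ?y ?z) x (tel T ?y ?z y z)) = h (be B1 ?B23 x (be B2 B3 y z))"
    and r_val: "?r (tel T ?x (tobj T ?y ?z) x (tel T ?y ?z y z)) = be ?B12 B3 (be B1 B2 x y) z"
    if "x \<in> carrier ?x" "y \<in> carrier ?y" "z \<in> carrier ?z" for h x y z
    using that t by (simp_all add: compose_eq Asc_tel whiskl_tel whiskr_tel bq_vhom bel_def)
  show ?thesis
    unfolding bimod_cat_def moncat.simps base_cat_simps(1-3,5,6) arr_base_cat Let_def
  proof (rule the_equality)
    have "?l k = ?r"
    proof (rule vhom_tobj3_eqI[OF t[THEN vobj_bob] W])
      show "?l k \<in> vhom V ?xyz (bt ?B12 B3)"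
        using t t2 bq_vhom[OF t(1) t2(1)]
        by (auto intro!: vhom_comp[OF vhom_comp[OF TenH_vhom] k] vhom_id bq_vhom)
      show "?r \<in> vhom V ?xyz (bt ?B12 B3)"
        using t t2 bq_vhom[OF t2(2) t(3)]
        by (auto intro!: vhom_comp[OF vhom_comp[OF Asc_vhom TenH_vhom]] vhom_id bq_vhom)
      show "?l k (tel T ?x (tobj T ?y ?z) x (tel T ?y ?z y z)) = ?r (tel T ?x (tobj T ?y ?z) x (tel T ?y ?z y z))"
        if "x \<in> carrier ?x" "y \<in> carrier ?y" "z \<in> carrier ?z" for x y z
        using that unfolding l_val[OF that] r_val[OF that] by (rule val)
    qed
    then show "k \<in> vhom V (bt B1 ?B23) (bt ?B12 B3) \<and> ?l k = ?r"
      using k by blast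
  next
    fix h assume h: "h \<in> vhom V (bt B1 ?B23) (bt ?B12 B3) \<and> ?l h = ?r"
    have eq: "h (be B1 ?B23 x (be B2 B3 y z)) = k (be B1 ?B23 x (be B2 B3 y z))"
      if "x \<in> carrier ?x" "y \<in> carrier ?y" "z \<in> carrier ?z" for x y z
      using fun_cong[OF conjunct2[OF h], of "tel T ?x (tobj T ?y ?z) x (tel T ?y ?z y z)"]
      unfolding l_val[OF that] r_val[OF that] val[OF that] .
    show "h = k"
    proof (rule bepi_unique[OF t(1) t2(1) W conjunct1[OF h] k])
      fix x p assume x: "x \<in> carrier ?x" and "p \<in> carrier (bob ?B23)"
      then have p: "p \<in> carrier (bt B2 B3)"
        by simp
      have l: "vlin V (bt B2 B3) (bt B1 ?B23) (be B1 ?B23 x)"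
        using be_lin(1)[OF t(1) t2(1) x] by simp
      show "h (be B1 ?B23 x p) = k (be B1 ?B23 x p)"
        by (rule bt_eqI[OF t(2,3) W vlin_comp[OF l vhom_vlin[OF conjunct1[OF h]]] vlin_comp[OF l vhom_vlin[OF k]] _ p])
          (rule eq[OF x])
    qed
  qed
qed

end

section \<open>Representable essentially strong monoidal functors\<close>

locale representable_monoidal = base_tensor V T
  for V :: "'k base" and T :: "('k, 'v) tensor_data" +
  fixes C :: "('k, 'o, 'v) moncat" and G :: "('o, 'v, ('k, 'v) module, 'v \<Rightarrow> 'v) monfun"
    and g :: 'o and \<theta> :: "'o \<Rightarrow> 'v \<Rightarrow> 'v"
  assumes monoidal_C: "vmonoidal_category V C"
    and monoidal_G: "monoidal_functor V C (base_cat V T) G"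
    and g [simp, intro]: "g \<in> Obj C"
    and representing: "nat_iso C (base_cat V T) G (hom_functor C g) \<theta>"
    and strong: "essentially_strong V C (base_cat V T) G"
begin

abbreviation "E \<equiv> Unt C"
abbreviation "R \<equiv> image_monoid C M G"
abbreviation "U \<equiv> bimod_factor C M G"
abbreviation "Ub c \<equiv> image_bimod C M G c"
abbreviation "el c \<equiv> carrier (FO G c)"

section \<open>The functor G and its monoidal structure on elements\<close>

definition dot :: "'o \<Rightarrow> 'o \<Rightarrow> 'v \<Rightarrow> 'v \<Rightarrow> 'v" where
  "dot a b x y = F2 G a b (tel T (FO G a) (FO G b) x y)"

definition lact :: "'o \<Rightarrow> 'v \<Rightarrow> 'v \<Rightarrow> 'v" where
  "lact c r x = blact (Ub c) (tel T (FO G E) (FO G c) r x)"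

definition racr :: "'o \<Rightarrow> 'v \<Rightarrow> 'v \<Rightarrow> 'v" where
  "racr c x r = bract (Ub c) (tel T (FO G c) (FO G E) x r)"

definition one :: 'v where
  "one = F0 G (uel T)"

lemma category_C: "vcategory V C" and bifunctor_C: "vbifunctor V C" and E [simp, intro]: "E \<in> Obj C"
  using monoidal_C by (simp_all add: vmonoidal_category_def)

lemma
  assumes "a \<in> Obj C" and "b \<in> Obj C"
  shows vobj_Hom [simp, intro]: "vobj V (Hom C a b)"
    and Ten_Obj [simp, intro]: "Ten C a b \<in> Obj C"
  using category_C bifunctor_C assms by (simp_all add: vcategory_def vbifunctor_def)

lemma Ide_arr [simp, intro]: "a \<in> Obj C \<Longrightarrow> Ide C a \<in> arr C a a"
  using category_C by (simp add: vcategory_def)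

lemma Cmp_vbilin:
  "a \<in> Obj C \<Longrightarrow> b \<in> Obj C \<Longrightarrow> c \<in> Obj C \<Longrightarrow>
     vbilin V (Hom C b c) (Hom C a b) (Hom C a c) (Cmp C a b c)"
  using category_C by (simp add: vcategory_def)

lemma Cmp_arr [simp, intro]:
  "a \<in> Obj C \<Longrightarrow> b \<in> Obj C \<Longrightarrow> c \<in> Obj C \<Longrightarrow> f \<in> arr C a b \<Longrightarrow> k \<in> arr C b c \<Longrightarrow>
     Cmp C a b c k f \<in> arr C a c"
  using Cmp_vbilin by (meson vbilin_def vlin_closed)

lemma TenH_arr [simp, intro]:
  "a \<in> Obj C \<Longrightarrow> a' \<in> Obj C \<Longrightarrow> b \<in> Obj C \<Longrightarrow> b' \<in> Obj C \<Longrightarrow> f \<in> arr C a a' \<Longrightarrow> k \<in> arr C b b' \<Longrightarrow>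
     TenH C a a' b b' f k \<in> arr C (Ten C a b) (Ten C a' b')"
  using bifunctor_C unfolding vbifunctor_def by (meson vbilin_def vlin_closed)

lemma Cmp_Ide [simp]: "a \<in> Obj C \<Longrightarrow> b \<in> Obj C \<Longrightarrow> f \<in> arr C a b \<Longrightarrow> Cmp C a a b f (Ide C a) = f"
  using category_C by (simp add: vcategory_def)

lemma Asc_arr [simp, intro]:
  "a \<in> Obj C \<Longrightarrow> b \<in> Obj C \<Longrightarrow> c \<in> Obj C \<Longrightarrow>
     Asc C a b c \<in> arr C (Ten C a (Ten C b c)) (Ten C (Ten C a b) c)"
  using monoidal_C by (simp add: vmonoidal_category_def is_iso_def)

lemma Lun_arr [simp, intro]: "c \<in> Obj C \<Longrightarrow> Lun C c \<in> arr C (Ten C E c) c"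
  and Run_arr [simp, intro]: "c \<in> Obj C \<Longrightarrow> Run C c \<in> arr C (Ten C c E) c"
  using monoidal_C by (simp_all add: vmonoidal_category_def is_iso_def)

lemma functor_G: "vfunctor V C M G"
  using monoidal_G by (simp add: monoidal_functor_def)

lemma vobj_G [simp, intro]: "a \<in> Obj C \<Longrightarrow> vobj V (FO G a)"
  using functor_G by (simp add: vfunctor_def)

lemma FA_vlin: "a \<in> Obj C \<Longrightarrow> b \<in> Obj C \<Longrightarrow> vlin V (Hom C a b) (vhomobj V (FO G a) (FO G b)) (FA G a b)"
  using functor_G by (simp add: vfunctor_def)

lemma FA_vhom [simp, intro]:
  "a \<in> Obj C \<Longrightarrow> b \<in> Obj C \<Longrightarrow> f \<in> arr C a b \<Longrightarrow> FA G a b f \<in> vhom V (FO G a) (FO G b)"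
  using vlin_closed[OF FA_vlin] by simp

lemma FA_closed [simp, intro]:
  "a \<in> Obj C \<Longrightarrow> b \<in> Obj C \<Longrightarrow> f \<in> arr C a b \<Longrightarrow> x \<in> el a \<Longrightarrow> FA G a b f x \<in> el b"
  using vhom_closed[OF FA_vhom] by simp

lemma FA_Ide: "a \<in> Obj C \<Longrightarrow> x \<in> el a \<Longrightarrow> FA G a a (Ide C a) x = x"
  using functor_G by (simp add: vfunctor_def)

lemma FA_Cmp:
  "a \<in> Obj C \<Longrightarrow> b \<in> Obj C \<Longrightarrow> c \<in> Obj C \<Longrightarrow> f \<in> arr C a b \<Longrightarrow> k \<in> arr C b c \<Longrightarrow> x \<in> el a \<Longrightarrow>
     FA G a c (Cmp C a b c k f) x = FA G b c k (FA G a b f x)"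
  using functor_G by (simp add: vfunctor_def compose_eq)

lemma F2_vhom: "a \<in> Obj C \<Longrightarrow> b \<in> Obj C \<Longrightarrow> F2 G a b \<in> vhom V (tobj T (FO G a) (FO G b)) (FO G (Ten C a b))"
  using monoidal_G by (simp add: monoidal_functor_def)

lemma F0_vhom: "F0 G \<in> vhom V I (FO G E)"
  using monoidal_G by (simp add: monoidal_functor_def)

lemma dot_closed [simp, intro]:
  "a \<in> Obj C \<Longrightarrow> b \<in> Obj C \<Longrightarrow> x \<in> el a \<Longrightarrow> y \<in> el b \<Longrightarrow> dot a b x y \<in> el (Ten C a b)"
  unfolding dot_def using vhom_closed[OF F2_vhom] by simp

lemma dot_vbilin:
  "a \<in> Obj C \<Longrightarrow> b \<in> Obj C \<Longrightarrow> vbilin V (FO G a) (FO G b) (FO G (Ten C a b)) (dot a b)"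
  unfolding dot_def by (rule vbilin_comp_tel[OF vobj_G vobj_G vhom_vlin[OF F2_vhom]])

lemma one_closed [simp, intro]: "one \<in> el E"
  unfolding one_def using vhom_closed[OF F0_vhom] by simp

lemma FA_TenH_dot:
  assumes "a \<in> Obj C" "a' \<in> Obj C" "b \<in> Obj C" "b' \<in> Obj C" "f \<in> arr C a a'" "k \<in> arr C b b'"
    and "x \<in> el a" "y \<in> el b"
  shows "FA G (Ten C a b) (Ten C a' b') (TenH C a a' b b' f k) (dot a b x y) =
    dot a' b' (FA G a a' f x) (FA G b b' k y)"
proof -
  have "compose (carrier (tobj T (FO G a) (FO G b))) (F2 G a' b')
      (TenH M (FO G a) (FO G a') (FO G b) (FO G b') (FA G a a' f) (FA G b b' k)) =
    compose (carrier (tobj T (FO G a) (FO G b)))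
      (FA G (Ten C a b) (Ten C a' b') (TenH C a a' b b' f k)) (F2 G a b)"
    using monoidal_G assms by (simp add: monoidal_functor_def)
  from fun_cong[OF this, of "tel T (FO G a) (FO G b) x y"] show ?thesis
    using assms by (simp add: compose_eq TenH_tel dot_def)
qed

lemma FA_Asc_dot:
  assumes abc: "a \<in> Obj C" "b \<in> Obj C" "c \<in> Obj C" and xyz: "x \<in> el a" "y \<in> el b" "z \<in> el c"
  shows "FA G (Ten C a (Ten C b c)) (Ten C (Ten C a b) c) (Asc C a b c) (dot a (Ten C b c) x (dot b c y z)) =
    dot (Ten C a b) c (dot a b x y) z"
proof -
  let ?x = "FO G a" and ?y = "FO G b" and ?z = "FO G c"
  let ?s = "tobj T ?x (tobj T ?y ?z)"
  have "compose (carrier ?s) (FA G (Ten C a (Ten C b c)) (Ten C (Ten C a b) c) (Asc C a b c))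
      (compose (carrier ?s) (F2 G a (Ten C b c)) (whiskl M ?x (tobj T ?y ?z) (FO G (Ten C b c)) (F2 G b c))) =
    compose (carrier ?s) (F2 G (Ten C a b) c) (compose (carrier ?s)
      (whiskr M (tobj T ?x ?y) (FO G (Ten C a b)) ?z (F2 G a b)) (Asc M ?x ?y ?z))"
    using monoidal_G abc by (simp add: monoidal_functor_def Let_def)
  from fun_cong[OF this, of "tel T ?x (tobj T ?y ?z) x (tel T ?y ?z y z)"] show ?thesis
    using abc xyz by (simp add: compose_eq Asc_tel whiskl_tel whiskr_tel F2_vhom dot_def)
qed

lemma
  assumes c: "c \<in> Obj C" and x: "x \<in> el c"
  shows FA_Lun_dot: "FA G (Ten C E c) c (Lun C c) (dot E c one x) = x"
    and FA_Run_dot: "FA G (Ten C c E) c (Run C c) (dot c E x one) = x"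
proof -
  let ?z = "FO G c"
  have "compose (carrier (tobj T I ?z)) (FA G (Ten C E c) c (Lun C c))
      (compose (carrier (tobj T I ?z)) (F2 G E c) (whiskr M I (FO G E) ?z (F0 G))) = Lun M ?z"
    using monoidal_G c by (simp add: monoidal_functor_def Let_def)
  from fun_cong[OF this, of "tel T I ?z (uel T) x"]
  show "FA G (Ten C E c) c (Lun C c) (dot E c one x) = x"
    using c x by (simp add: compose_eq whiskr_tel F0_vhom dot_def one_def Lun_tel)
  have "compose (carrier (tobj T ?z I)) (FA G (Ten C c E) c (Run C c))
      (compose (carrier (tobj T ?z I)) (F2 G c E) (whiskl M ?z I (FO G E) (F0 G))) = Run M ?z"
    using monoidal_G c by (simp add: monoidal_functor_def Let_def)
  from fun_cong[OF this, of "tel T ?z I x (uel T)"]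
  show "FA G (Ten C c E) c (Run C c) (dot c E x one) = x"
    using c x by (simp add: compose_eq whiskl_tel F0_vhom dot_def one_def Run_tel)
qed

lemma
  shows mob_R [simp]: "mob R = FO G E" and mun_image [simp]: "mun R = F0 G"
    and bob_Ub [simp]: "bob (Ub c) = FO G c" and FO_U [simp]: "FO U c = Ub c"
    and FA_U [simp]: "FA U = FA G" and F0_U [simp]: "F0 U = (\<lambda>x\<in>el E. x)"
  by (simp_all add: image_monoid_def image_bimod_def bimod_factor_def Let_def)

lemma mmu_image: "mmu R = blact (Ub E)"
  by (simp add: image_monoid_def image_bimod_def Let_def)

lemma lact_dot:
  "c \<in> Obj C \<Longrightarrow> r \<in> el E \<Longrightarrow> x \<in> el c \<Longrightarrow> lact c r x = FA G (Ten C E c) c (Lun C c) (dot E c r x)"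
  by (simp add: lact_def image_bimod_def Let_def compose_eq dot_def)

lemma racr_dot:
  "c \<in> Obj C \<Longrightarrow> r \<in> el E \<Longrightarrow> x \<in> el c \<Longrightarrow> racr c x r = FA G (Ten C c E) c (Run C c) (dot c E x r)"
  by (simp add: racr_def image_bimod_def Let_def compose_eq dot_def)

text \<open>The triangle axiom of \<open>C\<close> seen through \<open>G\<close>: naturality of the
  structure maps pulls both unit constraints outside, and the associativity law moves
  \<open>r\<close> from the left to the right factor.\<close>

lemma dot_balanced:
  assumes ab: "a \<in> Obj C" "b \<in> Obj C" and xry: "x \<in> el a" "r \<in> el E" "y \<in> el b"
  shows "dot a b (racr a x r) y = dot a b x (lact b r y)"
proof -
  let ?aeb = "Ten C a (Ten C E b)" and ?aeb' = "Ten C (Ten C a E) b" and ?ab = "Ten C a b"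
  have tri: "Cmp C ?aeb ?aeb' ?ab (whiskr C (Ten C a E) a b (Run C a)) (Asc C a E b) =
      whiskl C a (Ten C E b) b (Lun C b)"
    using monoidal_C ab by (simp add: vmonoidal_category_def)
  have "dot a b (racr a x r) y =
      FA G ?aeb' ?ab (whiskr C (Ten C a E) a b (Run C a)) (dot (Ten C a E) b (dot a E x r) y)"
    using ab xry by (simp add: racr_dot FA_TenH_dot FA_Ide)
  also have "\<dots> = FA G ?aeb' ?ab (whiskr C (Ten C a E) a b (Run C a))
      (FA G ?aeb ?aeb' (Asc C a E b) (dot a (Ten C E b) x (dot E b r y)))"
    using ab xry by (simp add: FA_Asc_dot)
  also have "\<dots> = FA G ?aeb ?ab (whiskl C a (Ten C E b) b (Lun C b)) (dot a (Ten C E b) x (dot E b r y))"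
    unfolding tri[symmetric] using ab xry by (subst FA_Cmp) auto
  also have "\<dots> = dot a b x (lact b r y)"
    using ab xry by (simp add: lact_dot FA_TenH_dot FA_Ide)
  finally show ?thesis .
qed

sublocale bimodules V T R
proof unfold_locales
  show "mmu R \<in> vhom V (tobj T (mob R) (mob R)) (mob R)"
    by (auto simp: image_monoid_def Let_def intro!: vhom_comp[OF F2_vhom])
qed (simp_all add: F0_vhom)

section \<open>Consequences of essential strength\<close>

lemma strong_U: "strong_monoidal_functor V C N U"
  using strong by (simp add: essentially_strong_def)

lemma monoidal_U: "monoidal_functor V C N U"
  using strong_U by (simp add: strong_monoidal_functor_def)

text \<open>The bimodule laws are contained in the assumption that \<open>U\<close> is a functor
  into the category of bimodules.\<close>

lemma bimodule_Ub [simp]: "c \<in> Obj C \<Longrightarrow> is_bimodule M R (Ub c)"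
  using monoidal_U by (simp add: monoidal_functor_def vfunctor_def)

lemma two_sided_Ub [simp]: "c \<in> Obj C \<Longrightarrow> two_sided (Ub c)"
  by (rule is_bimodule_two_sided) simp

lemma blact_mul: "c \<in> Obj C \<Longrightarrow> lmul (Ub c) r x = lact c r x"
  and bract_mul: "c \<in> Obj C \<Longrightarrow> rmul (Ub c) x r = racr c x r"
  by (simp_all add: lact_def racr_def)

text \<open>
  Through \<open>G\<close> this is the coherence law \<open>l_e = r_e\<close>.  It need not be derived from the pentagon
  and the triangle, because \<open>U\<^sub>0\<close> being a bimodule map already contains it.
\<close>

lemma bract_Ub_E: "bract (Ub E) = mmu R"
proof -
  have "F0 U \<in> bimodule_maps M R \<lparr>bob = mob R, blact = mmu R, bract = mmu R\<rparr> (Ub E)"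
    using monoidal_U by (simp add: monoidal_functor_def del: F0_U)
  note * = this[unfolded bimodule_maps_iff[OF two_sided_unit two_sided_Ub[OF E]], simplified]
  have "bract (Ub E) (tel T (FO G E) (FO G E) x y) = mmu R (tel T (FO G E) (FO G E) x y)"
    if "x \<in> el E" "y \<in> el E" for x y
  proof -
    have "mmu R (tel T (FO G E) (FO G E) x y) \<in> el E"
      using vhom_closed[OF mmu_R] that by simp
    then show ?thesis
      using *[THEN conjunct2, THEN bspec, OF that(2), THEN bspec, OF that(1), THEN conjunct2] by simp
  qed
  then show ?thesis
    using vhom_tobj_eqI[of "FO G E" "FO G E" "FO G E" "bract (Ub E)" "mmu R"]
      mmu_R bract_vhom[OF two_sided_Ub[OF E]] by simp
qed

text \<open>Both actions on \<open>Ub E\<close> are the multiplication of \<open>R\<close>, so its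
  bimodule laws contain associativity and both unit laws.\<close>

lemma monoid_R: "is_monoid M R"
  using bimodule_Ub[OF E] mmu_R mun_R bract_Ub_E
  by (simp add: is_monoid_def is_bimodule_def Let_def mmu_image[symmetric])

lemma rmult_lact: "rmult r s = lact E r s"
  by (simp add: mmul_def lact_def mmu_image)

lemma rmult_racr: "rmult r s = racr E r s"
  by (simp add: mmul_def racr_def bract_Ub_E)

lemma rone_eq: "rone = one"
  by (simp add: mone_def one_def)

lemma
  assumes c: "c \<in> Obj C" and r: "r \<in> el E" and x: "x \<in> el c"
  shows lact_closed [simp, intro]: "lact c r x \<in> el c" and racr_closed [simp, intro]: "racr c x r \<in> el c"
    and lact_lact: "s \<in> el E \<Longrightarrow> lact c s (lact c r x) = lact c (rmult s r) x"
    and racr_racr: "s \<in> el E \<Longrightarrow> racr c (racr c x r) s = racr c x (rmult r s)"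
    and lact_racr: "s \<in> el E \<Longrightarrow> lact c r (racr c x s) = racr c (lact c r x) s"
  using assms lmul_closed[OF two_sided_Ub, of c r x] rmul_closed[OF two_sided_Ub, of c r x]
    lmul_lmul[OF bimodule_Ub, of c s r x] rmul_rmul[OF bimodule_Ub, of c r s x]
    lmul_rmul[OF bimodule_Ub, of c r s x]
  by (simp_all add: lact_def racr_def)

lemma lact_one: "c \<in> Obj C \<Longrightarrow> x \<in> el c \<Longrightarrow> lact c one x = x"
  and racr_one: "c \<in> Obj C \<Longrightarrow> x \<in> el c \<Longrightarrow> racr c x one = x"
  using lmul_one[OF bimodule_Ub, of c x] rmul_one[OF bimodule_Ub, of c x]
  by (simp_all add: lact_def racr_def rone_eq)

lemma FA_bimodule_map: "a \<in> Obj C \<Longrightarrow> b \<in> Obj C \<Longrightarrow> f \<in> arr C a b \<Longrightarrow> FA G a b f \<in> bimodule_maps M R (Ub a) (Ub b)"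
  using vlin_closed[of V "Hom C a b" "Hom N (Ub a) (Ub b)" "FA G a b" f] monoidal_U
  by (simp add: monoidal_functor_def vfunctor_def)

lemma
  assumes "a \<in> Obj C" "b \<in> Obj C" "f \<in> arr C a b" "r \<in> el E" "x \<in> el a"
  shows FA_lact: "FA G a b f (lact a r x) = lact b r (FA G a b f x)"
    and FA_racr: "FA G a b f (racr a x r) = racr b (FA G a b f x) r"
  using FA_bimodule_map[OF assms(1-3)] assms by (simp_all add: bimodule_maps_iff lact_def racr_def)

abbreviation "BT a b \<equiv> bt (Ub a) (Ub b)"
abbreviation "bb a b x y \<equiv> be (Ub a) (Ub b) x y"
abbreviation "u a b \<equiv> F2 U a b"

text \<open>The point where essential strength provides the inverses from which the comultiplication
  is built.\<close>

lemma u_iso: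
  assumes ab: "a \<in> Obj C" "b \<in> Obj C"
  shows "u a b \<in> bimodule_maps M R (bim_ten M R (Ub a) (Ub b)) (Ub (Ten C a b)) \<and>
    (\<exists>v\<in>bimodule_maps M R (Ub (Ten C a b)) (bim_ten M R (Ub a) (Ub b)).
       compose (carrier (BT a b)) v (u a b) = (\<lambda>x\<in>carrier (BT a b). x) \<and>
       compose (el (Ten C a b)) (u a b) v = (\<lambda>x\<in>el (Ten C a b). x))"
proof -
  have "is_iso N (bim_ten M R (Ub a) (Ub b)) (Ub (Ten C a b)) (u a b)"
    using strong_U ab by (simp add: strong_monoidal_functor_def)
  then show ?thesis
    by (simp add: is_iso_def)
qed

definition ui :: "'o \<Rightarrow> 'o \<Rightarrow> 'v \<Rightarrow> 'v" where
  "ui a b = (SOME v. v \<in> bimodule_maps M R (Ub (Ten C a b)) (bim_ten M R (Ub a) (Ub b)) \<and>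
       compose (carrier (BT a b)) v (u a b) = (\<lambda>x\<in>carrier (BT a b). x) \<and>
       compose (el (Ten C a b)) (u a b) v = (\<lambda>x\<in>el (Ten C a b). x))"

lemma
  assumes ab: "a \<in> Obj C" "b \<in> Obj C"
  shows u_map: "u a b \<in> bimodule_maps M R (bim_ten M R (Ub a) (Ub b)) (Ub (Ten C a b))"
    and ui_map: "ui a b \<in> bimodule_maps M R (Ub (Ten C a b)) (bim_ten M R (Ub a) (Ub b))"
    and u_vhom: "u a b \<in> vhom V (BT a b) (FO G (Ten C a b))"
    and ui_vhom: "ui a b \<in> vhom V (FO G (Ten C a b)) (BT a b)"
    and u_closed [simp, intro]: "p \<in> carrier (BT a b) \<Longrightarrow> u a b p \<in> el (Ten C a b)"
    and ui_closed [simp, intro]: "z \<in> el (Ten C a b) \<Longrightarrow> ui a b z \<in> carrier (BT a b)"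
    and ui_u [simp]: "p \<in> carrier (BT a b) \<Longrightarrow> ui a b (u a b p) = p"
    and u_ui [simp]: "z \<in> el (Ten C a b) \<Longrightarrow> u a b (ui a b z) = z"
proof -
  show 1: "u a b \<in> bimodule_maps M R (bim_ten M R (Ub a) (Ub b)) (Ub (Ten C a b))"
    using u_iso[OF ab] by simp
  obtain v where v: "v \<in> bimodule_maps M R (Ub (Ten C a b)) (bim_ten M R (Ub a) (Ub b))"
      "compose (carrier (BT a b)) v (u a b) = (\<lambda>x\<in>carrier (BT a b). x)"
      "compose (el (Ten C a b)) (u a b) v = (\<lambda>x\<in>el (Ten C a b). x)"
    using u_iso[OF ab, THEN conjunct2] by (elim bexE conjE)
  have v: "ui a b \<in> bimodule_maps M R (Ub (Ten C a b)) (bim_ten M R (Ub a) (Ub b)) \<and>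
       compose (carrier (BT a b)) (ui a b) (u a b) = (\<lambda>x\<in>carrier (BT a b). x) \<and>
       compose (el (Ten C a b)) (u a b) (ui a b) = (\<lambda>x\<in>el (Ten C a b). x)"
    unfolding ui_def by (rule someI[where x = v]) (intro conjI v)
  show "ui a b \<in> bimodule_maps M R (Ub (Ten C a b)) (bim_ten M R (Ub a) (Ub b))"
    using v by simp
  show 2: "u a b \<in> vhom V (BT a b) (FO G (Ten C a b))" "ui a b \<in> vhom V (FO G (Ten C a b)) (BT a b)"
    using v 1 by (simp_all add: bimodule_maps_def)
  show "p \<in> carrier (BT a b) \<Longrightarrow> u a b p \<in> el (Ten C a b)" "z \<in> el (Ten C a b) \<Longrightarrow> ui a b z \<in> carrier (BT a b)"
    using vhom_closed[OF 2(1)] vhom_closed[OF 2(2)] by simp_all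
  show "ui a b (u a b p) = p" if "p \<in> carrier (BT a b)"
    using v[THEN conjunct2, THEN conjunct1, THEN fun_cong, of p] that by (simp add: compose_eq)
  show "u a b (ui a b z) = z" if "z \<in> el (Ten C a b)"
    using v[THEN conjunct2, THEN conjunct2, THEN fun_cong, of z] that by (simp add: compose_eq)
qed

lemma bb_closed [simp, intro]:
  "a \<in> Obj C \<Longrightarrow> b \<in> Obj C \<Longrightarrow> x \<in> el a \<Longrightarrow> y \<in> el b \<Longrightarrow> bb a b x y \<in> carrier (BT a b)"
  by (simp add: be_closed)

text \<open>The map \<open>F2 U\<close> is given by a \<open>THE\<close>; existence comes from
  \<open>dot_balanced\<close> and uniqueness from \<open>bepi_unique\<close>. The second equation is
  the factorization of \<open>G\<close> through bimodules at the level of structure maps.\<close>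

lemma
  assumes ab: "a \<in> Obj C" "b \<in> Obj C"
  shows u_bb: "x \<in> el a \<Longrightarrow> y \<in> el b \<Longrightarrow> u a b (bb a b x y) = dot a b x y"
    and u_bq: "compose (carrier (tobj T (FO G a) (FO G b))) (u a b) (bq (Ub a) (Ub b)) = F2 G a b"
proof -
  note t = two_sided_Ub[OF ab(1)] two_sided_Ub[OF ab(2)]
  have W: "vobj V (FO G (Ten C a b))"
    using ab by simp
  let ?xy = "tobj T (FO G a) (FO G b)"
  have "\<exists>k. k \<in> vhom V (BT a b) (FO G (Ten C a b)) \<and>
    (\<forall>x\<in>carrier (bob (Ub a)). \<forall>y\<in>carrier (bob (Ub b)). k (bb a b x y) = dot a b x y)"
    using ab dot_vbilin[OF ab] dot_balanced[OF ab] 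
    by (intro bt_lift_ex[OF t W]) (simp_all add: lact_def racr_def)
  then obtain k where k: "k \<in> vhom V (BT a b) (FO G (Ten C a b))"
    and k_bb: "\<And>x y. x \<in> el a \<Longrightarrow> y \<in> el b \<Longrightarrow> k (bb a b x y) = dot a b x y"
    by auto
  have bq: "bq (Ub a) (Ub b) \<in> vhom V ?xy (BT a b)"
    using bq_vhom[OF t] by simp
  have kq: "compose (carrier ?xy) k (bq (Ub a) (Ub b)) = F2 G a b"
    by (rule vhom_tobj_eqI[OF _ _ W vhom_comp[OF bq k] F2_vhom[OF ab]])
      (use ab k_bb in \<open>simp_all add: compose_eq bel_def dot_def\<close>)
  have "u a b = k"
    unfolding bimod_factor_def Let_def monfun.simps base_cat_simps(1-3,5,6) arr_base_cat
  proof (rule the_equality)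
    fix h assume h: "h \<in> vhom V (BT a b) (FO G (Ten C a b)) \<and>
      compose (carrier ?xy) h (bq (Ub a) (Ub b)) = F2 G a b"
    have "h (bb a b x y) = dot a b x y" if "x \<in> el a" "y \<in> el b" for x y
      using fun_cong[OF conjunct2[OF h], of "tel T (FO G a) (FO G b) x y"] that ab
      by (simp add: compose_eq bel_def dot_def)
    then show "h = k"
      using h k_bb by (intro bepi_unique[OF t W _ k]) simp_all
  qed (use k kq in blast)
  then show "x \<in> el a \<Longrightarrow> y \<in> el b \<Longrightarrow> u a b (bb a b x y) = dot a b x y"
    "compose (carrier (tobj T (FO G a) (FO G b))) (u a b) (bq (Ub a) (Ub b)) = F2 G a b"
    using k_bb kq by simp_all
qed

lemma BT_eqI:
  fixes W :: "('k, 'v) module"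
  assumes ab: "a \<in> Obj C" "b \<in> Obj C" and W: "vobj V W"
    and f: "vlin V (BT a b) W f" and k: "vlin V (BT a b) W k"
    and eq: "\<And>x y. x \<in> el a \<Longrightarrow> y \<in> el b \<Longrightarrow> f (bb a b x y) = k (bb a b x y)"
    and p: "p \<in> carrier (BT a b)"
  shows "f p = k p"
  by (rule bt_eqI[OF two_sided_Ub[OF ab(1)] two_sided_Ub[OF ab(2)] W f k _ p]) (simp add: eq)

section \<open>The universal element and the right action\<close>

definition w :: 'v where
  "w = (SOME x. x \<in> el g \<and> \<theta> g x = Ide C g)"

lemma \<theta>_iso:
  assumes c: "c \<in> Obj C"
  shows "\<theta> c \<in> vhom V (FO G c) (Hom C g c) \<and> (\<exists>k\<in>vhom V (Hom C g c) (FO G c).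
    compose (el c) k (\<theta> c) = (\<lambda>x\<in>el c. x) \<and> compose (arr C g c) (\<theta> c) k = (\<lambda>x\<in>arr C g c. x))"
proof -
  have "is_iso M (FO G c) (Hom C g c) (\<theta> c)"
    using representing c by (simp add: nat_iso_def hom_functor_def)
  then show ?thesis
    by (simp add: is_iso_def)
qed

lemma \<theta>_vhom: "c \<in> Obj C \<Longrightarrow> \<theta> c \<in> vhom V (FO G c) (Hom C g c)"
  using \<theta>_iso by blast

lemma \<theta>_arr [simp, intro]: "c \<in> Obj C \<Longrightarrow> x \<in> el c \<Longrightarrow> \<theta> c x \<in> arr C g c"
  using vhom_closed[OF \<theta>_vhom] .

lemma \<theta>_natural:
  assumes "a \<in> Obj C" "b \<in> Obj C" "f \<in> arr C a b" "x \<in> el a"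
  shows "\<theta> b (FA G a b f x) = Cmp C g a b f (\<theta> a x)"
proof -
  have "compose (el a) (\<theta> b) (FA G a b f) = compose (el a) (\<lambda>h\<in>arr C g a. Cmp C g a b f h) (\<theta> a)"
    using representing assms by (simp add: nat_iso_def hom_functor_def)
  from fun_cong[OF this, of x] show ?thesis
    using assms by (simp add: compose_eq)
qed

lemma w_closed [simp, intro]: "w \<in> el g" and \<theta>_w: "\<theta> g w = Ide C g"
proof -
  obtain k where k: "k \<in> vhom V (Hom C g g) (FO G g)" "compose (arr C g g) (\<theta> g) k = (\<lambda>x\<in>arr C g g. x)"
    using \<theta>_iso[OF g] by blast
  have "k (Ide C g) \<in> el g \<and> \<theta> g (k (Ide C g)) = Ide C g"
    using fun_cong[OF k(2), of "Ide C g"] vhom_closed[OF k(1)] by (simp add: compose_eq)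
  then have "w \<in> el g \<and> \<theta> g w = Ide C g"
    unfolding w_def by (rule someI)
  then show "w \<in> el g" "\<theta> g w = Ide C g"
    by simp_all
qed

lemma \<theta>_FA_w: "c \<in> Obj C \<Longrightarrow> f \<in> arr C g c \<Longrightarrow> \<theta> c (FA G g c f w) = f"
  by (simp add: \<theta>_natural \<theta>_w)

lemma \<theta>_inj: "c \<in> Obj C \<Longrightarrow> x \<in> el c \<Longrightarrow> y \<in> el c \<Longrightarrow> \<theta> c x = \<theta> c y \<Longrightarrow> x = y"
proof -
  assume c: "c \<in> Obj C" and xy: "x \<in> el c" "y \<in> el c" and eq: "\<theta> c x = \<theta> c y"
  obtain k where "compose (el c) k (\<theta> c) = (\<lambda>x\<in>el c. x)"
    using \<theta>_iso[OF c] by blast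
  from fun_cong[OF this, of x] fun_cong[OF this, of y] show "x = y"
    using xy eq by (simp add: compose_eq)
qed

lemma FA_\<theta>_w: "c \<in> Obj C \<Longrightarrow> x \<in> el c \<Longrightarrow> FA G g c (\<theta> c x) w = x"
  by (rule \<theta>_inj[OF _ _ _ \<theta>_FA_w]) (auto intro: FA_closed)

definition act :: "'o \<Rightarrow> 'v \<Rightarrow> 'v \<Rightarrow> 'v" where
  "act c x a = FA G g c (\<theta> c x) a"

lemma act_closed [simp, intro]: "c \<in> Obj C \<Longrightarrow> x \<in> el c \<Longrightarrow> a \<in> el g \<Longrightarrow> act c x a \<in> el c"
  by (simp add: act_def)

text \<open>Naturality of \<theta> rewrites \<open>G(f) G(\<theta>(x))\<close> as
  \<open>G(\<theta>(G(f) x))\<close>, so every \<open>G(f)\<close> is a module map. Associativity of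
  the action is the special case \<open>f = \<theta>(x)\<close>.\<close>

lemma FA_act:
  "b \<in> Obj C \<Longrightarrow> c \<in> Obj C \<Longrightarrow> f \<in> arr C b c \<Longrightarrow> x \<in> el b \<Longrightarrow> a \<in> el g \<Longrightarrow>
     FA G b c f (act b x a) = act c (FA G b c f x) a"
  by (simp add: act_def \<theta>_natural FA_Cmp)

lemma act_act: "c \<in> Obj C \<Longrightarrow> x \<in> el c \<Longrightarrow> a \<in> el g \<Longrightarrow> b \<in> el g \<Longrightarrow> act c (act c x a) b = act c x (act g a b)"
  unfolding act_def[of c x] by (rule FA_act[symmetric]) simp_all

lemma act_w: "c \<in> Obj C \<Longrightarrow> x \<in> el c \<Longrightarrow> act c x w = x"
  by (simp add: act_def FA_\<theta>_w)

lemma w_act: "a \<in> el g \<Longrightarrow> act g w a = a"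
  by (simp add: act_def \<theta>_w FA_Ide)

text \<open>In \<open>a\<close> the action is a morphism \<open>G(\<theta>(x))\<close>. In
  \<open>x\<close> it is the composite of \<theta>, of \<open>G\<close> on hom-objects and of
  evaluation at \<open>a\<close>; this is where enrichment of \<open>G\<close> and of the
  representation is used.\<close>

lemma act_vbilin: "c \<in> Obj C \<Longrightarrow> vbilin V (FO G c) (FO G g) (FO G c) (act c)"
  unfolding vbilin_def act_def
  using vlin_comp[OF vhom_vlin[OF \<theta>_vhom] vlin_comp[OF FA_vlin vlin_evaluation]] vhom_vlin[OF FA_vhom]
  by (simp add: vobj_G)

lemma
  assumes "c \<in> Obj C" "x \<in> el c" "a \<in> el g" "r \<in> el E"
  shows act_lact: "act c x (lact g r a) = lact c r (act c x a)"
    and act_racr: "act c x (racr g a r) = racr c (act c x a) r"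
  using assms by (simp_all add: act_def FA_lact FA_racr)

section \<open>The bialgebroid\<close>

abbreviation "gg \<equiv> Ten C g g"

definition comult_arr :: 'v where
  "comult_arr = \<theta> gg (dot g g w w)"

definition counit_arr :: 'v where
  "counit_arr = \<theta> E one"

definition A :: "('k, 'v) bialgebroid_data" where
  "A = \<lparr>tot = \<lparr>mob = FO G g, mmu = tlift V T (FO G g) (FO G g) (FO G g) (act g), mun = unit_map (FO G g) w\<rparr>,
     src = (\<lambda>r\<in>el E. racr g w r), tgt = (\<lambda>r\<in>el E. lact g r w),
     cop = compose (el g) (ui g g) (FA G g gg comult_arr), cou = FA G g E counit_arr\<rparr>"

definition K_obj :: "'o \<Rightarrow> ('k, 'v) vrmod" where
  "K_obj c = \<lparr>rob = FO G c, ract = tlift V T (FO G c) (FO G g) (FO G c) (act c)\<rparr>"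

lemma comult_arr_in [simp, intro]: "comult_arr \<in> arr C g gg" and counit_arr_in [simp, intro]: "counit_arr \<in> arr C g E"
  by (auto simp: comult_arr_def counit_arr_def)

lemma FA_comult_w: "FA G g gg comult_arr w = dot g g w w" and FA_counit_w: "FA G g E counit_arr w = one"
  by (simp_all add: comult_arr_def counit_arr_def FA_\<theta>_w dot_closed)

text \<open>
  Reduces equalities between maps out of \<open>G g\<close> to equalities at \<open>w\<close>.
\<close>

lemma FA_g: "c \<in> Obj C \<Longrightarrow> f \<in> arr C g c \<Longrightarrow> a \<in> el g \<Longrightarrow> FA G g c f a = act c (FA G g c f w) a"
  using FA_act[of g c f w a] by (simp add: w_act)

lemma FA_comult: "a \<in> el g \<Longrightarrow> FA G g gg comult_arr a = act gg (dot g g w w) a"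
  using FA_g[of gg comult_arr a] by (simp add: FA_comult_w)

lemma mob_tot [simp]: "mob (tot A) = FO G g"
  and src_A: "r \<in> el E \<Longrightarrow> src A r = racr g w r"
  and tgt_A: "r \<in> el E \<Longrightarrow> tgt A r = lact g r w"
  and cou_A: "cou A = FA G g E counit_arr"
  by (simp_all add: A_def)

lemma cop_A: "a \<in> el g \<Longrightarrow> cop A a = ui g g (FA G g gg comult_arr a)"
  by (simp add: A_def compose_eq)

lemma src_closed [simp, intro]: "r \<in> el E \<Longrightarrow> src A r \<in> el g"
  and tgt_closed [simp, intro]: "r \<in> el E \<Longrightarrow> tgt A r \<in> el g"
  and cop_closed [simp, intro]: "a \<in> el g \<Longrightarrow> cop A a \<in> carrier (BT g g)"
  by (simp_all add: src_A tgt_A cop_A)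

text \<open>The working form of \<delta>: after \<open>u g g\<close> it is the orbit of the element
  \<open>G_{g,g}(w \<otimes> w)\<close>, so identities for \<delta> become identities between
  actions.\<close>

lemma u_cop: "a \<in> el g \<Longrightarrow> u g g (cop A a) = act gg (dot g g w w) a"
  by (simp add: cop_A FA_comult act_closed dot_closed)

lemma regular_A: "regular A = K_obj g"
  by (simp add: A_def K_obj_def)

lemma rob_K_obj [simp]: "rob (K_obj c) = FO G c"
  by (simp add: K_obj_def)

lemma ract_K_obj: "c \<in> Obj C \<Longrightarrow> ract (K_obj c) \<in> vhom V (tobj T (FO G c) (FO G g)) (FO G c)"
  by (simp add: K_obj_def tlift_vhom act_vbilin)

lemma ract_el_K_obj: "c \<in> Obj C \<Longrightarrow> x \<in> el c \<Longrightarrow> a \<in> el g \<Longrightarrow> ract_el T (tot A) (K_obj c) x a = act c x a"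
  by (simp add: ract_el_def K_obj_def tlift_tel act_vbilin)

lemma mmu_A: "mmu (tot A) \<in> vhom V (tobj T (FO G g) (FO G g)) (FO G g)"
  and mun_A: "mun (tot A) \<in> vhom V I (FO G g)"
  by (simp_all add: A_def tlift_vhom act_vbilin unit_map_vhom)

lemma mmul_A: "a \<in> el g \<Longrightarrow> b \<in> el g \<Longrightarrow> mmul T (tot A) a b = act g a b"
  by (simp add: mmul_def A_def tlift_tel act_vbilin)

lemma mone_A: "mone T (tot A) = w"
  by (simp add: mone_def A_def unit_map_uel)

text \<open>Orbit maps lie in the image of \<open>G\<close>. The tensor products of orbit maps that
  define the Takeuchi product and the action on products of modules therefore fall under naturality
  of \<open>u\<close>.\<close>

lemma orbit_K_obj: "c \<in> Obj C \<Longrightarrow> x \<in> el c \<Longrightarrow> orbit T (tot A) (K_obj c) x = FA G g c (\<theta> c x)"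
  using FA_vhom[OF g _ \<theta>_arr, of c x]
  by (intro extensionalityI[of _ "el g"]) (simp_all add: orbit_def ract_el_K_obj vhom_def act_def)

text \<open>An equality of records, not merely an isomorphism: the actions are determined by their
  values on pure tensors, and \<open>x \<triangleleft> (r \<cdot> w) = r \<cdot> (x \<triangleleft>
  w) = r \<cdot> x\<close>, likewise on the right.\<close>

lemma rmod_bimod_K_obj: "c \<in> Obj C \<Longrightarrow> rmod_bimod V T R A (K_obj c) = Ub c"
proof -
  assume c: "c \<in> Obj C"
  have "tlift V T (FO G E) (FO G c) (FO G c) (\<lambda>r x. ract_el T (tot A) (K_obj c) x (tgt A r)) = blact (Ub c)"
    using c blact_vhom[OF two_sided_Ub[OF c]]
    by (intro tlift_eqI) (simp_all add: ract_el_K_obj tgt_A act_lact act_w, simp add: lact_def)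
  moreover have "tlift V T (FO G c) (FO G E) (FO G c) (\<lambda>x r. ract_el T (tot A) (K_obj c) x (src A r)) = bract (Ub c)"
    using c bract_vhom[OF two_sided_Ub[OF c]]
    by (intro tlift_eqI) (simp_all add: ract_el_K_obj src_A act_racr act_w, simp add: racr_def)
  ultimately show ?thesis
    by (simp add: rmod_bimod_def)
qed

lemma A_bimod_eq: "A_bimod V T R A = Ub g"
  unfolding regular_A by (rule rmod_bimod_K_obj[OF g])

text \<open>Allows the unit of the bimodule category to be treated as one of the bimodules
  \<open>Ub c\<close>, so that unit laws can be read with \<open>E\<close> as an object of
  \<open>C\<close>.\<close>

lemma unit_bimod: "\<lparr>bob = FO G E, blact = mmu R, bract = mmu R\<rparr> = Ub E"
  by (rule bimod.equality) (simp_all add: bract_Ub_E mmu_image)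

lemma monoid_A: "is_monoid M (tot A)"
proof -
  have "is_monoid M \<lparr>mob = FO G g, mmu = mmu (tot A), mun = mun (tot A)\<rparr>"
    using mmul_A mone_A mmu_A mun_A by (intro is_monoidI) (simp_all add: mmul_def mone_def act_act act_w w_act)
  then show ?thesis
    by (simp add: A_def)
qed

lemma
  assumes r: "r \<in> el E"
  shows racr_E_one: "racr E one r = r" and lact_E_one: "lact E r one = r"
  using r lact_one[of E r] racr_one[of E r] by (simp_all flip: rmult_lact rmult_racr)

text \<open>The map \<epsilon> lies in the image of \<open>G\<close>, hence is a bimodule map, and
  it sends \<open>w\<close> to the unit of \<open>R\<close>.\<close>

lemma cou_src: "r \<in> el E \<Longrightarrow> cou A (src A r) = r" and cou_tgt: "r \<in> el E \<Longrightarrow> cou A (tgt A r) = r"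
  by (simp_all add: cou_A src_A tgt_A FA_racr FA_lact FA_counit_w racr_E_one lact_E_one)

lemma cou_act: "a \<in> el g \<Longrightarrow> b \<in> el g \<Longrightarrow> cou A (act g a b) = act E (cou A a) b"
  by (simp add: cou_A FA_act)

lemma racr_vbilin: "c \<in> Obj C \<Longrightarrow> vbilin V (FO G c) (FO G E) (FO G c) (racr c)"
  and lact_vbilin: "c \<in> Obj C \<Longrightarrow> vbilin V (FO G E) (FO G c) (FO G c) (lact c)"
  using rmul_vbilin[OF two_sided_Ub, of c] lmul_vbilin[OF two_sided_Ub, of c]
  by (simp_all add: racr_def[abs_def] lact_def[abs_def])

section \<open>Source and target maps\<close>

text \<open>Right multiplication by \<open>s(y)\<close> is the right action of \<open>y\<close>, so
  \<open>s(x) s(y) = (w \<cdot> x) \<cdot> y = w \<cdot> (x y)\<close>.\<close>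

lemma src_morphism: "monoid_morphism M R (tot A) (src A)"
proof (rule monoid_morphismI)
  have "vlin V (FO G E) (FO G g) (racr g w)"
    using racr_vbilin[OF g] by (simp add: vbilin_def)
  then show "src A \<in> vhom V (mob R) (mob (tot A))"
    by (simp add: A_def vhomI)
  show "src A (rmult x y) = mmul T (tot A) (src A x) (src A y)" if "x \<in> carrier (mob R)" "y \<in> carrier (mob R)" for x y
    using that rmult_closed[of x y] by (simp add: src_A mmul_A act_racr act_w racr_racr)
  show "src A rone = mone T (tot A)"
    by (simp add: rone_eq mone_A src_A racr_one)
qed (use mmu_R mun_R mmu_A mun_A in simp_all)

text \<open>Right multiplication by \<open>t(y)\<close> is the left action of \<open>y\<close>, so
  \<open>t(x) t(y) = y \<cdot> (x \<cdot> w) = (y x) \<cdot> w\<close>; hence the opposite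
  monoid.\<close>

lemma tgt_morphism: "monoid_morphism M (opposite_monoid V T R) (tot A) (tgt A)"
proof (rule monoid_morphismI)
  let ?R = "opposite_monoid V T R"
  have bil: "vbilin V (FO G E) (FO G E) (FO G E) (\<lambda>x y. rmult y x)"
    using vbilin_comp_tel[OF vobj_R vobj_R vhom_vlin[OF mmu_R]] by (simp add: vbilin_def mmul_def)
  have "vlin V (FO G E) (FO G g) (\<lambda>r. lact g r w)"
    using lact_vbilin[OF g] by (simp add: vbilin_def)
  then show "tgt A \<in> vhom V (mob ?R) (mob (tot A))"
    by (simp add: A_def vhomI opposite_monoid_def)
  show "mmu ?R \<in> vhom V (tobj T (mob ?R) (mob ?R)) (mob ?R)"
    using bil by (simp add: opposite_monoid_def tlift_vhom)
  show "tgt A (mmul T ?R x y) = mmul T (tot A) (tgt A x) (tgt A y)" if "x \<in> carrier (mob ?R)" "y \<in> carrier (mob ?R)" for x y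
  proof -
    have xy: "x \<in> el E" "y \<in> el E"
      using that by (simp_all add: opposite_monoid_def)
    then have "mmul T ?R x y = rmult y x"
      using bil by (simp add: mmul_def opposite_monoid_def tlift_tel)
    then show ?thesis
      using xy rmult_closed[of y x] by (simp add: tgt_A mmul_A act_lact act_w lact_lact)
  qed
  have "mone T ?R = one"
    by (simp add: mone_def opposite_monoid_def one_def)
  then show "tgt A (mone T ?R) = mone T (tot A)"
    by (simp add: mone_A tgt_A lact_one)
qed (use mun_R mmu_A mun_A in \<open>simp_all add: opposite_monoid_def\<close>)

text \<open>The two products are \<open>r' \<cdot> (w \<cdot> r)\<close> and
  \<open>(r' \<cdot> w) \<cdot> r\<close>.\<close>

lemma src_tgt_commute:
  "r \<in> el E \<Longrightarrow> r' \<in> el E \<Longrightarrow> mmul T (tot A) (src A r) (tgt A r') = mmul T (tot A) (tgt A r') (src A r)"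
  by (simp add: mmul_A) (simp add: src_A tgt_A act_lact act_racr act_w lact_racr)

section \<open>Transport along the structure maps of U\<close>

abbreviation "tenN a a' b b' \<equiv> TenH N (Ub a) (Ub a') (Ub b) (Ub b')"

lemma
  assumes "a \<in> Obj C" "a' \<in> Obj C" "b \<in> Obj C" "b' \<in> Obj C" "f \<in> arr C a a'" "k \<in> arr C b b'"
  shows tenN_vhom: "tenN a a' b b' (FA G a a' f) (FA G b b' k) \<in> vhom V (BT a b) (BT a' b')"
    and tenN_bb: "x \<in> el a \<Longrightarrow> y \<in> el b \<Longrightarrow>
      tenN a a' b b' (FA G a a' f) (FA G b b' k) (bb a b x y) = bb a' b' (FA G a a' f x) (FA G b b' k y)"
    and u_tenN: "p \<in> carrier (BT a b) \<Longrightarrow> u a' b' (tenN a a' b b' (FA G a a' f) (FA G b b' k) p) =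
      FA G (Ten C a b) (Ten C a' b') (TenH C a a' b b' f k) (u a b p)"
proof -
  have t: "two_sided (Ub a)" "two_sided (Ub b)" "two_sided (Ub a')" "two_sided (Ub b')"
    using assms by simp_all
  note maps = FA_racr[OF assms(1,2,5)] FA_lact[OF assms(3,4,6)]
  show "tenN a a' b b' (FA G a a' f) (FA G b b' k) \<in> vhom V (BT a b) (BT a' b')"
    using maps assms by (intro TenH_N_vhom[OF t]) (simp_all add: lact_def racr_def)
  show "x \<in> el a \<Longrightarrow> y \<in> el b \<Longrightarrow>
      tenN a a' b b' (FA G a a' f) (FA G b b' k) (bb a b x y) = bb a' b' (FA G a a' f x) (FA G b b' k y)"
    using maps assms by (intro TenH_N_be[OF t]) (simp_all add: lact_def racr_def)
  have "compose (carrier (BT a b)) (u a' b') (tenN a a' b b' (FA G a a' f) (FA G b b' k)) =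
      compose (carrier (BT a b)) (FA G (Ten C a b) (Ten C a' b') (TenH C a a' b b' f k)) (u a b)"
    using monoidal_U assms by (simp add: monoidal_functor_def)
  from fun_cong[OF this, of p]
  show "p \<in> carrier (BT a b) \<Longrightarrow> u a' b' (tenN a a' b b' (FA G a a' f) (FA G b b' k) p) =
      FA G (Ten C a b) (Ten C a' b') (TenH C a a' b b' f k) (u a b p)"
    by (simp add: compose_eq)
qed

text \<open>By naturality of \<open>u\<close> the product of the two orbit maps becomes
  \<open>G(\<theta>(x) \<box> \<theta>(y))\<close>. This is a module map that sends
  \<open>dot g g w w\<close> to \<open>dot a b x y\<close>, so applying it to
  \<open>u g g (cop A c)\<close> gives the right-hand side.\<close>

lemma u_tenN_cop:
  assumes "a \<in> Obj C" "b \<in> Obj C" "x \<in> el a" "y \<in> el b" "c \<in> el g"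
  shows "u a b (tenN g a g b (FA G g a (\<theta> a x)) (FA G g b (\<theta> b y)) (cop A c)) = act (Ten C a b) (dot a b x y) c"
  using assms by (simp add: u_tenN u_cop FA_act FA_TenH_dot FA_\<theta>_w dot_closed)

abbreviation "id_el a \<equiv> (\<lambda>x\<in>el a. x)"

lemma FA_Ide_eq: "a \<in> Obj C \<Longrightarrow> FA G a a (Ide C a) = id_el a"
  using functor_G by (simp add: vfunctor_def)

lemma two_sided_bim_ten_Ub [simp]: "a \<in> Obj C \<Longrightarrow> b \<in> Obj C \<Longrightarrow> two_sided (bim_ten M R (Ub a) (Ub b))"
  by (simp add: two_sided_bim_ten)

text \<open>As \<open>u\<close> and \<open>ui\<close> are bimodule maps, the actions on a product
  over \<open>R\<close> are those on \<open>G(a \<box> b)\<close> carried back, for all elements and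
  not just for pure tensors.\<close>

lemma lmul_bb:
  "a \<in> Obj C \<Longrightarrow> b \<in> Obj C \<Longrightarrow> r \<in> el E \<Longrightarrow> p \<in> carrier (BT a b) \<Longrightarrow>
     lmul (bim_ten M R (Ub a) (Ub b)) r p = ui a b (lact (Ten C a b) r (u a b p))"
  and rmul_bb:
  "a \<in> Obj C \<Longrightarrow> b \<in> Obj C \<Longrightarrow> r \<in> el E \<Longrightarrow> p \<in> carrier (BT a b) \<Longrightarrow>
     rmul (bim_ten M R (Ub a) (Ub b)) p r = ui a b (racr (Ten C a b) (u a b p) r)"
  using u_map[of a b] ui_map[of a b]
  by (simp_all add: bimodule_maps_iff lact_def racr_def)

abbreviation "BT3l a b c \<equiv> bt (Ub a) (bim_ten M R (Ub b) (Ub c))"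
abbreviation "BT3r a b c \<equiv> bt (bim_ten M R (Ub a) (Ub b)) (Ub c)"

text \<open>Comparison maps for three factors. \<open>u3l\<close> leaves the right-bracketed product
  over \<open>R\<close>, and \<open>ui3r\<close> below arrives at the left-bracketed one, so that
  \<open>G\<close> of the associator of \<open>C\<close> fits between them.\<close>

definition u3l :: "'o \<Rightarrow> 'o \<Rightarrow> 'o \<Rightarrow> 'v \<Rightarrow> 'v" where
  "u3l a b c = compose (carrier (BT3l a b c)) (u a (Ten C b c))
     (TenH N (Ub a) (Ub a) (bim_ten M R (Ub b) (Ub c)) (Ub (Ten C b c)) (id_el a) (u b c))"

definition ui3r :: "'o \<Rightarrow> 'o \<Rightarrow> 'o \<Rightarrow> 'v \<Rightarrow> 'v" where
  "ui3r a b c = compose (el (Ten C (Ten C a b) c))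
     (TenH N (Ub (Ten C a b)) (bim_ten M R (Ub a) (Ub b)) (Ub c) (Ub c) (ui a b) (id_el c)) (ui (Ten C a b) c)"

lemma
  assumes abc: "a \<in> Obj C" "b \<in> Obj C" "c \<in> Obj C"
  shows u3l_vhom: "u3l a b c \<in> vhom V (BT3l a b c) (FO G (Ten C a (Ten C b c)))"
    and u3l_be: "x \<in> el a \<Longrightarrow> p \<in> carrier (BT b c) \<Longrightarrow>
      u3l a b c (be (Ub a) (bim_ten M R (Ub b) (Ub c)) x p) = dot a (Ten C b c) x (u b c p)"
    and ui3r_vhom: "ui3r a b c \<in> vhom V (FO G (Ten C (Ten C a b) c)) (BT3r a b c)"
    and ui3r_dot: "q \<in> el (Ten C a b) \<Longrightarrow> z \<in> el c \<Longrightarrow>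
      ui3r a b c (dot (Ten C a b) c q z) = be (bim_ten M R (Ub a) (Ub b)) (Ub c) (ui a b q) z"
proof -
  let ?Bab = "bim_ten M R (Ub a) (Ub b)" and ?Bbc = "bim_ten M R (Ub b) (Ub c)"
  let ?k = "TenH N (Ub a) (Ub a) ?Bbc (Ub (Ten C b c)) (id_el a) (u b c)"
  let ?l = "TenH N (Ub (Ten C a b)) ?Bab (Ub c) (Ub c) (ui a b) (id_el c)"
  have t: "two_sided (Ub a)" "two_sided ?Bbc" "two_sided (Ub (Ten C b c))"
    and t': "two_sided (Ub (Ten C a b))" "two_sided ?Bab" "two_sided (Ub c)"
    using abc by simp_all
  have k: "?k \<in> vhom V (BT3l a b c) (BT a (Ten C b c))"
    and k_be: "\<And>x p. x \<in> el a \<Longrightarrow> p \<in> carrier (BT b c) \<Longrightarrow> ?k (be (Ub a) ?Bbc x p) = bb a (Ten C b c) x (u b c p)"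
    using abc u_vhom[of b c] vhom_id[OF vobj_G[OF abc(1)]] racr_closed[of a] lmul_bb[of b c]
      TenH_N_vhom[OF t(1,2,1,3), of "id_el a" "u b c"] TenH_N_be[OF t(1,2,1,3), of "id_el a" "u b c"]
    by (simp_all add: bract_mul blact_mul flip: racr_def lact_def)
  show "u3l a b c \<in> vhom V (BT3l a b c) (FO G (Ten C a (Ten C b c)))"
    unfolding u3l_def using abc t by (intro vhom_comp[OF k] u_vhom) auto
  show "u3l a b c (be (Ub a) ?Bbc x p) = dot a (Ten C b c) x (u b c p)" if "x \<in> el a" "p \<in> carrier (BT b c)"
    using that abc be_closed[OF t(1,2), of x p] by (simp add: u3l_def compose_eq k_be u_bb u_closed)
  have l: "?l \<in> vhom V (BT (Ten C a b) c) (BT3r a b c)"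
    and l_be: "\<And>q z. q \<in> el (Ten C a b) \<Longrightarrow> z \<in> el c \<Longrightarrow> ?l (bb (Ten C a b) c q z) = be ?Bab (Ub c) (ui a b q) z"
    using abc ui_vhom[of a b] vhom_id[OF vobj_G[OF abc(3)]] lact_closed[of c] rmul_bb[of a b]
      TenH_N_vhom[OF t'(1,3,2,3), of "ui a b" "id_el c"] TenH_N_be[OF t'(1,3,2,3), of "ui a b" "id_el c"]
    by (simp_all add: ui_closed flip: racr_def lact_def)
  show "ui3r a b c \<in> vhom V (FO G (Ten C (Ten C a b) c)) (BT3r a b c)"
    unfolding ui3r_def using abc by (intro vhom_comp[OF ui_vhom l]) auto
  show "ui3r a b c (dot (Ten C a b) c q z) = be ?Bab (Ub c) (ui a b q) z" if "q \<in> el (Ten C a b)" "z \<in> el c"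
  proof -
    have "ui (Ten C a b) c (dot (Ten C a b) c q z) = bb (Ten C a b) c q z"
      using that abc ui_u[of "Ten C a b" c "bb (Ten C a b) c q z"] by (simp add: u_bb bb_closed)
    then show ?thesis
      using that abc by (simp add: ui3r_def compose_eq l_be dot_closed)
  qed
qed

lemma ui_dot: "a \<in> Obj C \<Longrightarrow> b \<in> Obj C \<Longrightarrow> x \<in> el a \<Longrightarrow> y \<in> el b \<Longrightarrow> ui a b (dot a b x y) = bb a b x y"
  using ui_u[of a b "bb a b x y"] by (simp add: u_bb bb_closed)

text \<open>The composite has the values that characterize the associator over \<open>R\<close>, by
  the associativity law of \<open>G\<close> on elements.\<close>

lemma Asc_N:
  assumes abc: "a \<in> Obj C" "b \<in> Obj C" "c \<in> Obj C"
  shows "Asc N (Ub a) (Ub b) (Ub c) = compose (carrier (BT3l a b c)) (ui3r a b c)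
    (compose (carrier (BT3l a b c)) (FA G (Ten C a (Ten C b c)) (Ten C (Ten C a b) c) (Asc C a b c)) (u3l a b c))"
proof (rule Asc_N_eqI)
  have 1: "vobj V (BT3l a b c)"
    using abc by (intro vobj_bt) auto
  then show "compose (carrier (BT3l a b c)) (ui3r a b c)
    (compose (carrier (BT3l a b c)) (FA G (Ten C a (Ten C b c)) (Ten C (Ten C a b) c) (Asc C a b c)) (u3l a b c)) \<in> vhom V (BT3l a b c) (BT3r a b c)"
    using abc by (intro vhom_comp[OF vhom_comp[OF u3l_vhom FA_vhom] ui3r_vhom]) auto
  fix x y z assume xyz: "x \<in> carrier (bob (Ub a))" "y \<in> carrier (bob (Ub b))" "z \<in> carrier (bob (Ub c))"
  have "be (Ub a) (bim_ten M R (Ub b) (Ub c)) x (bb b c y z) \<in> carrier (BT3l a b c)"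
    using abc xyz by (intro be_closed) (auto simp: bb_closed)
  then show "compose (carrier (BT3l a b c)) (ui3r a b c)
    (compose (carrier (BT3l a b c)) (FA G (Ten C a (Ten C b c)) (Ten C (Ten C a b) c) (Asc C a b c)) (u3l a b c))
     (be (Ub a) (bim_ten M R (Ub b) (Ub c)) x (bb b c y z)) = be (bim_ten M R (Ub a) (Ub b)) (Ub c) (bb a b x y) z"
    using abc xyz by (simp add: compose_eq u3l_be ui3r_dot bb_closed u_bb FA_Asc_dot dot_closed ui_dot)
qed (use abc in simp_all)

section \<open>The comonoid structure\<close>

lemma cop_map: "cop A \<in> bimodule_maps M R (Ub g) (bim_ten M R (Ub g) (Ub g))"
  using bimodule_maps_comp[OF _ _ _ FA_bimodule_map[OF g _ comult_arr_in] ui_map[OF g g]]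
  by (simp add: A_def)

lemma cop_vhom: "cop A \<in> vhom V (FO G g) (BT g g)"
  using cop_map by (simp add: bimodule_maps_def)

lemma cou_map: "cou A \<in> bimodule_maps M R (Ub g) (Ub E)"
  by (simp add: cou_A FA_bimodule_map)

text \<open>Through the comparison maps the two tensor products with \<delta> become
  \<open>G(id \<box> d)\<close> and \<open>G(d \<box> id)\<close>, with \<open>d\<close> the arrow
  \<open>comult_arr\<close>. All maps are then module maps, and both sides equal
  \<open>ui3r g g g\<close> applied to the action of \<open>a\<close> on
  \<open>dot gg g (dot g g w w) w\<close>.\<close>

lemma cop_coassoc:
  assumes a: "a \<in> el g"
  shows "Asc N (Ub g) (Ub g) (Ub g) (TenH N (Ub g) (Ub g) (Ub g) (bim_ten M R (Ub g) (Ub g)) (id_el g) (cop A) (cop A a)) =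
    TenH N (Ub g) (bim_ten M R (Ub g) (Ub g)) (Ub g) (Ub g) (cop A) (id_el g) (cop A a)"
proof -
  let ?B = "bim_ten M R (Ub g) (Ub g)"
  let ?r = "TenH N (Ub g) (Ub g) (Ub g) ?B (id_el g) (cop A)"
  let ?l = "TenH N (Ub g) ?B (Ub g) (Ub g) (cop A) (id_el g)"
  let ?gr = "Ten C g gg" and ?gl = "Ten C gg g"
  have t: "two_sided (Ub g)" "two_sided ?B"
    by simp_all
  have m: "\<And>x r. x \<in> el g \<Longrightarrow> r \<in> el E \<Longrightarrow> cop A (rmul (Ub g) x r) = rmul ?B (cop A x) r"
    "\<And>x r. x \<in> el g \<Longrightarrow> r \<in> el E \<Longrightarrow> cop A (lmul (Ub g) r x) = lmul ?B r (cop A x)"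
    using cop_map by (simp_all add: bimodule_maps_iff)
  have r: "?r \<in> vhom V (BT g g) (BT3l g g g)"
    and r_bb: "\<And>x y. x \<in> el g \<Longrightarrow> y \<in> el g \<Longrightarrow> ?r (bb g g x y) = be (Ub g) ?B x (cop A y)"
    using m cop_vhom vhom_id[OF vobj_G[OF g]] racr_closed[of g]
      TenH_N_vhom[OF t(1,1,1,2), of "id_el g" "cop A"] TenH_N_be[OF t(1,1,1,2), of "id_el g" "cop A"]
    by (simp_all flip: racr_def lact_def)
  have l: "?l \<in> vhom V (BT g g) (BT3r g g g)"
    and l_bb: "\<And>x y. x \<in> el g \<Longrightarrow> y \<in> el g \<Longrightarrow> ?l (bb g g x y) = be ?B (Ub g) (cop A x) y"
    using m cop_vhom vhom_id[OF vobj_G[OF g]] lact_closed[of g]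
      TenH_N_vhom[OF t(1,1,2,1), of "cop A" "id_el g"] TenH_N_be[OF t(1,1,2,1), of "cop A" "id_el g"]
    by (simp_all flip: racr_def lact_def)
  have 1: "u3l g g g (?r p) = FA G gg ?gr (TenH C g g g gg (Ide C g) comult_arr) (u g g p)" if p: "p \<in> carrier (BT g g)" for p
  proof (rule BT_eqI[OF g g _ _ _ _ p])
    show "vlin V (BT g g) (FO G ?gr) (\<lambda>p. u3l g g g (?r p))"
      by (rule vlin_comp[OF vhom_vlin[OF r] vhom_vlin[OF u3l_vhom]]) simp_all
    show "vlin V (BT g g) (FO G ?gr) (\<lambda>p. FA G gg ?gr (TenH C g g g gg (Ide C g) comult_arr) (u g g p))"
      by (rule vlin_comp[OF vhom_vlin[OF u_vhom] vhom_vlin[OF FA_vhom]]) auto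
    show "u3l g g g (?r (bb g g x y)) = FA G gg ?gr (TenH C g g g gg (Ide C g) comult_arr) (u g g (bb g g x y))"
      if "x \<in> el g" "y \<in> el g" for x y
      using that by (simp add: r_bb u3l_be u_bb FA_TenH_dot FA_Ide cop_closed cop_A)
  qed simp
  have 2: "?l p = ui3r g g g (FA G gg ?gl (TenH C g gg g g comult_arr (Ide C g)) (u g g p))" if p: "p \<in> carrier (BT g g)" for p
  proof (rule BT_eqI[OF g g _ _ _ _ p])
    show "vlin V (BT g g) (BT3r g g g) ?l"
      by (rule vhom_vlin[OF l])
    show "vlin V (BT g g) (BT3r g g g) (\<lambda>p. ui3r g g g (FA G gg ?gl (TenH C g gg g g comult_arr (Ide C g)) (u g g p)))"
      by (rule vlin_comp[OF vlin_comp[OF vhom_vlin[OF u_vhom] vhom_vlin[OF FA_vhom]] vhom_vlin[OF ui3r_vhom]]) auto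
    show "?l (bb g g x y) = ui3r g g g (FA G gg ?gl (TenH C g gg g g comult_arr (Ide C g)) (u g g (bb g g x y)))"
      if "x \<in> el g" "y \<in> el g" for x y
      using that by (simp add: l_bb ui3r_dot u_bb FA_TenH_dot FA_Ide cop_A)
  qed (use t in simp)
  have c: "cop A a \<in> carrier (BT g g)"
    using a by (rule cop_closed)
  have "?r (cop A a) \<in> carrier (BT3l g g g)"
    using vhom_closed[OF r c] .
  then have "Asc N (Ub g) (Ub g) (Ub g) (?r (cop A a)) =
      ui3r g g g (FA G ?gr ?gl (Asc C g g g) (FA G gg ?gr (TenH C g g g gg (Ide C g) comult_arr) (u g g (cop A a))))"
    using c by (simp add: Asc_N compose_eq 1)
  also have "\<dots> = ui3r g g g (act ?gl (dot gg g (dot g g w w) w) a)"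
    using a by (simp add: u_cop FA_act FA_TenH_dot FA_Ide FA_comult_w FA_Asc_dot dot_closed)
  also have "\<dots> = ?l (cop A a)"
    using a c by (simp add: 2 u_cop FA_act FA_TenH_dot FA_Ide FA_comult_w dot_closed)
  finally show ?thesis .
qed

text \<open>These are the unit laws of \<open>U\<close>: its unit comparison is the identity, so the
  middle factor is a product of identities and disappears.\<close>

lemma Lun_N: "p \<in> carrier (BT E g) \<Longrightarrow> Lun N (Ub g) p = FA G (Ten C E g) g (Lun C g) (u E g p)"
  and Run_N: "p \<in> carrier (BT g E) \<Longrightarrow> Run N (Ub g) p = FA G (Ten C g E) g (Run C g) (u g E p)"
proof -
  have l: "compose (carrier (BT E g)) (FA G (Ten C E g) g (Lun C g)) (compose (carrier (BT E g)) (u E g)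
      (tenN E E g g (id_el E) (id_el g))) = Lun N (Ub g)"
    using monoidal_U unfolding monoidal_functor_def Let_def by (simp add: unit_bimod)
  have r: "compose (carrier (BT g E)) (FA G (Ten C g E) g (Run C g)) (compose (carrier (BT g E)) (u g E)
      (tenN g g E E (id_el g) (id_el E))) = Run N (Ub g)"
    using monoidal_U unfolding monoidal_functor_def Let_def by (simp add: unit_bimod)
  have id: "FA G (Ten C a b) (Ten C a b) (TenH C a a b b (Ide C a) (Ide C b)) z = z"
    if "a \<in> Obj C" "b \<in> Obj C" "z \<in> el (Ten C a b)" for a b z
    using that bifunctor_C by (simp add: vbifunctor_def FA_Ide)
  show "Lun N (Ub g) p = FA G (Ten C E g) g (Lun C g) (u E g p)" if "p \<in> carrier (BT E g)"
    using fun_cong[OF l, of p] that u_tenN[of E E g g "Ide C E" "Ide C g" p]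
    by (simp add: compose_eq FA_Ide_eq id u_closed)
  show "Run N (Ub g) p = FA G (Ten C g E) g (Run C g) (u g E p)" if "p \<in> carrier (BT g E)"
    using fun_cong[OF r, of p] that u_tenN[of g g E E "Ide C g" "Ide C E" p]
    by (simp add: compose_eq FA_Ide_eq id u_closed)
qed

text \<open>Applying \<epsilon> in one factor turns \<open>dot g g w w\<close> into a product of
  \<open>one\<close> with \<open>w\<close>, the unit constraint turns that into \<open>w\<close>,
  and \<open>w \<triangleleft> a = a\<close>.\<close>

lemma
  assumes a: "a \<in> el g"
  shows cop_counit_left: "Lun N (Ub g) (tenN g E g g (cou A) (id_el g) (cop A a)) = a"
    and cop_counit_right: "Run N (Ub g) (tenN g g g E (id_el g) (cou A) (cop A a)) = a"
proof -
  have c: "cop A a \<in> carrier (BT g g)"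
    using a by (rule cop_closed)
  show "Lun N (Ub g) (tenN g E g g (cou A) (id_el g) (cop A a)) = a"
    using u_tenN[of g E g g counit_arr "Ide C g" "cop A a"] vhom_closed[OF tenN_vhom[of g E g g counit_arr "Ide C g"] c] a c
    by (simp add: FA_Ide_eq cou_A Lun_N u_cop FA_act FA_TenH_dot FA_counit_w FA_Lun_dot w_act dot_closed)
  show "Run N (Ub g) (tenN g g g E (id_el g) (cou A) (cop A a)) = a"
    using u_tenN[of g g g E "Ide C g" counit_arr "cop A a"] vhom_closed[OF tenN_vhom[of g g g E "Ide C g" counit_arr] c] a c
    by (simp add: FA_Ide_eq cou_A Run_N u_cop FA_act FA_TenH_dot FA_counit_w FA_Run_dot w_act dot_closed)
qed

lemma comonoid_A: "is_comonoid N (A_bimod V T R A) (cop A) (cou A)"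
proof -
  let ?B = "bim_ten M R (Ub g) (Ub g)"
  have 1: "compose (el g) (Asc N (Ub g) (Ub g) (Ub g))
      (compose (el g) (TenH N (Ub g) (Ub g) (Ub g) ?B (id_el g) (cop A)) (cop A)) =
    compose (el g) (TenH N (Ub g) ?B (Ub g) (Ub g) (cop A) (id_el g)) (cop A)"
    by (auto simp: compose_def cop_coassoc)
  have 2: "compose (el g) (Lun N (Ub g)) (compose (el g) (tenN g E g g (cou A) (id_el g)) (cop A)) = id_el g"
    by (auto simp: compose_def cop_counit_left)
  have 3: "compose (el g) (Run N (Ub g)) (compose (el g) (tenN g g g E (id_el g) (cou A)) (cop A)) = id_el g"
    by (auto simp: compose_def cop_counit_right)
  show ?thesis
    using 1 2 3 cop_map cou_map unfolding A_bimod_eq is_comonoid_def Let_def by (simp add: unit_bimod)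
qed

text \<open>
  The map \<open>L\<^sub>x \<otimes>\<^sub>R L\<^sub>y\<close> of the Takeuchi product.
\<close>

definition left_mult :: "'v \<Rightarrow> 'v \<Rightarrow> 'v \<Rightarrow> 'v" where
  "left_mult x y = tenN g g g g (FA G g g (\<theta> g x)) (FA G g g (\<theta> g y))"

lemma A_ten_map_orbit:
  "x \<in> el g \<Longrightarrow> y \<in> el g \<Longrightarrow> A_ten_map V T R A (regular A) (regular A)
     (orbit T (tot A) (regular A) x) (orbit T (tot A) (regular A) y) = left_mult x y"
  unfolding A_bimod_eq unfolding regular_A left_mult_def by (simp add: orbit_K_obj)

lemma
  assumes "x \<in> el g" "y \<in> el g"
  shows left_mult_vhom: "left_mult x y \<in> vhom V (BT g g) (BT g g)"
    and left_mult_closed [simp, intro]: "p \<in> carrier (BT g g) \<Longrightarrow> left_mult x y p \<in> carrier (BT g g)"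
    and left_mult_bb: "x' \<in> el g \<Longrightarrow> y' \<in> el g \<Longrightarrow> left_mult x y (bb g g x' y') = bb g g (act g x x') (act g y y')"
proof -
  show 1: "left_mult x y \<in> vhom V (BT g g) (BT g g)"
    unfolding left_mult_def using assms by (intro tenN_vhom) auto
  show "p \<in> carrier (BT g g) \<Longrightarrow> left_mult x y p \<in> carrier (BT g g)"
    using vhom_closed[OF 1] .
  show "x' \<in> el g \<Longrightarrow> y' \<in> el g \<Longrightarrow> left_mult x y (bb g g x' y') = bb g g (act g x x') (act g y y')"
    unfolding left_mult_def act_def using assms by (intro tenN_bb) auto
qed

lemma BT_vobj: "vobj V (BT g g)"
  by simp

lemma left_mult_left_mult:
  assumes "x \<in> el g" "y \<in> el g" "x' \<in> el g" "y' \<in> el g" "p \<in> carrier (BT g g)"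
  shows "left_mult x y (left_mult x' y' p) = left_mult (act g x x') (act g y y') p"
  by (rule BT_eqI[OF g g BT_vobj vlin_comp[OF vhom_vlin[OF left_mult_vhom] vhom_vlin[OF left_mult_vhom]] vhom_vlin[OF left_mult_vhom] _ assms(5)])
    (use assms in \<open>simp_all add: left_mult_bb act_act act_closed\<close>)

text \<open>Linearity in each factor is reduced by \<open>vlin_in_parameter\<close> to pure tensors
  \<open>p\<close>, where it is linearity of the multiplication of \<open>A\<close>.\<close>

lemma left_mult_vbilin:
  assumes p: "p \<in> carrier (BT g g)"
  shows "vbilin V (FO G g) (FO G g) (BT g g) (\<lambda>x y. left_mult x y p)"
  unfolding vbilin_def
proof (intro conjI ballI)
  note gen = generates_be[OF two_sided_Ub[OF g] two_sided_Ub[OF g]]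
  note act_lin = act_vbilin[OF g, unfolded vbilin_def, THEN conjunct2, THEN bspec]
  note bb_lin = be_lin[OF two_sided_Ub[OF g] two_sided_Ub[OF g]]
  show "vlin V (FO G g) (BT g g) (\<lambda>y. left_mult x y p)" if x: "x \<in> el g" for x
  proof (rule vlin_in_parameter[OF gen vobj_G[OF g] BT_vobj _ _ p])
    show "vlin V (BT g g) (BT g g) (left_mult x y)" if "y \<in> el g" for y
      using vhom_vlin[OF left_mult_vhom[OF x that]] .
    show "vlin V (FO G g) (BT g g) (\<lambda>y. left_mult x y s)"
      if s: "s \<in> {bb g g x y |x y. x \<in> carrier (bob (Ub g)) \<and> y \<in> carrier (bob (Ub g))}" for s
    proof -
      obtain x' y' where s: "x' \<in> el g" "y' \<in> el g" "s = bb g g x' y'"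
        using s by auto
      have "vlin V (FO G g) (BT g g) (\<lambda>y. bb g g (act g x x') (act g y y'))"
        using vlin_comp[OF act_lin[OF s(2)] bb_lin(1)[unfolded bob_Ub, OF act_closed[OF g x s(1)]]] .
      then show ?thesis
        by (rule vlin_cong[OF vobj_G[OF g]]) (use x s in \<open>simp add: left_mult_bb\<close>)
    qed
  qed
  show "vlin V (FO G g) (BT g g) (\<lambda>x. left_mult x y p)" if y: "y \<in> el g" for y
  proof (rule vlin_in_parameter[OF gen vobj_G[OF g] BT_vobj _ _ p])
    show "vlin V (BT g g) (BT g g) (left_mult x y)" if "x \<in> el g" for x
      using vhom_vlin[OF left_mult_vhom[OF that y]] .
    show "vlin V (FO G g) (BT g g) (\<lambda>x. left_mult x y s)"
      if s: "s \<in> {bb g g x y |x y. x \<in> carrier (bob (Ub g)) \<and> y \<in> carrier (bob (Ub g))}" for s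
    proof -
      obtain x' y' where s: "x' \<in> el g" "y' \<in> el g" "s = bb g g x' y'"
        using s by auto
      have "vlin V (FO G g) (BT g g) (\<lambda>x. bb g g (act g x x') (act g y y'))"
        using vlin_comp[OF act_lin[OF s(1)] bb_lin(2)[unfolded bob_Ub, OF act_closed[OF g y s(2)]]] .
      then show ?thesis
        by (rule vlin_cong[OF vobj_G[OF g]]) (use y s in \<open>simp add: left_mult_bb\<close>)
    qed
  qed
qed

section \<open>The Takeuchi product and multiplicativity of the comultiplication\<close>

abbreviation "P \<equiv> takeuchi_obj V T R A"

lemma takeuchi_obj_eq:
  "P = (BT g g)\<lparr>carrier := {z \<in> carrier (BT g g). \<forall>r\<in>el E. left_mult (src A r) w z = left_mult w (tgt A r) z}\<rparr>"
proof -
  have "left_mult (src A r) w = A_ten_map V T R A (regular A) (regular A)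
      (orbit T (tot A) (regular A) (src A r)) (orbit T (tot A) (regular A) w)"
    "left_mult w (tgt A r) = A_ten_map V T R A (regular A) (regular A)
      (orbit T (tot A) (regular A) w) (orbit T (tot A) (regular A) (tgt A r))" if "r \<in> el E" for r
    using that A_ten_map_orbit[of "src A r" w] A_ten_map_orbit[of w "tgt A r"] by auto
  then show ?thesis
    unfolding takeuchi_obj_def Let_def A_bimod_eq mone_A by (simp cong: conj_cong)
qed

lemma takeuchi_iff:
  "z \<in> carrier P \<longleftrightarrow> z \<in> carrier (BT g g) \<and> (\<forall>r\<in>el E. left_mult (src A r) w z = left_mult w (tgt A r) z)"
  by (simp add: takeuchi_obj_eq)

lemma takeuchi_vobj: "vobj V P"
  unfolding takeuchi_obj_eq
  by (rule vobj_restrict_carrier[OF base_ok BT_vobj BT_vobj]) (auto intro!: vhom_vlin left_mult_vhom)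

lemma vlin_takeuchi: "vlin V X P f \<longleftrightarrow> vlin V X (BT g g) f \<and> f \<in> carrier X \<rightarrow> carrier P"
  unfolding takeuchi_obj_eq by (subst vlin_restrict_carrier) auto

lemma vlin_from_takeuchi: "vlin V (BT g g) X f \<Longrightarrow> vlin V P X f"
  unfolding takeuchi_obj_eq by (rule vlin_from_restrict_carrier) auto

text \<open>Since \<open>x \<cdot> r = x s(r)\<close>, the map for \<open>(x \<cdot> r, y)\<close>
  first multiplies \<open>z\<close> by \<open>s(r)\<close> in the left factor. The Takeuchi
  condition replaces this by \<open>t(r)\<close> in the right factor, which gives the map for
  \<open>(x, r \<cdot> y)\<close>; so the assignment is balanced.\<close>

lemma takeuchi_mult_ex:
  assumes z: "z \<in> carrier P"
  shows "\<exists>k. k \<in> vhom V (BT g g) (BT g g) \<and> (\<forall>x\<in>el g. \<forall>y\<in>el g. k (bb g g x y) = left_mult x y z)"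
proof -
  have z': "z \<in> carrier (BT g g)" and bal: "\<And>r. r \<in> el E \<Longrightarrow> left_mult (src A r) w z = left_mult w (tgt A r) z"
    using z by (auto simp: takeuchi_iff)
  have "left_mult (racr g x r) y z = left_mult x (lact g r y) z" if "x \<in> el g" "r \<in> el E" "y \<in> el g" for x r y
  proof -
    have "left_mult (racr g x r) y z = left_mult x y (left_mult (src A r) w z)"
      using that z' by (simp add: left_mult_left_mult act_w) (simp add: src_A act_racr act_w)
    also have "\<dots> = left_mult x (lact g r y) z"
      using that z' by (simp add: bal left_mult_left_mult act_w) (simp add: tgt_A act_lact act_w)
    finally show ?thesis .
  qed
  then show ?thesis
    using bt_lift_ex[OF two_sided_Ub[OF g] two_sided_Ub[OF g] BT_vobj, of "\<lambda>x y. left_mult x y z"] left_mult_vbilin[OF z']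
    by (simp flip: lact_def racr_def)
qed

text \<open>The arguments are swapped so that \<open>tm z\<close> is right multiplication by
  \<open>z\<close>, the endomorphism that the definition of the product singles out.\<close>

abbreviation "tm z w' \<equiv> takeuchi_mult V T R A w' z"

lemma
  assumes z: "z \<in> carrier P"
  shows tm_vhom: "tm z \<in> vhom V (BT g g) (BT g g)"
    and tm_bb: "x \<in> el g \<Longrightarrow> y \<in> el g \<Longrightarrow> tm z (bb g g x y) = left_mult x y z"
proof -
  obtain k where k: "k \<in> vhom V (BT g g) (BT g g)" "\<And>x y. x \<in> el g \<Longrightarrow> y \<in> el g \<Longrightarrow> k (bb g g x y) = left_mult x y z"
    using takeuchi_mult_ex[OF z] by blast
  have "(THE h. h \<in> vhom V (BT g g) (BT g g) \<and> (\<forall>x\<in>el g. \<forall>y\<in>el g. h (bb g g x y) =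
      A_ten_map V T R A (regular A) (regular A) (orbit T (tot A) (regular A) x) (orbit T (tot A) (regular A) y) z)) = k"
  proof (rule the_equality)
    show "h = k" if "h \<in> vhom V (BT g g) (BT g g) \<and> (\<forall>x\<in>el g. \<forall>y\<in>el g. h (bb g g x y) =
      A_ten_map V T R A (regular A) (regular A) (orbit T (tot A) (regular A) x) (orbit T (tot A) (regular A) y) z)" for h
      using that k
      by (intro bepi_unique[OF two_sided_Ub[OF g] two_sided_Ub[OF g] BT_vobj _ k(1)])
        (simp_all only: A_ten_map_orbit bob_Ub)
  qed (use k regular_A in \<open>simp add: rmod_bimod_K_obj orbit_K_obj left_mult_def\<close>)
  then have tm: "tm z = k"
    unfolding takeuchi_mult_def Let_def A_bimod_eq by (simp only: mob_tot)
  show "tm z \<in> vhom V (BT g g) (BT g g)" "x \<in> el g \<Longrightarrow> y \<in> el g \<Longrightarrow> tm z (bb g g x y) = left_mult x y z"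
    using k tm fun_cong[OF tm, of "bb g g x y"] by simp_all
qed

lemma tm_left_mult:
  assumes z: "z \<in> carrier P" and xy: "x \<in> el g" "y \<in> el g" and p: "p \<in> carrier (BT g g)"
  shows "tm z (left_mult x y p) = left_mult x y (tm z p)"
proof (rule BT_eqI[OF g g BT_vobj _ _ _ p])
  note 1 = vhom_vlin[OF tm_vhom[OF z]] and 2 = vhom_vlin[OF left_mult_vhom[OF xy]]
  show "vlin V (BT g g) (BT g g) (\<lambda>p. tm z (left_mult x y p))" "vlin V (BT g g) (BT g g) (\<lambda>p. left_mult x y (tm z p))"
    using vlin_comp[OF 2 1] vlin_comp[OF 1 2] by simp_all
  show "tm z (left_mult x y (bb g g x' y')) = left_mult x y (tm z (bb g g x' y'))" if "x' \<in> el g" "y' \<in> el g" for x' y'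
    using z xy that by (simp add: left_mult_bb tm_bb left_mult_left_mult takeuchi_iff act_closed)
qed

text \<open>Left multiplications commute with right multiplication by \<open>z\<close>, so the
  Takeuchi condition passes from \<open>p\<close> to the product of \<open>p\<close> and
  \<open>z\<close>.\<close>

lemma tm_closed: 
  assumes z: "z \<in> carrier P" and p: "p \<in> carrier P"
  shows "tm z p \<in> carrier P"
proof -
  have p': "p \<in> carrier (BT g g)"
    using p by (simp add: takeuchi_iff)
  show ?thesis
    using vhom_closed[OF tm_vhom[OF z] p'] p by (simp add: takeuchi_iff flip: tm_left_mult[OF z _ _ p'])
qed

lemma tm_vbilin: "vbilin V P P P (takeuchi_mult V T R A)"
  unfolding vbilin_def
proof (intro conjI ballI)
  show "vlin V P P (\<lambda>p. tm z p)" if z: "z \<in> carrier P" for z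
    unfolding vlin_takeuchi using tm_closed[OF z] vlin_from_takeuchi[OF vhom_vlin[OF tm_vhom[OF z]]] by auto
  fix p assume p: "p \<in> carrier P"
  have p': "p \<in> carrier (BT g g)"
    using p by (simp add: takeuchi_iff)
  have "vlin V P (BT g g) (\<lambda>z. tm z p)"
  proof (rule vlin_in_parameter[OF generates_be[OF two_sided_Ub[OF g] two_sided_Ub[OF g]] takeuchi_vobj BT_vobj _ _ p'])
    show "vlin V (BT g g) (BT g g) (tm z)" if "z \<in> carrier P" for z
      using vhom_vlin[OF tm_vhom[OF that]] .
    show "vlin V P (BT g g) (\<lambda>z. tm z s)"
      if s: "s \<in> {bb g g x y |x y. x \<in> carrier (bob (Ub g)) \<and> y \<in> carrier (bob (Ub g))}" for s
    proof -
      obtain x y where s: "x \<in> el g" "y \<in> el g" "s = bb g g x y"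
        using s by auto
      show ?thesis
        by (rule vlin_cong[OF takeuchi_vobj vlin_from_takeuchi[OF vhom_vlin[OF left_mult_vhom[OF s(1,2)]]]])
          (simp add: s tm_bb)
    qed
  qed
  then show "vlin V P P (takeuchi_mult V T R A p)"
    unfolding vlin_takeuchi using tm_closed[OF _ p] by auto
qed

text \<open>Here \<open>s(r) = w \<cdot> r\<close> and \<open>t(r) = r \<cdot> w\<close>, so the
  Takeuchi condition for the unit is the balancing relation itself.\<close>

lemma bb_w_takeuchi: "bb g g w w \<in> carrier P"
  using be_balanced[OF two_sided_Ub[OF g] two_sided_Ub[OF g], of w _ w]
  by (simp add: takeuchi_iff bb_closed left_mult_bb act_w src_closed tgt_closed)
    (simp add: src_A tgt_A bract_mul blact_mul flip: racr_def lact_def)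

text \<open>By \<open>u_tenN_cop\<close> the two sides become the action of \<open>a\<close> on
  \<open>dot g g (s r) w\<close> and on \<open>dot g g w (t r)\<close>. These elements agree because
  \<open>dot\<close> is balanced, and \<open>u\<close> is injective.\<close>

lemma cop_takeuchi: "a \<in> el g \<Longrightarrow> cop A a \<in> carrier P"
proof -
  assume a: "a \<in> el g"
  have "left_mult (src A r) w (cop A a) = left_mult w (tgt A r) (cop A a)" if r: "r \<in> el E" for r
  proof -
    have "u g g (left_mult (src A r) w (cop A a)) = act gg (dot g g (src A r) w) a"
      unfolding left_mult_def by (rule u_tenN_cop) (use a r in auto)
    also have "\<dots> = act gg (dot g g w (tgt A r)) a"
      using dot_balanced[OF g g w_closed r w_closed] r by (simp add: src_A tgt_A)
    also have "\<dots> = u g g (left_mult w (tgt A r) (cop A a))"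
      unfolding left_mult_def by (rule u_tenN_cop[symmetric]) (use a r in auto)
    finally have "u g g (left_mult (src A r) w (cop A a)) = u g g (left_mult w (tgt A r) (cop A a))" .
    then have "ui g g (u g g (left_mult (src A r) w (cop A a))) = ui g g (u g g (left_mult w (tgt A r) (cop A a)))"
      by (rule arg_cong)
    then show ?thesis
      using a r by (simp add: cop_closed src_closed tgt_closed)
  qed
  then show ?thesis
    using a by (simp add: takeuchi_iff cop_closed)
qed

text \<open>On pure tensors this is \<open>u_tenN_cop\<close>, and both sides are linear in
  \<open>p\<close>.\<close>

lemma u_tm_cop:
  assumes b: "b \<in> el g" and p: "p \<in> carrier (BT g g)"
  shows "u g g (tm (cop A b) p) = act gg (u g g p) b"
proof (rule BT_eqI[OF g g _ _ _ _ p])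
  show "vlin V (BT g g) (FO G gg) (\<lambda>p. u g g (tm (cop A b) p))"
    using vlin_comp[OF vhom_vlin[OF tm_vhom[OF cop_takeuchi[OF b]]] vhom_vlin[OF u_vhom[OF g g]]] .
  have "vlin V (FO G gg) (FO G gg) (\<lambda>z. act gg z b)"
    using act_vbilin[of gg] b by (simp add: vbilin_def)
  then show "vlin V (BT g g) (FO G gg) (\<lambda>p. act gg (u g g p) b)"
    by (rule vlin_comp[OF vhom_vlin[OF u_vhom[OF g g]]])
  show "u g g (tm (cop A b) (bb g g x y)) = act gg (u g g (bb g g x y)) b" if "x \<in> el g" "y \<in> el g" for x y
    unfolding tm_bb[OF cop_takeuchi[OF b] that] left_mult_def u_bb[OF g g that]
    by (rule u_tenN_cop) (use that b in auto)
qed simp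

lemma cop_morphism: "monoid_morphism M (tot A) (takeuchi_monoid V T R A) (cop A)"
proof (rule monoid_morphismI)
  let ?P = "takeuchi_monoid V T R A"
  have mob: "mob ?P = P" and mmu: "mmu ?P = tlift V T P P P (takeuchi_mult V T R A)"
    by (simp_all add: takeuchi_monoid_def Let_def)
  have "mun ?P = (THE h. h \<in> vhom V I P \<and> h (uel T) = bb g g w w)"
    unfolding takeuchi_monoid_def Let_def A_bimod_eq mone_A by simp
  also have "\<dots> = unit_map P (bb g g w w)"
    using unit_map_vhom[OF takeuchi_vobj bb_w_takeuchi] unit_map_uel[OF takeuchi_vobj bb_w_takeuchi]
      vhom_unit_eqI[OF takeuchi_vobj] by (intro the_equality) auto
  finally have mun: "mun ?P = unit_map P (bb g g w w)" .
  show "vobj V (mob ?P)"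
    unfolding mob by (rule takeuchi_vobj)
  show "mmu ?P \<in> vhom V (tobj T (mob ?P) (mob ?P)) (mob ?P)"
    unfolding mob mmu by (intro tlift_vhom takeuchi_vobj tm_vbilin)
  show "mun ?P \<in> vhom V I (mob ?P)"
    unfolding mob mun by (rule unit_map_vhom[OF takeuchi_vobj bb_w_takeuchi])
  show "cop A \<in> vhom V (mob (tot A)) (mob ?P)"
    using cop_vhom cop_takeuchi by (auto simp: mob vhom_def vlin_takeuchi)
  show "cop A (mone T (tot A)) = mone T ?P"
    using unit_map_uel[OF takeuchi_vobj bb_w_takeuchi]
    by (simp add: mone_A) (simp add: mone_def mun cop_A FA_comult_w ui_dot)
  show "cop A (mmul T (tot A) a b) = mmul T ?P (cop A a) (cop A b)"
    if ab: "a \<in> carrier (mob (tot A))" "b \<in> carrier (mob (tot A))" for a b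
  proof -
    have ab: "a \<in> el g" "b \<in> el g"
      using ab by simp_all
    have P: "cop A a \<in> carrier P" "cop A b \<in> carrier P"
      using ab cop_takeuchi by simp_all
    have "mmul T ?P (cop A a) (cop A b) = tm (cop A b) (cop A a)"
      unfolding mmul_def mob mmu using P by (intro tlift_tel takeuchi_vobj tm_vbilin)
    \<comment> \<open>With right multiplication by \<delta>(b) turned into the action of
      \<open>b\<close>, multiplicativity is associativity of the action on
      \<open>G(g \<box> g)\<close>.\<close>
    moreover have "u g g (tm (cop A b) (cop A a)) = u g g (cop A (act g a b))"
      using ab by (simp add: u_tm_cop cop_closed u_cop act_act act_closed dot_closed)
    moreover have "tm (cop A b) (cop A a) \<in> carrier (BT g g)"
      using tm_closed[OF P(2,1)] by (simp add: takeuchi_iff)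
    ultimately have "mmul T ?P (cop A a) (cop A b) = cop A (act g a b)"
      using ab by (metis ui_u g cop_closed act_closed)
    then show ?thesis
      using ab by (simp add: mmul_A)
  qed
qed (use mmu_A mun_A in simp_all)

lemma bialgebroid_A: "right_bialgebroid V T R A"
proof -
  have "cou A (mone T (tot A)) = rone"
    by (simp add: mone_A cou_A FA_counit_w rone_eq)
  moreover have "cou A (mmul T (tot A) (src A (cou A a)) b) = cou A (mmul T (tot A) a b) \<and>
      cou A (mmul T (tot A) a b) = cou A (mmul T (tot A) (tgt A (cou A a)) b)" if "a \<in> el g" "b \<in> el g" for a b
  proof -
    have "cou A a \<in> el E"
      using that by (simp add: cou_A FA_closed)
    \<comment> \<open>As \<epsilon> is a module map and inverts \<open>s\<close> and
      \<open>t\<close> from the left, all three expressions equal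
      \<open>\<epsilon>(a) \<triangleleft> b\<close>.\<close>
    then show ?thesis
      using that by (simp add: mmul_A src_closed tgt_closed cou_act cou_src cou_tgt)
  qed
  ultimately show ?thesis
    using monoid_R monoid_A src_morphism tgt_morphism src_tgt_commute comonoid_A cop_morphism
    unfolding right_bialgebroid_def Let_def by simp
qed

section \<open>The comparison functor\<close>

abbreviation "D \<equiv> rmod_cat V T R A"

lemma rmod_cat_simps [simp]:
  "Obj D = {X. is_rmodule M (tot A) X}" "carrier (Hom D X Y) = rmodule_maps M (tot A) X Y"
  "Cmp D X Y Z k f = compose (carrier (rob X)) k f" "Ide D X = (\<lambda>x\<in>carrier (rob X). x)"
  "Ten D = rmod_ten V T R A" "Unt D = rmod_unit V T R A"
  "TenH D X X' Y Y' f k = TenH N (rmod_bimod V T R A X) (rmod_bimod V T R A X')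
     (rmod_bimod V T R A Y) (rmod_bimod V T R A Y') f k"
  "Asc D X Y Z = Asc N (rmod_bimod V T R A X) (rmod_bimod V T R A Y) (rmod_bimod V T R A Z)"
  "Lun D X = Lun N (rmod_bimod V T R A X)" "Run D X = Run N (rmod_bimod V T R A X)"
  by (simp_all add: rmod_cat_def Let_def)

lemma Hom_rmod_cat: "Hom D X Y = (vhomobj V (rob X) (rob Y))\<lparr>carrier := rmodule_maps M (tot A) X Y\<rparr>"
  by (simp add: rmod_cat_def Let_def)

declare rmod_bimod_K_obj [simp]

lemma rob_rmod_ten [simp]:
  "rob (rmod_ten V T R A X Y) = bt (rmod_bimod V T R A X) (rmod_bimod V T R A Y)"
  by (simp add: rmod_ten_def Let_def)

section \<open>Products of the modules K a and K b\<close>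

lemma act_u_vbilin:
  assumes ab: "a \<in> Obj C" "b \<in> Obj C"
  shows "vbilin V (BT a b) (FO G g) (BT a b) (\<lambda>p c. ui a b (act (Ten C a b) (u a b p) c))"
proof -
  note l = act_vbilin[OF Ten_Obj[OF ab], unfolded vbilin_def]
  have "vlin V (FO G g) (BT a b) (\<lambda>c. ui a b (act (Ten C a b) (u a b p) c))" if "p \<in> carrier (BT a b)" for p
    using vlin_comp[OF l[THEN conjunct1, THEN bspec] vhom_vlin[OF ui_vhom[OF ab]]] ab that by simp
  moreover have "vlin V (BT a b) (BT a b) (\<lambda>p. ui a b (act (Ten C a b) (u a b p) c))" if "c \<in> el g" for c
    using vlin_comp[OF vlin_comp[OF vhom_vlin[OF u_vhom[OF ab]] l[THEN conjunct2, THEN bspec, OF that]]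
        vhom_vlin[OF ui_vhom[OF ab]]] .
  ultimately show ?thesis
    by (simp add: vbilin_def)
qed

text \<open>The diagonal action is the action on \<open>G(a \<box> b)\<close> carried back along
  \<open>u\<close>: \<open>u_tenN_cop\<close> shows this on pure tensors, and these determine the
  action.\<close>

lemma ract_rmod_ten:
  assumes ab: "a \<in> Obj C" "b \<in> Obj C"
  shows "ract (rmod_ten V T R A (K_obj a) (K_obj b)) =
    tlift V T (BT a b) (FO G g) (BT a b) (\<lambda>p c. ui a b (act (Ten C a b) (u a b p) c))" (is "_ = ?p")
proof -
  note t = two_sided_Ub[OF ab(1)] two_sided_Ub[OF ab(2)]
  have Z: "vobj V (BT a b)"
    using ab by simp
  note bil = act_u_vbilin[OF ab]
  have p: "?p \<in> vhom V (tobj T (BT a b) (FO G g)) (BT a b)"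
    using Z bil by (intro tlift_vhom) auto
  have val: "tenN g a g b (FA G g a (\<theta> a x)) (FA G g b (\<theta> b y)) (cop A c) = ui a b (act (Ten C a b) (dot a b x y) c)"
    if xyc: "x \<in> el a" "y \<in> el b" "c \<in> el g" for x y c
  proof -
    have "tenN g a g b (FA G g a (\<theta> a x)) (FA G g b (\<theta> b y)) (cop A c) \<in> carrier (BT a b)"
      using ab xyc by (intro vhom_closed[OF tenN_vhom]) auto
    then show ?thesis
      using ui_u[OF ab] u_tenN_cop[OF ab xyc] by metis
  qed
  have p_bb: "?p (tel T (BT a b) (FO G g) (bb a b x y) c) = ui a b (act (Ten C a b) (dot a b x y) c)"
    if "x \<in> el a" "y \<in> el b" "c \<in> el g" for x y c
    using that ab by (subst tlift_tel[OF Z vobj_G[OF g] Z bil]) (simp_all add: u_bb bb_closed)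
  have "(THE p. p \<in> vhom V (tobj T (BT a b) (FO G g)) (BT a b) \<and>
      (\<forall>x\<in>el a. \<forall>y\<in>el b. \<forall>c\<in>el g. p (tel T (BT a b) (FO G g) (bb a b x y) c) =
        TenH N (Ub g) (Ub a) (Ub g) (Ub b) (orbit T (tot A) (K_obj a) x) (orbit T (tot A) (K_obj b) y) (cop A c))) = ?p"
  proof (rule the_equality)
    show "?p \<in> vhom V (tobj T (BT a b) (FO G g)) (BT a b) \<and>
      (\<forall>x\<in>el a. \<forall>y\<in>el b. \<forall>c\<in>el g. ?p (tel T (BT a b) (FO G g) (bb a b x y) c) =
        TenH N (Ub g) (Ub a) (Ub g) (Ub b) (orbit T (tot A) (K_obj a) x) (orbit T (tot A) (K_obj b) y) (cop A c))"
      using p p_bb val ab by (simp add: orbit_K_obj)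
    fix h assume h: "h \<in> vhom V (tobj T (BT a b) (FO G g)) (BT a b) \<and>
      (\<forall>x\<in>el a. \<forall>y\<in>el b. \<forall>c\<in>el g. h (tel T (BT a b) (FO G g) (bb a b x y) c) =
        TenH N (Ub g) (Ub a) (Ub g) (Ub b) (orbit T (tot A) (K_obj a) x) (orbit T (tot A) (K_obj b) y) (cop A c))"
    then have h_bb: "h (tel T (BT a b) (FO G g) (bb a b x y) c) = ui a b (act (Ten C a b) (dot a b x y) c)"
      if "x \<in> el a" "y \<in> el b" "c \<in> el g" for x y c
      using that val ab by (simp add: orbit_K_obj)
    show "h = ?p"
      by (rule vhom_ext[OF conjunct1[OF h] p],
        rule generatesD[OF generates_tobj[OF Z vobj_G[OF g] generates_be[OF t] generates_carrier] Z
            vhom_vlin[OF conjunct1[OF h]] vhom_vlin[OF p]])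
        (auto simp: h_bb p_bb)
  qed
  then show ?thesis
    using ab unfolding rmod_ten_def Let_def A_bimod_eq by simp
qed

lemma
  assumes ab: "a \<in> Obj C" "b \<in> Obj C"
  shows ract_ten_vhom: "ract (rmod_ten V T R A (K_obj a) (K_obj b)) \<in> vhom V (tobj T (BT a b) (FO G g)) (BT a b)"
    and ract_el_ten: "p \<in> carrier (BT a b) \<Longrightarrow> c \<in> el g \<Longrightarrow>
      ract_el T (tot A) (rmod_ten V T R A (K_obj a) (K_obj b)) p c = ui a b (act (Ten C a b) (u a b p) c)"
  using ab act_u_vbilin[OF ab] by (simp_all add: ract_el_def ract_rmod_ten tlift_vhom tlift_tel)

text \<open>The \<open>A\<close>-action and both \<open>R\<close>-actions on the product are all
  carried back along the same map \<open>u\<close>, so this reduces to the corresponding fact for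
  \<open>G(a \<box> b)\<close>. As a rewrite rule it turns coherence maps between products of
  modules into those of bimodules.\<close>

lemma rmod_bimod_ten [simp]:
  assumes ab: "a \<in> Obj C" "b \<in> Obj C"
  shows "rmod_bimod V T R A (rmod_ten V T R A (K_obj a) (K_obj b)) = bim_ten M R (Ub a) (Ub b)"
proof (rule bimod.equality)
  let ?X = "rmod_ten V T R A (K_obj a) (K_obj b)"
  note t = two_sided_bim_ten_Ub[OF ab]
  have Z: "vobj V (BT a b)"
    using ab by simp
  have "tlift V T (FO G E) (BT a b) (BT a b) (\<lambda>r x. ract_el T (tot A) ?X x (tgt A r)) = blact (bim_ten M R (Ub a) (Ub b))"
    using ab blact_vhom[OF t] lmul_bb[OF ab]
    by (intro tlift_eqI Z) (auto simp: ract_el_ten tgt_closed, simp add: tgt_A act_lact act_w u_closed)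
  then show "blact (rmod_bimod V T R A ?X) = blact (bim_ten M R (Ub a) (Ub b))"
    using ab by (simp add: rmod_bimod_def[of V T R A ?X])
  have "tlift V T (BT a b) (FO G E) (BT a b) (\<lambda>x r. ract_el T (tot A) ?X x (src A r)) = bract (bim_ten M R (Ub a) (Ub b))"
    using ab bract_vhom[OF t] rmul_bb[OF ab]
    by (intro tlift_eqI Z) (auto simp: ract_el_ten src_closed, simp add: src_A act_racr act_w u_closed)
  then show "bract (rmod_bimod V T R A ?X) = bract (bim_ten M R (Ub a) (Ub b))"
    using ab by (simp add: rmod_bimod_def[of V T R A ?X])
qed (use ab in \<open>simp_all add: rmod_bimod_def[of V T R A "rmod_ten V T R A (K_obj a) (K_obj b)"]\<close>)

text \<open>The action on the unit module is \<open>\<epsilon>(s(r) a) = \<epsilon>(s(r))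
  \<triangleleft> a = r \<triangleleft> a\<close>.\<close>

lemma rmod_unit_eq [simp]: "rmod_unit V T R A = K_obj E"
proof -
  have "tlift V T (FO G E) (FO G g) (FO G E) (\<lambda>r a. cou A (mmul T (tot A) (src A r) a)) = ract (K_obj E)"
    using ract_K_obj[OF E] ract_el_K_obj[OF E]
    by (intro tlift_eqI) (simp_all add: mmul_A cou_act cou_src src_closed ract_el_def)
  then show ?thesis
    by (simp add: rmod_unit_def K_obj_def)
qed

section \<open>The functor K and the natural isomorphism\<close>

definition K :: "('o, 'v, ('k, 'v) vrmod, 'v \<Rightarrow> 'v) monfun" where
  "K = \<lparr>FO = K_obj, FA = FA G, F2 = F2 U, F0 = F0 U\<rparr>"

lemma K_simps [simp]: "FO K = K_obj" "FA K = FA G" "F2 K = F2 U" "F0 K = F0 U"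
  by (simp_all add: K_def)

lemma rmodule_K_obj: "c \<in> Obj C \<Longrightarrow> is_rmodule M (tot A) (K_obj c)"
  by (rule is_rmoduleI)
    (use mmu_A mun_A ract_K_obj in \<open>simp_all add: mmul_A mone_A ract_el_K_obj act_act act_w act_closed\<close>)

lemma FA_rmodule_map:
  "a \<in> Obj C \<Longrightarrow> b \<in> Obj C \<Longrightarrow> f \<in> arr C a b \<Longrightarrow> FA G a b f \<in> rmodule_maps M (tot A) (K_obj a) (K_obj b)"
  by (rule rmodule_mapsI) (use ract_K_obj in \<open>simp_all add: ract_el_K_obj FA_act\<close>)

lemma vfunctor_K: "vfunctor V C D K"
proof -
  have "vlin V (Hom C a b) (Hom D (K_obj a) (K_obj b)) (FA G a b)" if ab: "a \<in> Obj C" "b \<in> Obj C" for a b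
  proof -
    have "rmodule_maps M (tot A) (K_obj a) (K_obj b) \<subseteq> carrier (vhomobj V (FO G a) (FO G b))"
      by (auto simp: rmodule_maps_def)
    then show ?thesis
      using FA_vlin[OF ab] FA_rmodule_map[OF ab] unfolding Hom_rmod_cat
      by (subst vlin_restrict_carrier) auto
  qed
  then show ?thesis
    using functor_G by (simp add: vfunctor_def rmodule_K_obj)
qed

text \<open>The action on the product was identified as the one carried back along \<open>u\<close>,
  so \<open>u\<close> and its inverse preserve actions.\<close>

lemma
  assumes ab: "a \<in> Obj C" "b \<in> Obj C"
  shows u_rmodule_map: "u a b \<in> rmodule_maps M (tot A) (rmod_ten V T R A (K_obj a) (K_obj b)) (K_obj (Ten C a b))"
    and ui_rmodule_map: "ui a b \<in> rmodule_maps M (tot A) (K_obj (Ten C a b)) (rmod_ten V T R A (K_obj a) (K_obj b))"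
  using ab ract_ten_vhom[OF ab] ract_K_obj[of "Ten C a b"] u_vhom[OF ab] ui_vhom[OF ab]
  by (auto intro!: rmodule_mapsI simp: ract_el_ten ract_el_K_obj)

lemma id_rmodule_map: "a \<in> Obj C \<Longrightarrow> id_el a \<in> rmodule_maps M (tot A) (K_obj a) (K_obj a)"
  using FA_rmodule_map[of a a "Ide C a"] by (simp add: FA_Ide_eq)

text \<open>After the rewrite rules for \<open>\<Phi>(K c)\<close>, for products and for the unit,
  the coherence equations of \<open>K\<close> are literally those of \<open>U\<close>. What remains
  is that the structure maps are module maps.\<close>

lemma monoidal_K: "monoidal_functor V C D K"
  using monoidal_U vfunctor_K u_rmodule_map id_rmodule_map[OF E]
  unfolding monoidal_functor_def Let_def
  by (simp add: unit_bimod)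

lemma strong_K: "strong_monoidal_functor V C D K"
proof -
  have "is_iso D (rmod_ten V T R A (K_obj a) (K_obj b)) (K_obj (Ten C a b)) (u a b)" if ab: "a \<in> Obj C" "b \<in> Obj C" for a b
  proof -
    have "compose (carrier (BT a b)) (ui a b) (u a b) = (\<lambda>x\<in>carrier (BT a b). x)"
      "compose (el (Ten C a b)) (u a b) (ui a b) = (\<lambda>x\<in>el (Ten C a b). x)"
      using ab by (auto simp: compose_def)
    then show ?thesis
      using u_rmodule_map[OF ab] ui_rmodule_map[OF ab] ab by (auto simp: is_iso_def)
  qed
  moreover have "is_iso D (K_obj E) (K_obj E) (id_el E)"
    using id_rmodule_map[OF E] vhom_compose_id[OF vhom_id[OF vobj_G[OF E]]] by (auto simp: is_iso_def)
  ultimately show ?thesis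
    using monoidal_K by (simp add: strong_monoidal_functor_def)
qed

text \<open>All components are identities, so compatibility with products is the factorization
  \<open>u_bq\<close> of the structure maps of \<open>G\<close> through the product over
  \<open>R\<close>.\<close>

lemma nat_iso_K:
  "monoidal_nat_iso C M G
     (monfun_comp C N M (bimod_forget M R) (monfun_comp C D N (rmod_forget V T R A) K)) id_el"
proof -
  have iso: "is_iso M (FO G a) (FO G a) (id_el a)" if "a \<in> Obj C" for a
    using that vhom_id[OF vobj_G[OF that]] vhom_compose_id[OF vhom_id[OF vobj_G[OF that]]]
    by (auto simp: is_iso_def)
  have nat: "compose (el a) (id_el b) (FA G a b f) = compose (el a) (FA G a b f) (id_el a)"
    if "a \<in> Obj C" "b \<in> Obj C" "f \<in> arr C a b" for a b f
    using FA_vhom[OF that] by (simp add: vhom_compose_id vhom_id_compose)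
  have ten: "TenH M (FO G a) (FO G a) (FO G b) (FO G b) (id_el a) (id_el b) = (\<lambda>x\<in>carrier (tobj T (FO G a) (FO G b)). x)"
    if "a \<in> Obj C" "b \<in> Obj C" for a b
    using that by (intro vhom_tobj_eqI[of "FO G a" "FO G b" "tobj T (FO G a) (FO G b)"])
      (auto intro!: TenH_vhom vhom_id simp: TenH_tel vhom_id)
  have F2: "compose (carrier (tobj T (FO G a) (FO G b))) (compose (carrier (BT a b)) (u a b) (\<lambda>x\<in>carrier (BT a b). x))
      (bq (Ub a) (Ub b)) = F2 G a b" if "a \<in> Obj C" "b \<in> Obj C" for a b
    using that u_bq[OF that] u_vhom[OF that] by (simp add: vhom_compose_id)
  have F0: "compose (carrier I) (compose (el E) (id_el E) (id_el E)) (F0 G) = F0 G"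
    using vhom_compose_id[OF vhom_id[OF vobj_G[OF E]]] vhom_id_compose[OF F0_vhom] by simp
  show ?thesis
    using iso nat ten F2 F0 vhom_id_compose[OF F2_vhom] vhom_compose_id[OF F2_vhom] vhom_id_compose[OF F0_vhom]
    by (simp add: monoidal_nat_iso_def nat_iso_def monfun_comp_def bimod_forget_def rmod_forget_def Let_def
        unit_bimod)
qed

end

theorem theorem4p2:
  fixes \<V> :: "'k base"
    and T :: "('k, 'v) tensor_data"
    and C :: "('k, 'o, 'v) moncat"
    and G :: "('o, 'v, ('k, 'v) module, 'v \<Rightarrow> 'v) monfun"
  assumes "base_ok \<V>"
    and "usual_tensor \<V> T"
    and "vmonoidal_category \<V> C"
    and "monoidal_functor \<V> C (base_cat \<V> T) G"
    and "representable \<V> T C G"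
    and "essentially_strong \<V> C (base_cat \<V> T) G"
  shows "\<exists>(R :: ('k, 'v) vmon) (A :: ('k, 'v) bialgebroid_data)
          (K :: ('o, 'v, ('k, 'v) vrmod, 'v \<Rightarrow> 'v) monfun) (\<theta> :: 'o \<Rightarrow> 'v \<Rightarrow> 'v).
           is_monoid (base_cat \<V> T) R \<and>
           right_bialgebroid \<V> T R A \<and>
           strong_monoidal_functor \<V> C (rmod_cat \<V> T R A) K \<and>
           monoidal_nat_iso C (base_cat \<V> T) G
             (monfun_comp C (bimod_cat (base_cat \<V> T) R) (base_cat \<V> T)
               (bimod_forget (base_cat \<V> T) R)
               (monfun_comp C (rmod_cat \<V> T R A) (bimod_cat (base_cat \<V> T) R)
                 (rmod_forget \<V> T R A) K))
             \<theta>"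
proof -
  obtain g \<theta> where "g \<in> Obj C" "nat_iso C (base_cat \<V> T) G (hom_functor C g) \<theta>"
    using assms(5) by (auto simp: representable_def)
  then interpret representable_monoidal \<V> T C G g \<theta>
    using assms by unfold_locales
  show ?thesis
    using monoid_R bialgebroid_A strong_K nat_iso_K by blast
qed

end
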